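(* Let $E$ be a $\sigma$-lattice effect algebra (respectively, a complete lattice effect algebra). For $x\in\mathcal{EO}(E)$ define $x^-:=f(x)$, where $f(t)=1-t$. Then, for $x,y,x_\alpha\in\mathcal{EO}(E)$ ($\alpha\in A$), with infima and suprema of observables taken with respect to the Olson order $\preceq_s$: (i) $y^-\preceq_s x^-$ if $x\preceq_s y$. (ii) $x^{--}=x$. (iii) $q_0^-=q_1$ and $q_1^-=q_0$. (iv) $(\bigwedge_\alpha x_\alpha)^-=\bigvee_\alpha x_\alpha^-$ and $(\bigvee_\alpha x_\alpha)^-=\bigwedge_\alpha x_\alpha^-$ if the index set $A$ is countable (respectively, if $A$ is an arbitrary set, when $E$ is a complete lattice effect algebra). (v) $q_a^-=q_{a'}$ for $a\in E$. (vi) $q_a\wedge q_b=q_{a\wedge b}$ and $q_a\vee q_b=q_{a\vee b}$ for $a,b\in E$. (vii) Let $g(t)=\min\{t,1-t\}$ and $h(t)=\max\{t,1-t\}$. Then $x\wedge x^-\preceq_s g(x)$ and $h(x)\preceq_s x\vee x^-$. (viii) For $a\in E$: $q_a$ is a sharp observable $\Leftrightarrow$ $a$ is a sharp element $\Leftrightarrow$ $q_a\wedge q_a^-=q_0$. In addition, $\mathcal{EO}(E)$ (with the map $x\mapsto x^-$) is an involution complete lattice with respect to the Olson order $\preceq_s$.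
   Context: An effect algebra is a partial algebra $(E;+,0,1)$ with a partially defined binary operation $+$ such that for all $a,b,c\in E$: (i) $a+b$ is defined iff $b+a$ is, and then $a+b=b+a$; (ii) $a+b$ and $(a+b)+c$ are defined iff $b+c$ and $a+(b+c)$ are defined, and then $(a+b)+c=a+(b+c)$; (iii) for each $a$ there is a unique $a'\in E$ with $a+a'=1$; (iv) if $a+1$ is defined, then $a=0$. The partial order is $a\le b$ iff $a+c=b$ for some $c\in E$. $E$ is a $\sigma$-lattice effect algebra (complete lattice effect algebra) if $(E,\le)$ is a lattice in which all countable (all) suprema and infima exist. An element $a\in E$ is sharp if $a\wedge a'$ exists and $a\wedge a'=0$. Let $\mathcal B(\mathbb R)$ be the Borel $\sigma$-algebra of $\mathbb R$. An observable on $E$ is a map $x:\mathcal B(\mathbb R)\to E$ such that (i) $x(\mathbb R)=1$; (ii) if $B\cap C=\emptyset$, then $x(B)+x(C)$ is defined and $x(B\cup C)=x(B)+x(C)$; (iii) if $B_i\subseteq B_{i+1}$ for all $i$ and $B=\bigcup_i B_i$, then $x(B)=\bigvee_i x(B_i)$. An observable $x$ is sharp if $x(B)$ is a sharp element for every $B\in\mathcal B(\mathbb R)$. The spectrum $\sigma(x)$ is the least closed set $K\subseteq\mathbb R$ with $x(K)=1$. $\mathcal{EO}(E)$ is the set of observables $x$ on $E$ with $\sigma(x)\subseteq[0,1]$. For a Borel function $f:\mathbb R\to\mathbb R$ and an observable $x$, $f(x)$ is the observable $f(x)(B)=x(f^{-1}(B))$. The Olson order on observables is: $x\preceq_s y$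 iff $y((-\infty,t))\le x((-\infty,t))$ for every $t\in\mathbb R$. For $a\in E$, the question observable $q_a$ is the observable with $q_a(\{0\})=a'$, $q_a(\{1\})=a$; i.e. $q_a(B)$ is $1$, $a$, $a'$ or $0$ according as $B$ contains both $0$ and $1$, only $1$, only $0$, or neither. An involution lattice is a lattice $(L,\le)$ with a map $^-:L\to L$ such that $a^{--}=a$ for all $a\in L$, and $a\le b$ implies $b^-\le a^-$. An involution complete lattice is an involution lattice that is a complete lattice (every family of elements has an infimum and a supremum).
   Formalization: In (vii) both inequalities are reversed, to g(x) ⪯_s x∧x^- and x∨x^- ⪯_s h(x), as the stated ones fail for q_{1/2} on E=[0,1]; EO(E) is an involution complete lattice for complete E, and for σ-lattice E an involution lattice with countable infima and suprema. *)

theory Defs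
  imports "HOL-Analysis.Analysis" "HOL-Algebra.Complete_Lattice"
begin

section \<open>Effect algebras\<close>

text \<open>The partial sum takes values in an option type; \<^term>\<open>None\<close> means "undefined".\<close>

record 'a effect_structure = "'a partial_object" +
  psum :: "'a \<Rightarrow> 'a \<Rightarrow> 'a option"
  ea_zero :: 'a
  ea_one :: 'a

locale effect_algebra =
  fixes E :: "('a, 'm) effect_structure_scheme" (structure)
  assumes zero_closed: "ea_zero E \<in> carrier E"
    and one_closed: "ea_one E \<in> carrier E"
    and psum_closed:
      "\<lbrakk>a \<in> carrier E; b \<in> carrier E; psum E a b = Some c\<rbrakk> \<Longrightarrow> c \<in> carrier E"
    and psum_commute:
      "\<lbrakk>a \<in> carrier E; b \<in> carrier E\<rbrakk> \<Longrightarrow> psum E a b = psum E b a"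
    \<comment> \<open>Equality of options: one side is defined iff the other is, and then the values agree.\<close>
    and psum_assoc:
      "\<lbrakk>a \<in> carrier E; b \<in> carrier E; c \<in> carrier E\<rbrakk> \<Longrightarrow>
        Option.bind (psum E a b) (\<lambda>s. psum E s c) = Option.bind (psum E b c) (\<lambda>s. psum E a s)"
    and orthosupplement:
      "a \<in> carrier E \<Longrightarrow> \<exists>!b. b \<in> carrier E \<and> psum E a b = Some (ea_one E)"
    and zero_one_law:
      "\<lbrakk>a \<in> carrier E; psum E a (ea_one E) \<noteq> None\<rbrakk> \<Longrightarrow> a = ea_zero E"

definition ea_compl :: "('a, 'm) effect_structure_scheme \<Rightarrow> 'a \<Rightarrow> 'a" where
  "ea_compl E a = (THE b. b \<in> carrier E \<and> psum E a b = Some (ea_one E))"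

definition ea_order :: "('a, 'm) effect_structure_scheme \<Rightarrow> 'a gorder" where
  "ea_order E =
    \<lparr> carrier = carrier E, eq = (=),
      le = (\<lambda>a b. \<exists>c\<in>carrier E. psum E a c = Some b) \<rparr>"

definition sharp_element :: "('a, 'm) effect_structure_scheme \<Rightarrow> 'a \<Rightarrow> bool" where
  "sharp_element E a \<longleftrightarrow>
    greatest (ea_order E) (ea_zero E) (Lower (ea_order E) {a, ea_compl E a})"


section \<open>Lattice-theoretic notions\<close>

text \<open>The locale names are qualified because HOL's type classes for lattices have the same
  base names.\<close>

locale sigma_lattice = Lattice.lattice L for L (structure) +
  assumes countable_sup_exists:
      "\<lbrakk>A \<subseteq> carrier L; countable A\<rbrakk> \<Longrightarrow> \<exists>s. least L s (Upper L A)"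
    and countable_inf_exists:
      "\<lbrakk>A \<subseteq> carrier L; countable A\<rbrakk> \<Longrightarrow> \<exists>i. greatest L i (Lower L A)"

locale involution_lattice = Lattice.lattice L for L (structure) +
  fixes neg :: "'a \<Rightarrow> 'a"
  assumes neg_closed: "a \<in> carrier L \<Longrightarrow> neg a \<in> carrier L"
    and neg_neg: "a \<in> carrier L \<Longrightarrow> neg (neg a) = a"
    and neg_antitone:
      "\<lbrakk>a \<in> carrier L; b \<in> carrier L; a \<sqsubseteq> b\<rbrakk> \<Longrightarrow> neg b \<sqsubseteq> neg a"

locale involution_complete_lattice =
  involution_lattice L neg + Complete_Lattice.complete_lattice L
  for L (structure) and neg


section \<open>Observables\<close>

text \<open>Observables are functions on the Borel sets only: they are required to be
  \<^term>\<open>undefined\<close> outside \<^term>\<open>sets borel\<close>, so that equality of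
  observables is equality of functions.\<close>

definition observable ::
    "('a, 'm) effect_structure_scheme \<Rightarrow> (real set \<Rightarrow> 'a) \<Rightarrow> bool" where
  "observable E x \<longleftrightarrow>
     x \<in> sets borel \<rightarrow>\<^sub>E carrier E \<and>
     x UNIV = ea_one E \<and>
     (\<forall>B\<in>sets borel. \<forall>C\<in>sets borel. B \<inter> C = {} \<longrightarrow> psum E (x B) (x C) = Some (x (B \<union> C))) \<and>
     (\<forall>B :: nat \<Rightarrow> real set. (\<forall>i. B i \<in> sets borel) \<and> (\<forall>i. B i \<subseteq> B (Suc i)) \<longrightarrow>
        least (ea_order E) (x (\<Union>i. B i)) (Upper (ea_order E) (range (\<lambda>i. x (B i)))))"

definition sharp_observable ::
    "('a, 'm) effect_structure_scheme \<Rightarrow> (real set \<Rightarrow> 'a) \<Rightarrow> bool" where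
  "sharp_observable E x \<longleftrightarrow> observable E x \<and> (\<forall>B\<in>sets borel. sharp_element E (x B))"

text \<open>The order on sets is inclusion, so this is the least closed set of full measure.\<close>

definition spectrum ::
    "('a, 'm) effect_structure_scheme \<Rightarrow> (real set \<Rightarrow> 'a) \<Rightarrow> real set" where
  "spectrum E x = (LEAST K. closed K \<and> x K = ea_one E)"

definition obs_fun :: "(real \<Rightarrow> real) \<Rightarrow> (real set \<Rightarrow> 'a) \<Rightarrow> real set \<Rightarrow> 'a" where
  "obs_fun f x = (\<lambda>B\<in>sets borel. x (f -` B))"

definition obs_neg :: "(real set \<Rightarrow> 'a) \<Rightarrow> real set \<Rightarrow> 'a" where
  "obs_neg x = obs_fun (\<lambda>t. 1 - t) x"

definition olson_le ::
    "('a, 'm) effect_structure_scheme \<Rightarrow> (real set \<Rightarrow> 'a) \<Rightarrow> (real set \<Rightarrow> 'a) \<Rightarrow> bool" where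
  "olson_le E x y \<longleftrightarrow> (\<forall>t::real. y {..<t} \<sqsubseteq>\<^bsub>ea_order E\<^esub> x {..<t})"

definition EO :: "('a, 'm) effect_structure_scheme \<Rightarrow> (real set \<Rightarrow> 'a) gorder" where
  "EO E =
    \<lparr> carrier = {x. observable E x \<and> spectrum E x \<subseteq> {0..1}}, eq = (=), le = olson_le E \<rparr>"

definition question ::
    "('a, 'm) effect_structure_scheme \<Rightarrow> 'a \<Rightarrow> real set \<Rightarrow> 'a" where
  "question E a = (\<lambda>B\<in>sets borel.
     if 0 \<in> B \<and> 1 \<in> B then ea_one E
     else if 1 \<in> B then a
     else if 0 \<in> B then ea_compl E a
     else ea_zero E)"

end

theory Submission
  imports Defs "HOL-Probability.Distribution_Functions"
begin

text \<open>In the Olson order the infimum of a family \<open>x\<^sub>\<alpha>\<close> of effect observables has to be the observable with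
\<open>x {..<t} = \<Squnion>\<^sub>\<alpha> x\<^sub>\<alpha> {..<t}\<close> for \<open>0 < t \<le> 1\<close>. The right-hand side is increasing and left-continuous in
\<open>t\<close>, so everything depends on the extension theorem: every such \<^emph>\<open>spectral resolution\<close> \<open>F\<close> comes from
an observable. Suprema then follow from the involution \<open>x \<mapsto> obs_neg x\<close>, which is antitone because
\<open>x {..s}\<close> is the infimum of the elements \<open>x {..<s + 1/n}\<close>; and the statements on question observables
are computations, because \<open>question E a {..<t}\<close> takes only the values \<open>0\<close>, \<open>a'\<close> and \<open>1\<close>.

The extension theorem cannot be proved by approximating Borel sets from inside and outside as for
real measures, because \<open>E\<close> need not be weakly distributive. It is reduced to the real case by
states. The values of \<open>F\<close> form a chain, so they are pairwise compatible, and the double commutant of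
the chain is a \<open>\<sigma>\<close>-complete subalgebra in which \<^emph>\<open>all\<close> pairs are compatible, i.e. an MV-algebra
(\<open>compat_sup\<close>, \<open>compat_diff_closed\<close> and the locale \<open>compatible_set\<close>).

In a \<open>\<sigma>\<close>-complete MV-algebra there are enough states (\<open>state_separation\<close>): if \<open>a \<preceq> b\<close> fails and
countably many sequences decreasing to \<open>0\<close> are given, some state \<open>h\<close> has \<open>h b < h a\<close> and sends all these
sequences to \<open>0\<close>. This is a Rasiowa--Sikorski argument. Sharp elements split the algebra into direct
factors, and any two elements become comparable on suitable factors (\<open>comparability\<close>). A decreasing
sequence of sharp elements meets the countably many requirements one after another and is extended to
an ultrafilter; the quotient by it would be a totally ordered MV-algebra, and \<open>h\<close> is the standard part
on this chain, computed by binary expansion: double the element, record whether the result exceeds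
\<open>1\<close>, and continue with the rest.

Each state \<open>h\<close> turns \<open>F\<close> into a distribution function on the real line and thus into a probability
measure \<open>\<nu>\<close>. Call \<open>a\<close> a value of the Borel set \<open>B\<close> if \<open>h a = \<nu> B\<close> holds for all states that respect some
countable family of null sequences. Since unions of countable families are countable,
\<open>state_separation\<close> makes values unique and monotone, and the sets that have a value contain the
intervals \<open>{..<t}\<close> and are closed under complements and disjoint countable unions. So every Borel
set has exactly one value, and this assignment is the observable wanted
(\<open>spectral_resolution_observable\<close>).\<close>

section \<open>Partial sums and the order of an effect algebra\<close>

context effect_algebra
begin

text \<open>The partial sum is made a total operation on options, with \<^term>\<open>None\<close> absorbing and elements outside
the carrier treated as undefined. It is then associative and commutative without side conditions, so
that sums of many terms can be rearranged by rewriting.\<close>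
definition oadd :: "'a option \<Rightarrow> 'a option \<Rightarrow> 'a option" (infixl "\<boxplus>" 65) where
  "x \<boxplus> y = (case x of None \<Rightarrow> None | Some a \<Rightarrow> (case y of None \<Rightarrow> None
     | Some b \<Rightarrow> if a \<in> carrier E \<and> b \<in> carrier E then psum E a b else None))"

definition leq :: "'a \<Rightarrow> 'a \<Rightarrow> bool" (infix "\<preceq>" 50) where
  "a \<preceq> b \<longleftrightarrow> (\<exists>c. Some a \<boxplus> Some c = Some b)"

text \<open>The value is meaningful only when \<^term>\<open>a \<preceq> b\<close>; it is then unique by cancellation.\<close>
definition diff :: "'a \<Rightarrow> 'a \<Rightarrow> 'a" (infixl "\<ominus>" 65) where
  "b \<ominus> a = (THE c. Some a \<boxplus> Some c = Some b)"

abbreviation zer ("\<zero>") where "\<zero> \<equiv> ea_zero E"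
abbreviation uni ("\<one>") where "\<one> \<equiv> ea_one E"
abbreviation compl ("(_\<^sup>\<sim>)" [1000] 1000) where "a\<^sup>\<sim> \<equiv> ea_compl E a"

lemma oadd_None [simp]: "None \<boxplus> y = None" "x \<boxplus> None = None"
  by (auto simp: oadd_def split: option.splits)

lemma oadd_eq: "a \<in> carrier E \<Longrightarrow> b \<in> carrier E \<Longrightarrow> Some a \<boxplus> Some b = psum E a b"
  by (simp add: oadd_def)

lemma oadd_carrier:
  assumes "Some a \<boxplus> Some b = Some c"
  shows "a \<in> carrier E" "b \<in> carrier E" "c \<in> carrier E"
  using assms psum_closed[of a b c] by (auto simp: oadd_def split: if_splits)

lemma oadd_commute: "x \<boxplus> y = y \<boxplus> x"
  by (auto simp: oadd_def psum_commute split: option.splits)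

lemma oadd_assoc: "(x \<boxplus> y) \<boxplus> z = x \<boxplus> (y \<boxplus> z)"
proof (cases "\<exists>a b c. x = Some a \<and> y = Some b \<and> z = Some c \<and>
    a \<in> carrier E \<and> b \<in> carrier E \<and> c \<in> carrier E")
  case True
  then obtain a b c where *: "x = Some a" "y = Some b" "z = Some c"
    and C: "a \<in> carrier E" "b \<in> carrier E" "c \<in> carrier E" by blast
  have "(x \<boxplus> y) \<boxplus> z = Option.bind (psum E a b) (\<lambda>s. psum E s c)"
    using C psum_closed[OF C(1,2)] by (cases "psum E a b") (auto simp: * oadd_eq)
  moreover have "x \<boxplus> (y \<boxplus> z) = Option.bind (psum E b c) (\<lambda>s. psum E a s)"
    using C psum_closed[OF C(2,3)] by (cases "psum E b c") (auto simp: * oadd_eq)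
  ultimately show ?thesis using psum_assoc[OF C] by simp
next
  case False
  then show ?thesis
    by (auto simp: oadd_def split: option.splits if_splits)
qed

sublocale oadd: abel_semigroup oadd
  by unfold_locales (fact oadd_assoc oadd_commute)+

lemmas oadd_ac = oadd.assoc oadd.commute oadd.left_commute

lemma compl:
  assumes "a \<in> carrier E"
  shows compl_closed [simp, intro]: "a\<^sup>\<sim> \<in> carrier E"
    and oadd_compl: "Some a \<boxplus> Some (a\<^sup>\<sim>) = Some \<one>"
proof -
  have "a\<^sup>\<sim> \<in> carrier E \<and> psum E a (a\<^sup>\<sim>) = Some \<one>"
    unfolding ea_compl_def by (rule theI'[OF orthosupplement[OF assms]])
  then show "a\<^sup>\<sim> \<in> carrier E" "Some a \<boxplus> Some (a\<^sup>\<sim>) = Some \<one>"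
    using assms by (auto simp: oadd_eq)
qed

lemma compl_unique:
  assumes "Some a \<boxplus> Some b = Some \<one>" shows "b = a\<^sup>\<sim>"
  using orthosupplement[of a] oadd_carrier[OF assms] assms compl[of a]
  by (auto simp: oadd_eq)

lemma compl_compl [simp]: "a \<in> carrier E \<Longrightarrow> a\<^sup>\<sim>\<^sup>\<sim> = a"
  using compl_unique[of "a\<^sup>\<sim>" a] oadd_compl[of a] by (simp add: oadd_commute)

lemma zero_in [simp, intro]: "\<zero> \<in> carrier E" and one_in [simp, intro]: "\<one> \<in> carrier E"
  by (rule zero_closed, rule one_closed)

lemma compl_one [simp]: "\<one>\<^sup>\<sim> = \<zero>"
proof (rule zero_one_law)
  show "psum E (\<one>\<^sup>\<sim>) \<one> \<noteq> None"
    using oadd_compl[of \<one>] by (simp add: oadd_eq psum_commute)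
qed simp

lemma compl_zero [simp]: "\<zero>\<^sup>\<sim> = \<one>"
  using compl_compl[of \<one>] by simp

text \<open>Adding the orthosupplement of the common sum to both sides exhibits \<open>b\<close> and \<open>c\<close> as orthosupplements
of the same element.\<close>
lemma oadd_cancel:
  assumes "Some a \<boxplus> Some b = Some d" "Some a \<boxplus> Some c = Some d"
  shows "b = c"
proof -
  let ?r = "Some (d\<^sup>\<sim>)"
  have d: "Some d \<boxplus> ?r = Some \<one>"
    using oadd_carrier[OF assms(1)] oadd_compl by simp
  have "(Some a \<boxplus> Some b) \<boxplus> ?r = Some \<one>" "(Some a \<boxplus> Some c) \<boxplus> ?r = Some \<one>"
    using assms d by simp_all
  then have "Some b \<boxplus> (Some a \<boxplus> ?r) = Some \<one>" "Some c \<boxplus> (Some a \<boxplus> ?r) = Some \<one>"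
    by (simp_all add: oadd_ac)
  then obtain u where "Some u \<boxplus> Some b = Some \<one>" "Some u \<boxplus> Some c = Some \<one>"
    by (cases "Some a \<boxplus> ?r") (auto simp: oadd_commute)
  then show ?thesis using compl_unique by metis
qed

lemma oadd_zero [simp]: "a \<in> carrier E \<Longrightarrow> Some a \<boxplus> Some \<zero> = Some a"
proof -
  assume a: "a \<in> carrier E"
  have "Some (a\<^sup>\<sim>) \<boxplus> (Some a \<boxplus> Some \<zero>) = (Some a \<boxplus> Some (a\<^sup>\<sim>)) \<boxplus> Some \<zero>"
    by (simp only: oadd_ac)
  also have "\<dots> = Some \<one> \<boxplus> Some \<zero>"
    using oadd_compl[OF a] by simp
  also have "\<dots> = Some \<one>" using oadd_compl[of \<one>] by simp
  finally have *: "Some (a\<^sup>\<sim>) \<boxplus> (Some a \<boxplus> Some \<zero>) = Some \<one>" .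
  then obtain u where "Some a \<boxplus> Some \<zero> = Some u" by (cases "Some a \<boxplus> Some \<zero>") auto
  with * show ?thesis using compl_unique[of "a\<^sup>\<sim>" u] a by simp
qed

lemma oadd_zero_left [simp]: "a \<in> carrier E \<Longrightarrow> Some \<zero> \<boxplus> Some a = Some a"
  by (simp add: oadd_commute)

text \<open>Since \<open>1 + (a + b) = 1 + 0\<close> is defined, associativity makes \<open>1 + a\<close> defined, and the zero-one law applies.\<close>
lemma oadd_eq_zero: 
  assumes "Some a \<boxplus> Some b = Some \<zero>" shows "a = \<zero>"
proof (rule zero_one_law)
  show a: "a \<in> carrier E" using oadd_carrier[OF assms] by blast
  have "Some \<one> = (Some \<one> \<boxplus> Some a) \<boxplus> Some b"
    using assms by (simp add: oadd_assoc)
  then have "Some \<one> \<boxplus> Some a \<noteq> None" by (metis oadd_None(1) option.distinct(1))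
  then show "psum E a \<one> \<noteq> None" using a by (simp add: oadd_eq psum_commute)
qed

lemma leqI: "Some a \<boxplus> Some c = Some b \<Longrightarrow> a \<preceq> b"
  by (auto simp: leq_def)

lemma leqI2: "Some c \<boxplus> Some a = Some b \<Longrightarrow> a \<preceq> b"
  by (auto simp: leq_def oadd_commute)

lemma leq_carrier: "a \<preceq> b \<Longrightarrow> a \<in> carrier E" "a \<preceq> b \<Longrightarrow> b \<in> carrier E"
  using oadd_carrier by (auto simp: leq_def)

lemma leq_refl [simp]: "a \<in> carrier E \<Longrightarrow> a \<preceq> a"
  by (rule leqI[of _ \<zero>]) simp

lemma leq_trans [trans]: "a \<preceq> b \<Longrightarrow> b \<preceq> c \<Longrightarrow> a \<preceq> c"
proof -
  assume "a \<preceq> b" "b \<preceq> c"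
  then obtain u v where u: "Some a \<boxplus> Some u = Some b" and v: "Some b \<boxplus> Some v = Some c"
    by (auto simp: leq_def)
  then have "Some a \<boxplus> (Some u \<boxplus> Some v) = Some c" by (metis oadd_assoc)
  then show ?thesis by (cases "Some u \<boxplus> Some v") (auto simp: leq_def)
qed

lemma leq_antisym: "a \<preceq> b \<Longrightarrow> b \<preceq> a \<Longrightarrow> a = b"
proof -
  assume "a \<preceq> b" "b \<preceq> a"
  then obtain u v where u: "Some a \<boxplus> Some u = Some b" and v: "Some b \<boxplus> Some v = Some a"
    by (auto simp: leq_def)
  then have *: "Some a \<boxplus> (Some u \<boxplus> Some v) = Some a" by (metis oadd_assoc)
  then obtain w where w: "Some u \<boxplus> Some v = Some w" by (cases "Some u \<boxplus> Some v") auto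
  then have "w = \<zero>" using * oadd_cancel[of a w a \<zero>] oadd_carrier[OF u] by simp
  then have "u = \<zero>" using w oadd_eq_zero by blast
  then show ?thesis using u oadd_carrier[OF u] by simp
qed

lemma zero_leq [simp]: "a \<in> carrier E \<Longrightarrow> \<zero> \<preceq> a"
  by (rule leqI[of _ a]) simp

lemma leq_one [simp]: "a \<in> carrier E \<Longrightarrow> a \<preceq> \<one>"
  using oadd_compl leqI by blast

lemma leq_zero: "a \<preceq> \<zero> \<Longrightarrow> a = \<zero>"
  using oadd_eq_zero by (auto simp: leq_def)

lemma oadd_diff: "a \<preceq> b \<Longrightarrow> Some a \<boxplus> Some (b \<ominus> a) = Some b"
proof -
  assume "a \<preceq> b"
  then obtain c where c: "Some a \<boxplus> Some c = Some b" by (auto simp: leq_def)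
  then show ?thesis unfolding diff_def
    by (rule theI) (use c oadd_cancel in blast)
qed

lemma diff_eqI: "Some a \<boxplus> Some c = Some b \<Longrightarrow> b \<ominus> a = c"
  using oadd_diff[OF leqI] oadd_cancel by blast

lemma diff_closed [simp]: "a \<preceq> b \<Longrightarrow> b \<ominus> a \<in> carrier E"
  using oadd_diff oadd_carrier by blast

lemma diff_leq: "a \<preceq> b \<Longrightarrow> b \<ominus> a \<preceq> b"
  using oadd_diff leqI2 by blast

lemma diff_diff: "a \<preceq> b \<Longrightarrow> b \<ominus> (b \<ominus> a) = a"
  by (rule diff_eqI) (metis oadd_diff oadd_commute)

lemma diff_zero [simp]: "a \<in> carrier E \<Longrightarrow> a \<ominus> \<zero> = a"
  by (rule diff_eqI) simp

lemma diff_eq_zero: "a \<preceq> b \<Longrightarrow> b \<ominus> a = \<zero> \<Longrightarrow> a = b"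
  using oadd_diff[of a b] leq_carrier[of a b] by auto

lemma compl_eq_diff: "a \<in> carrier E \<Longrightarrow> a\<^sup>\<sim> = \<one> \<ominus> a"
  using diff_eqI[OF oadd_compl] by simp

lemma oadd_mono:
  assumes "a \<preceq> b" "Some b \<boxplus> Some c = Some d"
  obtains e where "Some a \<boxplus> Some c = Some e" "e \<preceq> d"
proof -
  have "(Some a \<boxplus> Some (b \<ominus> a)) \<boxplus> Some c = Some d"
    using oadd_diff[OF assms(1)] assms(2) by simp
  then have "(Some a \<boxplus> Some c) \<boxplus> Some (b \<ominus> a) = Some d"
    by (simp only: oadd_ac)
  then show ?thesis using that
    by (cases "Some a \<boxplus> Some c") (auto simp: leq_def)
qed

lemma oadd_mono2:
  assumes "a \<preceq> b" "a' \<preceq> b'" "Some b \<boxplus> Some b' = Some d"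
  obtains e where "Some a \<boxplus> Some a' = Some e" "e \<preceq> d"
proof -
  obtain e where e: "Some a \<boxplus> Some b' = Some e" "e \<preceq> d"
    using oadd_mono[OF assms(1,3)] .
  then have "Some b' \<boxplus> Some a = Some e" by (simp add: oadd_commute)
  then obtain f where "Some a' \<boxplus> Some a = Some f" "f \<preceq> e"
    using oadd_mono[OF assms(2)] by blast
  then show ?thesis using that e leq_trans oadd_commute by metis
qed

lemma oadd_leq_mono:
  assumes "a \<preceq> b" "a' \<preceq> b'" "Some a \<boxplus> Some a' = Some c" "Some b \<boxplus> Some b' = Some d"
  shows "c \<preceq> d"
  using oadd_mono2[OF assms(1,2,4)] assms(3) by force

lemma oadd_leq_cancel:
  assumes "Some a \<boxplus> Some b = Some u" "Some a \<boxplus> Some c = Some v" "u \<preceq> v"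
  shows "b \<preceq> c"
proof -
  have "Some a \<boxplus> (Some b \<boxplus> Some (v \<ominus> u)) = Some v"
    using oadd_diff[OF assms(3)] assms(1) by (simp flip: oadd_assoc)
  then obtain w where w: "Some b \<boxplus> Some (v \<ominus> u) = Some w" "Some a \<boxplus> Some w = Some v"
    by (cases "Some b \<boxplus> Some (v \<ominus> u)") auto
  then have "w = c" using assms(2) oadd_cancel by blast
  then show ?thesis using w leqI by blast
qed

lemma diff_mono: "a \<preceq> b \<Longrightarrow> b \<preceq> c \<Longrightarrow> b \<ominus> a \<preceq> c \<ominus> a"
  using oadd_leq_cancel[of a "b \<ominus> a" b "c \<ominus> a" c] oadd_diff[of a b] oadd_diff[of a c]
    leq_trans[of a b c] by simp

lemma diff_antimono: "a \<preceq> b \<Longrightarrow> b \<preceq> c \<Longrightarrow> c \<ominus> b \<preceq> c \<ominus> a"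
proof -
  assume *: "a \<preceq> b" "b \<preceq> c"
  have "Some a \<boxplus> (Some (b \<ominus> a) \<boxplus> Some (c \<ominus> b)) = Some c"
    using oadd_diff[OF *(1)] oadd_diff[OF *(2)] by (simp flip: oadd_assoc)
  then obtain w where w: "Some (b \<ominus> a) \<boxplus> Some (c \<ominus> b) = Some w" "Some a \<boxplus> Some w = Some c"
    by (cases "Some (b \<ominus> a) \<boxplus> Some (c \<ominus> b)") auto
  then show ?thesis using diff_eqI[OF w(2)] leqI2[OF w(1)] by simp
qed

lemma leq_diff_iff: "Some a \<boxplus> Some b = Some c \<Longrightarrow> c \<preceq> d \<Longrightarrow> b \<preceq> d \<ominus> a"
  using diff_mono[of a c d] diff_eqI[of a b c] leqI[of a b c] by simp

lemma leq_diffD: "a \<preceq> d \<Longrightarrow> b \<preceq> d \<ominus> a \<Longrightarrow> \<exists>c. Some a \<boxplus> Some b = Some c \<and> c \<preceq> d"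
  using oadd_mono2[of a a b "d \<ominus> a" d] leq_refl[OF leq_carrier(1)] oadd_diff[of a d] by blast

lemma compl_antimono: "a \<preceq> b \<Longrightarrow> b\<^sup>\<sim> \<preceq> a\<^sup>\<sim>"
  using diff_antimono[of a b \<one>] by (simp add: compl_eq_diff leq_carrier)

lemma compl_leq_iff: "a \<in> carrier E \<Longrightarrow> b \<in> carrier E \<Longrightarrow> b\<^sup>\<sim> \<preceq> a\<^sup>\<sim> \<longleftrightarrow> a \<preceq> b"
  using compl_antimono[of a b] compl_antimono[of "b\<^sup>\<sim>" "a\<^sup>\<sim>"] by auto

text \<open>Orthogonality, i.e. definedness of the sum, is expressed by the order.\<close>
lemma orth_iff: "a \<in> carrier E \<Longrightarrow> b \<in> carrier E \<Longrightarrow>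
   (\<exists>c. Some a \<boxplus> Some b = Some c) \<longleftrightarrow> a \<preceq> b\<^sup>\<sim>"
proof
  assume C: "a \<in> carrier E" "b \<in> carrier E"
  assume "\<exists>c. Some a \<boxplus> Some b = Some c"
  then obtain c where c: "Some b \<boxplus> Some a = Some c" by (auto simp: oadd_commute)
  show "a \<preceq> b\<^sup>\<sim>" using leq_diff_iff[OF c, of \<one>] oadd_carrier[OF c] by (simp add: compl_eq_diff)
next
  assume C: "a \<in> carrier E" "b \<in> carrier E"
  assume "a \<preceq> b\<^sup>\<sim>"
  then show "\<exists>c. Some a \<boxplus> Some b = Some c"
    using oadd_mono[of a "b\<^sup>\<sim>" b \<one>] oadd_compl[OF C(2)] by (metis oadd_commute)
qed

lemma le_ea_order [simp]: "a \<in> carrier E \<Longrightarrow> le (ea_order E) a b \<longleftrightarrow> a \<preceq> b"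
  by (auto simp: ea_order_def leq_def oadd_def split: if_splits)

lemma carrier_ea_order [simp]: "carrier (ea_order E) = carrier E"
  by (simp add: ea_order_def)

lemma eq_ea_order [simp]: "eq (ea_order E) = (=)"
  by (simp add: ea_order_def)

lemma partial_order_ea_order: "partial_order (ea_order E)"
  by unfold_locales (auto intro: leq_antisym leq_trans)

lemma least_Upper_iff: "A \<subseteq> carrier E \<Longrightarrow> least (ea_order E) s (Upper (ea_order E) A) \<longleftrightarrow>
    s \<in> carrier E \<and> (\<forall>a\<in>A. a \<preceq> s) \<and> (\<forall>u\<in>carrier E. (\<forall>a\<in>A. a \<preceq> u) \<longrightarrow> s \<preceq> u)"
  by (auto simp: least_def Upper_def subset_iff)

lemma greatest_Lower_iff: "A \<subseteq> carrier E \<Longrightarrow> greatest (ea_order E) s (Lower (ea_order E) A) \<longleftrightarrow>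
    s \<in> carrier E \<and> (\<forall>a\<in>A. s \<preceq> a) \<and> (\<forall>u\<in>carrier E. (\<forall>a\<in>A. u \<preceq> a) \<longrightarrow> u \<preceq> s)"
  by (auto simp: greatest_def Lower_def subset_iff)

end

section \<open>Compatible elements of a lattice effect algebra\<close>

locale sigma_lattice_ea = effect_algebra E + lat: sigma_lattice "ea_order E"
  for E :: "('a, 'm) effect_structure_scheme" (structure)
begin

abbreviation join (infixl "\<^bold>\<or>" 65) where "a \<^bold>\<or> b \<equiv> Lattice.join (ea_order E) a b"
abbreviation meet (infixl "\<^bold>\<and>" 70) where "a \<^bold>\<and> b \<equiv> Lattice.meet (ea_order E) a b"

definition is_sup :: "'a \<Rightarrow> 'a set \<Rightarrow> bool" where
  "is_sup s A \<longleftrightarrow> A \<subseteq> carrier E \<and> s \<in> carrier E \<and> (\<forall>a\<in>A. a \<preceq> s) \<and>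
     (\<forall>u\<in>carrier E. (\<forall>a\<in>A. a \<preceq> u) \<longrightarrow> s \<preceq> u)"

lemma is_supD:
  assumes "is_sup s A"
  shows "A \<subseteq> carrier E" "s \<in> carrier E" "a \<in> A \<Longrightarrow> a \<preceq> s"
    "u \<in> carrier E \<Longrightarrow> (\<And>a. a \<in> A \<Longrightarrow> a \<preceq> u) \<Longrightarrow> s \<preceq> u"
  using assms by (auto simp: is_sup_def)

lemma is_sup_unique: "is_sup s A \<Longrightarrow> is_sup t A \<Longrightarrow> s = t"
  by (auto simp: is_sup_def intro: leq_antisym)

lemma is_sup_iff_least: "A \<subseteq> carrier E \<Longrightarrow> is_sup s A \<longleftrightarrow> least (ea_order E) s (Upper (ea_order E) A)"
  by (simp add: least_Upper_iff is_sup_def)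

lemma countable_is_sup: "A \<subseteq> carrier E \<Longrightarrow> countable A \<Longrightarrow> \<exists>s. is_sup s A"
  using lat.countable_sup_exists[of A] by (simp add: is_sup_iff_least)

lemma join [simp]:
  assumes "a \<in> carrier E" "b \<in> carrier E"
  shows "a \<^bold>\<or> b \<in> carrier E" "a \<preceq> a \<^bold>\<or> b" "b \<preceq> a \<^bold>\<or> b"
  using lat.weak.join_closed[of a b] lat.weak.join_left[of a b] lat.weak.join_right[of a b] assms by auto

lemma join_least: "a \<preceq> u \<Longrightarrow> b \<preceq> u \<Longrightarrow> a \<^bold>\<or> b \<preceq> u"
  using lat.weak.join_le[of a u b] join by (auto simp: leq_carrier)

lemma meet [simp]:
  assumes "a \<in> carrier E" "b \<in> carrier E"
  shows "a \<^bold>\<and> b \<in> carrier E" "a \<^bold>\<and> b \<preceq> a" "a \<^bold>\<and> b \<preceq> b"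
  using lat.weak.meet_closed[of a b] lat.weak.meet_left[of a b] lat.weak.meet_right[of a b] assms by auto

lemma meet_greatest: "u \<preceq> a \<Longrightarrow> u \<preceq> b \<Longrightarrow> u \<preceq> a \<^bold>\<and> b"
  using lat.weak.meet_le[of u a b] meet by (auto simp: leq_carrier)

lemma is_sup_join: "a \<in> carrier E \<Longrightarrow> b \<in> carrier E \<Longrightarrow> is_sup (a \<^bold>\<or> b) {a, b}"
  by (auto simp: is_sup_def intro: join_least)

lemma meet_commute: "a \<^bold>\<and> b = b \<^bold>\<and> a"
  by (simp add: Lattice.meet_def insert_commute)

lemma meet_absorb1: "a \<preceq> b \<Longrightarrow> a \<^bold>\<and> b = a"
  by (rule leq_antisym) (auto intro: meet_greatest simp: leq_carrier)

lemma meet_absorb2: "a \<preceq> b \<Longrightarrow> b \<^bold>\<and> a = a"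
  by (simp add: meet_absorb1 meet_commute)

lemma meet_mono: "a \<preceq> c \<Longrightarrow> b \<preceq> d \<Longrightarrow> a \<^bold>\<and> b \<preceq> c \<^bold>\<and> d"
  by (meson leq_carrier leq_trans meet meet_greatest)

lemma meet_zero [simp]: "a \<in> carrier E \<Longrightarrow> a \<^bold>\<and> \<zero> = \<zero>" "a \<in> carrier E \<Longrightarrow> \<zero> \<^bold>\<and> a = \<zero>"
  by (simp_all add: meet_absorb2 meet_absorb1)

lemma meet_one [simp]: "a \<in> carrier E \<Longrightarrow> a \<^bold>\<and> \<one> = a" "a \<in> carrier E \<Longrightarrow> \<one> \<^bold>\<and> a = a"
  by (simp_all add: meet_absorb2 meet_absorb1)

lemma meet_assoc:
  assumes "a \<in> carrier E" "b \<in> carrier E" "c \<in> carrier E"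
  shows "(a \<^bold>\<and> b) \<^bold>\<and> c = a \<^bold>\<and> (b \<^bold>\<and> c)"
proof (rule leq_antisym)
  have "(a \<^bold>\<and> b) \<^bold>\<and> c \<preceq> a \<^bold>\<and> b" using assms by simp
  then have "(a \<^bold>\<and> b) \<^bold>\<and> c \<preceq> a" "(a \<^bold>\<and> b) \<^bold>\<and> c \<preceq> b"
    using meet(2,3)[of a b] assms leq_trans by blast+
  then show "(a \<^bold>\<and> b) \<^bold>\<and> c \<preceq> a \<^bold>\<and> (b \<^bold>\<and> c)"
    using assms by (intro meet_greatest) auto
  have "a \<^bold>\<and> (b \<^bold>\<and> c) \<preceq> b \<^bold>\<and> c" using assms by simp
  then have "a \<^bold>\<and> (b \<^bold>\<and> c) \<preceq> c" "a \<^bold>\<and> (b \<^bold>\<and> c) \<preceq> b"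
    using meet(2,3)[of b c] assms leq_trans by blast+
  then show "a \<^bold>\<and> (b \<^bold>\<and> c) \<preceq> (a \<^bold>\<and> b) \<^bold>\<and> c"
    using assms by (intro meet_greatest) auto
qed

lemma compl_of_meet: 
  assumes "a \<in> carrier E" "b \<in> carrier E"
  shows "(a \<^bold>\<and> b)\<^sup>\<sim> = a\<^sup>\<sim> \<^bold>\<or> b\<^sup>\<sim>"
proof (rule leq_antisym)
  show "a\<^sup>\<sim> \<^bold>\<or> b\<^sup>\<sim> \<preceq> (a \<^bold>\<and> b)\<^sup>\<sim>"
    using assms by (intro join_least compl_antimono) auto
  have "(a\<^sup>\<sim> \<^bold>\<or> b\<^sup>\<sim>)\<^sup>\<sim> \<preceq> a\<^sup>\<sim>\<^sup>\<sim>" "(a\<^sup>\<sim> \<^bold>\<or> b\<^sup>\<sim>)\<^sup>\<sim> \<preceq> b\<^sup>\<sim>\<^sup>\<sim>"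
    by (intro compl_antimono; use assms in auto)+
  then have "(a\<^sup>\<sim> \<^bold>\<or> b\<^sup>\<sim>)\<^sup>\<sim> \<preceq> a \<^bold>\<and> b"
    using assms by (intro meet_greatest) simp_all
  from compl_antimono[OF this] show "(a \<^bold>\<and> b)\<^sup>\<sim> \<preceq> a\<^sup>\<sim> \<^bold>\<or> b\<^sup>\<sim>"
    using assms by simp
qed

text \<open>Two elements are compatible if they have a common part \<open>m\<close> such that the two remainders and \<open>m\<close> are
jointly summable; this is how any two elements of an MV-algebra are related. The part \<open>m\<close> turns out to
be the meet.\<close>
definition compat :: "'a \<Rightarrow> 'a \<Rightarrow> bool" where
  "compat a b \<longleftrightarrow> (\<exists>x y m. Some x \<boxplus> Some m = Some a \<and> Some y \<boxplus> Some m = Some b \<and>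
     (Some x \<boxplus> Some m) \<boxplus> Some y \<noteq> None)"

lemma compat_commute: "compat a b \<Longrightarrow> compat b a"
proof -
  assume "compat a b"
  then obtain x y m where *: "Some x \<boxplus> Some m = Some a" "Some y \<boxplus> Some m = Some b"
     "(Some x \<boxplus> Some m) \<boxplus> Some y \<noteq> None" unfolding compat_def by blast
  have "(Some x \<boxplus> Some m) \<boxplus> Some y = (Some y \<boxplus> Some m) \<boxplus> Some x"
    by (simp only: oadd_ac)
  then have "(Some y \<boxplus> Some m) \<boxplus> Some x \<noteq> None" using *(3) by simp
  then show ?thesis using *(1,2) unfolding compat_def by blast
qed

lemma compat_carrier: "compat a b \<Longrightarrow> a \<in> carrier E" "compat a b \<Longrightarrow> b \<in> carrier E"
  unfolding compat_def using oadd_carrier by blast+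

lemma meet_diff_zero:
  assumes "a \<in> carrier E" "b \<in> carrier E" "z \<preceq> a \<ominus> (a \<^bold>\<and> b)" "z \<preceq> b \<ominus> (a \<^bold>\<and> b)"
  shows "z = \<zero>"
proof -
  let ?g = "a \<^bold>\<and> b"
  obtain w where w: "Some ?g \<boxplus> Some z = Some w" "w \<preceq> a"
    using leq_diffD[OF _ assms(3)] assms(1,2) by auto
  have "w \<preceq> b" using leq_diffD[OF _ assms(4)] w assms(1,2) by auto
  then have "w \<preceq> ?g" using w meet_greatest by blast
  then have "w = ?g" using leqI[OF w(1)] leq_antisym by blast
  then show ?thesis using w(1) oadd_cancel[of ?g z ?g \<zero>] oadd_carrier[OF w(1)] by simp
qed

text \<open>A common part \<open>m\<close> as in the definition may be enlarged to the meet \<open>g\<close>, because \<open>g \<ominus> m\<close> lies below both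
remainders. Then \<open>t = a + (b \<ominus> g)\<close> is an upper bound of \<open>a\<close> and \<open>b\<close>, and whatever separates it from the
join lies below both \<open>a \<ominus> g\<close> and \<open>b \<ominus> g\<close>, hence vanishes.\<close>
lemma compat_join:
  assumes "compat a b"
  shows "Some a \<boxplus> Some (b \<ominus> (a \<^bold>\<and> b)) = Some (a \<^bold>\<or> b)"
proof -
  obtain x y m where *: "Some x \<boxplus> Some m = Some a" "Some y \<boxplus> Some m = Some b"
     "(Some x \<boxplus> Some m) \<boxplus> Some y \<noteq> None" using assms unfolding compat_def by blast
  have C: "a \<in> carrier E" "b \<in> carrier E" using compat_carrier[OF assms] by auto
  define g where "g = a \<^bold>\<and> b"
  have g: "g \<in> carrier E" "g \<preceq> a" "g \<preceq> b" using C by (auto simp: g_def)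
  have m: "m \<preceq> g" unfolding g_def using *(1,2) leqI2 by (intro meet_greatest) auto
  have "g \<ominus> m \<preceq> a \<ominus> m" "g \<ominus> m \<preceq> b \<ominus> m" using m g diff_mono by blast+
  then have e: "g \<ominus> m \<preceq> x" "g \<ominus> m \<preceq> y"
    using diff_eqI[of m x a] diff_eqI[of m y b] *(1,2) by (simp_all add: oadd_commute)
  have yg: "b \<ominus> g \<preceq> y"
    using diff_antimono[OF m g(3)] diff_eqI[of m y b] *(2) by (simp add: oadd_commute)
  then obtain t where t: "Some a \<boxplus> Some (b \<ominus> g) = Some t"
    using *(1,3) oadd_mono2[of a a "b \<ominus> g" y] leq_refl[OF C(1)] by fastforce
  have at: "a \<preceq> t" using t leqI by blast
  have "Some t = (Some (a \<ominus> g) \<boxplus> Some g) \<boxplus> Some (b \<ominus> g)"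
    using t oadd_diff[OF g(2)] by (simp add: oadd_commute)
  also have "\<dots> = Some (a \<ominus> g) \<boxplus> (Some g \<boxplus> Some (b \<ominus> g))" by (rule oadd_assoc)
  also have "\<dots> = Some b \<boxplus> Some (a \<ominus> g)" using oadd_diff[OF g(3)] by (simp add: oadd_commute)
  finally have t2: "Some b \<boxplus> Some (a \<ominus> g) = Some t" by simp
  have bt: "b \<preceq> t" using t2 leqI by blast
  have "t = a \<^bold>\<or> b"
  proof (rule leq_antisym)
    define v where "v = a \<^bold>\<or> b"
    have v: "a \<preceq> v" "b \<preceq> v" "v \<preceq> t" using C join_least[OF at bt] by (auto simp: v_def)
    have "t \<ominus> v \<preceq> t \<ominus> a" "t \<ominus> v \<preceq> t \<ominus> b" using v diff_antimono by blast+
    then have "t \<ominus> v \<preceq> b \<ominus> g" "t \<ominus> v \<preceq> a \<ominus> g" using diff_eqI[OF t] diff_eqI[OF t2] by simp_all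
    then have "t \<ominus> v = \<zero>" using meet_diff_zero[of a b] C unfolding g_def by blast
    then show "t \<preceq> a \<^bold>\<or> b" using diff_eq_zero[OF v(3)] leq_carrier[OF v(1)] by (simp add: v_def)
  qed (rule join_least[OF at bt])
  with t show ?thesis by (simp add: g_def)
qed

text \<open>If \<open>c = x + m\<close>, \<open>a = y + m\<close> and \<open>x + m + y + r = 1\<close>, then \<open>x + r\<close> is the orthosupplement of \<open>a\<close>, and \<open>x\<close> is the
common part of it and \<open>c\<close>.\<close>
lemma compat_compl:
  assumes "compat c a" shows "compat c (a\<^sup>\<sim>)"
proof -
  obtain x y m where *: "Some x \<boxplus> Some m = Some c" "Some y \<boxplus> Some m = Some a"
     "(Some x \<boxplus> Some m) \<boxplus> Some y \<noteq> None" using assms unfolding compat_def by blast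
  then obtain s where s: "(Some x \<boxplus> Some m) \<boxplus> Some y = Some s" by auto
  have "s \<in> carrier E" using s * oadd_carrier by metis
  then have "((Some x \<boxplus> Some m) \<boxplus> Some y) \<boxplus> Some (s\<^sup>\<sim>) = Some \<one>"
    using s oadd_compl by simp
  then have 1: "(Some y \<boxplus> Some m) \<boxplus> (Some x \<boxplus> Some (s\<^sup>\<sim>)) = Some \<one>"
    by (simp only: oadd_ac)
  then obtain r where r: "Some x \<boxplus> Some (s\<^sup>\<sim>) = Some r" "Some a \<boxplus> Some r = Some \<one>"
    using *(2) by (cases "Some x \<boxplus> Some (s\<^sup>\<sim>)") auto
  have "r = a\<^sup>\<sim>" using compl_unique r by blast
  moreover have "(Some m \<boxplus> Some x) \<boxplus> Some (s\<^sup>\<sim>) \<noteq> None"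
  proof
    assume "(Some m \<boxplus> Some x) \<boxplus> Some (s\<^sup>\<sim>) = None"
    moreover have "(Some y \<boxplus> Some m) \<boxplus> (Some x \<boxplus> Some (s\<^sup>\<sim>)) = Some y \<boxplus> ((Some m \<boxplus> Some x) \<boxplus> Some (s\<^sup>\<sim>))"
      by (simp only: oadd_ac)
    ultimately show False using 1 by simp
  qed
  moreover have "Some m \<boxplus> Some x = Some c" "Some (s\<^sup>\<sim>) \<boxplus> Some x = Some r"
    using *(1) r(1) by (simp_all add: oadd_commute)
  ultimately show ?thesis
    unfolding compat_def by (intro exI[of _ m] exI[of _ "s\<^sup>\<sim>"] exI[of _ x]) simp
qed

lemma leq_compat: "a \<preceq> b \<Longrightarrow> compat a b"
  unfolding compat_def
  by (rule exI[of _ \<zero>], rule exI[of _ "b \<ominus> a"], rule exI[of _ a])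
    (simp add: leq_carrier oadd_diff oadd_commute)

text \<open>Compatibility passes to suprema, and then \<open>c\<close> distributes over them. With \<open>t\<close> the supremum of the meets
\<open>c \<and> a\<close> and \<open>y = (s \<or> c) \<ominus> c\<close>, every \<open>a\<close> is the sum of \<open>c \<and> a \<preceq> t\<close> and \<open>(c \<or> a) \<ominus> c \<preceq> y\<close>. So \<open>s \<preceq> t + y\<close>,
which leaves room for \<open>u = c \<ominus> t\<close> above \<open>s\<close>; thus \<open>t\<close> is a common part of \<open>c\<close> and \<open>s\<close>. Comparing with
\<open>compat_join\<close> shows that \<open>t\<close> is their meet.\<close>
lemma compat_sup:
  assumes "countable A" and compat: "\<And>a. a \<in> A \<Longrightarrow> compat c a" and s: "is_sup s A"
    and c: "c \<in> carrier E"
  shows "compat c s" "is_sup (c \<^bold>\<and> s) ((\<^bold>\<and>) c ` A)"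
proof -
  have AC: "A \<subseteq> carrier E" "s \<in> carrier E" using is_supD[OF s] by auto
  have img: "(\<^bold>\<and>) c ` A \<subseteq> carrier E" using AC c meet(1) by blast
  then obtain t where t: "is_sup t ((\<^bold>\<and>) c ` A)"
    using countable_is_sup[OF img countable_image[OF assms(1)]] by blast
  have tc: "t \<preceq> c" using is_supD(4)[OF t c] meet(2)[OF c] AC by blast
  have ts: "t \<preceq> s"
  proof (rule is_supD(4)[OF t AC(2)])
    fix z assume "z \<in> (\<^bold>\<and>) c ` A"
    then obtain a where a: "a \<in> A" "z = c \<^bold>\<and> a" by auto
    then have "z \<preceq> a" using AC c by auto
    then show "z \<preceq> s" using is_supD(3)[OF s a(1)] leq_trans by blast
  qed
  define j where "j = s \<^bold>\<or> c"
  have j: "j \<in> carrier E" "s \<preceq> j" "c \<preceq> j" using AC c by (auto simp: j_def)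
  define y where "y = j \<ominus> c"
  have cy: "Some c \<boxplus> Some y = Some j" unfolding y_def using oadd_diff[OF j(3)] .
  obtain p where p: "Some t \<boxplus> Some y = Some p" using oadd_mono[OF tc cy] by blast
  have ap: "a \<preceq> p" if a: "a \<in> A" for a
  proof -
    have aC: "a \<in> carrier E" using a AC by auto
    have "Some c \<boxplus> Some (a \<ominus> (c \<^bold>\<and> a)) = Some (c \<^bold>\<or> a)" using compat_join[OF compat[OF a]] .
    moreover have "c \<^bold>\<or> a \<preceq> j" using j leq_trans[OF is_supD(3)[OF s a] j(2)] by (intro join_least)
    ultimately have 1: "a \<ominus> (c \<^bold>\<and> a) \<preceq> y" using oadd_leq_cancel cy by blast
    have 2: "c \<^bold>\<and> a \<preceq> t" using is_supD(3)[OF t] a by auto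
    have "Some (c \<^bold>\<and> a) \<boxplus> Some (a \<ominus> (c \<^bold>\<and> a)) = Some a" using oadd_diff[of "c \<^bold>\<and> a" a] aC c by simp
    then show ?thesis using oadd_leq_mono[OF 2 1 _ p] by blast
  qed
  then have sp: "s \<preceq> p" using is_supD(4)[OF s] oadd_carrier(3)[OF p] by blast
  define u where "u = c \<ominus> t"
  have tu: "Some t \<boxplus> Some u = Some c" unfolding u_def using oadd_diff[OF tc] .
  have pu: "Some p \<boxplus> Some u = Some j"
  proof -
    have "Some p \<boxplus> Some u = (Some t \<boxplus> Some u) \<boxplus> Some y" by (simp add: p[symmetric] oadd_ac)
    then show ?thesis using tu cy by simp
  qed
  obtain q where q: "Some s \<boxplus> Some u = Some q" "q \<preceq> j" using oadd_mono[OF sp pu] .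
  have st: "Some t \<boxplus> Some (s \<ominus> t) = Some s" using oadd_diff[OF ts] .
  show compat: "compat c s"
    unfolding compat_def
  proof (intro exI conjI)
    show "Some u \<boxplus> Some t = Some c" using tu by (simp add: oadd_commute)
    show "Some (s \<ominus> t) \<boxplus> Some t = Some s" using st by (simp add: oadd_commute)
    have "Some u \<boxplus> Some t \<boxplus> Some (s \<ominus> t) = (Some t \<boxplus> Some (s \<ominus> t)) \<boxplus> Some u" by (simp only: oadd_ac)
    then show "Some u \<boxplus> Some t \<boxplus> Some (s \<ominus> t) \<noteq> None" using st q by simp
  qed
  have "q = j"
  proof (rule leq_antisym[OF q(2)])
    have "c \<preceq> q"
    proof -
      have "Some q = Some (s \<ominus> t) \<boxplus> (Some t \<boxplus> Some u)"
        by (simp add: q(1)[symmetric] st[symmetric] oadd_ac)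
      then show ?thesis using tu leqI2 by metis
    qed
    then show "j \<preceq> q" unfolding j_def using leqI[OF q(1)] by (intro join_least)
  qed
  moreover have "Some s \<boxplus> Some (c \<ominus> (s \<^bold>\<and> c)) = Some j"
    using compat_join[OF compat_commute[OF compat]] by (simp add: j_def)
  ultimately have "u = c \<ominus> (s \<^bold>\<and> c)" using q oadd_cancel by blast
  then have "c \<ominus> (c \<ominus> t) = c \<ominus> (c \<ominus> (s \<^bold>\<and> c))" by (simp add: u_def)
  then have "t = c \<^bold>\<and> s" using diff_diff[OF tc] diff_diff[of "s \<^bold>\<and> c" c] AC c by (simp add: meet_commute)
  then show "is_sup (c \<^bold>\<and> s) ((\<^bold>\<and>) c ` A)" using t by simp
qed

lemma compat_join_closed: "compat c a \<Longrightarrow> compat c b \<Longrightarrow> compat c (a \<^bold>\<or> b)"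
  by (rule compat_sup(1)[where A = "{a, b}"]) (auto intro: is_sup_join compat_carrier)

lemma compat_meet_closed:
  assumes "compat c a" "compat c b" shows "compat c (a \<^bold>\<and> b)"
proof -
  have "compat c (((a \<^bold>\<and> b)\<^sup>\<sim>)\<^sup>\<sim>)"
    using assms by (simp add: compl_of_meet compat_carrier[OF assms(1)] compat_carrier[OF assms(2)] 
      compat_join_closed compat_compl)
  then show ?thesis using compat_carrier[OF assms(1)] compat_carrier[OF assms(2)] by simp
qed

text \<open>Put \<open>d = c \<and> a\<close>, which is compatible with \<open>b\<close>; with \<open>n = b \<and> d\<close>, the element \<open>a\<close> is the sum of \<open>b\<close>,
\<open>d1 = d \<ominus> n\<close> and a rest \<open>r\<close>, so \<open>a \<ominus> b = d1 + r\<close>. As \<open>c \<ominus> d\<close> is summable with all of \<open>a\<close>, the element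
\<open>d1\<close> is a common part of \<open>c\<close> and \<open>a \<ominus> b\<close>.\<close>
lemma compat_diff_closed:
  assumes "compat c a" "compat c b" "b \<preceq> a" shows "compat c (a \<ominus> b)"
proof -
  note C = compat_carrier[OF assms(1)] compat_carrier[OF assms(2)]
  define d where "d = c \<^bold>\<and> a"
  have d: "d \<in> carrier E" "d \<preceq> c" "d \<preceq> a" using C by (auto simp: d_def)
  have "compat b d" unfolding d_def
    by (rule compat_meet_closed[OF compat_commute[OF assms(2)] leq_compat[OF assms(3)]])
  note J = compat_join[OF this]
  have bd: "b \<^bold>\<and> d \<in> carrier E" "b \<^bold>\<and> d \<preceq> b" "b \<^bold>\<and> d \<preceq> d" using C d by auto
  define d1 where "d1 = d \<ominus> (b \<^bold>\<and> d)"
  define n where "n = b \<^bold>\<and> d"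
  have dn: "Some n \<boxplus> Some d1 = Some d" unfolding d1_def n_def using oadd_diff[OF bd(3)] .
  have J: "Some b \<boxplus> Some d1 = Some (b \<^bold>\<or> d)" using J by (simp add: d1_def)
  define r where "r = a \<ominus> (b \<^bold>\<or> d)"
  have R: "Some (b \<^bold>\<or> d) \<boxplus> Some r = Some a"
    unfolding r_def using join_least[OF assms(3) d(3)] by (rule oadd_diff)
  have b1r: "Some b \<boxplus> (Some d1 \<boxplus> Some r) = Some a" using J R by (simp flip: oadd_assoc)
  then obtain w where w: "Some d1 \<boxplus> Some r = Some w" by (cases "Some d1 \<boxplus> Some r") auto
  then have wab: "w = a \<ominus> b" using b1r diff_eqI[of b w a] by simp
  define c1 where "c1 = c \<ominus> d"
  have c1: "Some d \<boxplus> Some c1 = Some c" unfolding c1_def using oadd_diff[OF d(2)] .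
  have J2: "Some a \<boxplus> Some c1 = Some (a \<^bold>\<or> c)"
    using compat_join[OF compat_commute[OF assms(1)]] by (simp add: c1_def d_def meet_commute)
  obtain bn where bn: "Some n \<boxplus> Some bn = Some b" using oadd_diff[OF bd(2)] n_def by metis
  show ?thesis unfolding compat_def
  proof (intro exI conjI)
    have "((Some n \<boxplus> Some bn) \<boxplus> (Some d1 \<boxplus> Some r)) \<boxplus> Some c1 = Some (a \<^bold>\<or> c)"
      using b1r bn J2 by simp
    then have X: "Some bn \<boxplus> (((Some n \<boxplus> Some d1) \<boxplus> Some c1) \<boxplus> Some r) = Some (a \<^bold>\<or> c)"
      by (simp only: oadd_ac)
    have nc: "Some (n) \<boxplus> Some c1 \<noteq> None"
    proof
      assume N: "Some n \<boxplus> Some c1 = None"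
      have "((Some n \<boxplus> Some d1) \<boxplus> Some c1) = (Some n \<boxplus> Some c1) \<boxplus> Some d1" by (simp only: oadd_ac)
      then show False using X N by simp
    qed
    then have the: "Some (the (Some n \<boxplus> Some c1)) = Some n \<boxplus> Some c1" by auto
    have "Some (the (Some n \<boxplus> Some c1)) \<boxplus> Some d1 = (Some n \<boxplus> Some d1) \<boxplus> Some c1"
      unfolding the by (simp only: oadd_ac)
    then show 1: "Some (the (Some n \<boxplus> Some c1)) \<boxplus> Some d1 = Some c" using dn c1 by simp
    show "Some r \<boxplus> Some d1 = Some (a \<ominus> b)" using w wab by (simp add: oadd_commute)
    show "Some (the (Some n \<boxplus> Some c1)) \<boxplus> Some d1 \<boxplus> Some r \<noteq> None"
      unfolding 1 using X dn c1 by (cases "Some c \<boxplus> Some r") simp_all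
  qed
qed

lemma oadd_eq_compl_diff:
  assumes "Some a \<boxplus> Some b = Some d" shows "b \<preceq> a\<^sup>\<sim>" "d = (a\<^sup>\<sim> \<ominus> b)\<^sup>\<sim>"
proof -
  have C: "a \<in> carrier E" "b \<in> carrier E" "d \<in> carrier E" using oadd_carrier[OF assms] by auto
  have "Some a \<boxplus> (Some b \<boxplus> Some (d\<^sup>\<sim>)) = Some \<one>"
    using assms oadd_compl[OF C(3)] by (simp flip: oadd_assoc)
  then obtain w where w: "Some b \<boxplus> Some (d\<^sup>\<sim>) = Some w" "Some a \<boxplus> Some w = Some \<one>"
    by (cases "Some b \<boxplus> Some (d\<^sup>\<sim>)") auto
  then have "w = a\<^sup>\<sim>" using compl_unique by blast
  then show "b \<preceq> a\<^sup>\<sim>" "d = (a\<^sup>\<sim> \<ominus> b)\<^sup>\<sim>" using w diff_eqI[OF w(1)] leqI C by auto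
qed

lemma compat_oadd_closed:
  assumes "compat c a" "compat c b" "Some a \<boxplus> Some b = Some d" shows "compat c d"
  unfolding oadd_eq_compl_diff(2)[OF assms(3)]
  by (intro compat_compl compat_diff_closed assms oadd_eq_compl_diff(1)[OF assms(3)])

end

section \<open>Sharp elements and doubling when all elements are compatible\<close>

text \<open>Lattice effect algebras in which all pairs are compatible are exactly the MV-algebras; the truncated
sum is \<open>a + (b \<and> a\<^sup>\<sim>)\<close>.\<close>
locale sigma_mv = sigma_lattice_ea +
  assumes all_compat: "a \<in> carrier E \<Longrightarrow> b \<in> carrier E \<Longrightarrow> compat a b"
begin

lemma join_eq: "a \<in> carrier E \<Longrightarrow> b \<in> carrier E \<Longrightarrow> Some a \<boxplus> Some (b \<ominus> (a \<^bold>\<and> b)) = Some (a \<^bold>\<or> b)"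
  using compat_join all_compat by blast

lemma meet_sup: "countable A \<Longrightarrow> is_sup s A \<Longrightarrow> c \<in> carrier E \<Longrightarrow> is_sup (c \<^bold>\<and> s) ((\<^bold>\<and>) c ` A)"
  using compat_sup(2)[of A c s] all_compat is_supD(1)[of s A] by blast

lemma meet_join:
  assumes "a \<in> carrier E" "b \<in> carrier E" "c \<in> carrier E"
  shows "c \<^bold>\<and> (a \<^bold>\<or> b) = (c \<^bold>\<and> a) \<^bold>\<or> (c \<^bold>\<and> b)"
  using meet_sup[OF _ is_sup_join[OF assms(1,2)] assms(3)] 
    is_sup_join[of "c \<^bold>\<and> a" "c \<^bold>\<and> b"] assms is_sup_unique by auto

text \<open>A strong form of the Riesz decomposition property: \<open>x\<close> is the sum of its meet with \<open>a\<close>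
and a rest below \<open>b\<close>. Indeed this rest is \<open>(a \<or> x) \<ominus> a\<close>, and \<open>a \<or> x \<preceq> a + b\<close>.\<close>
lemma riesz:
  assumes "x \<preceq> d" "Some a \<boxplus> Some b = Some d"
  shows "x \<ominus> (x \<^bold>\<and> a) \<preceq> b"
proof -
  have C: "x \<in> carrier E" "a \<in> carrier E" using leq_carrier assms(1) oadd_carrier assms(2) by auto
  have "a \<^bold>\<or> x \<preceq> d" using assms leqI by (intro join_least) auto
  then show ?thesis
    using oadd_leq_cancel[OF join_eq[OF C(2,1)] assms(2)] by (simp add: meet_commute)
qed

lemma disjoint_riesz:
  assumes "x \<preceq> d" "Some a \<boxplus> Some b = Some d" "x \<^bold>\<and> a = \<zero>"
  shows "x \<preceq> b"
  using riesz[OF assms(1,2)] assms(3) leq_carrier[OF assms(1)] by simp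

lemma disjoint_oadd:
  assumes "Some a \<boxplus> Some b = Some d" "a \<^bold>\<and> y = \<zero>" "b \<^bold>\<and> y = \<zero>" "y \<in> carrier E"
  shows "d \<^bold>\<and> y = \<zero>"
proof -
  have C: "a \<in> carrier E" "b \<in> carrier E" "d \<in> carrier E" using oadd_carrier assms by auto
  let ?z = "d \<^bold>\<and> y"
  have z: "?z \<preceq> d" "?z \<preceq> y" using C assms by auto
  have "?z \<^bold>\<and> a \<preceq> y \<^bold>\<and> a" using z C by (intro meet_mono) auto
  then have "?z \<^bold>\<and> a = \<zero>" using assms leq_zero by (simp add: meet_commute)
  then have "?z \<preceq> b" using disjoint_riesz z assms by blast
  then have "?z \<preceq> b \<^bold>\<and> y" using z meet_greatest by blast
  then show ?thesis using assms leq_zero by simp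
qed

lemma disjoint_join: "a \<in> carrier E \<Longrightarrow> b \<in> carrier E \<Longrightarrow> a \<^bold>\<and> b = \<zero> \<Longrightarrow> Some a \<boxplus> Some b = Some (a \<^bold>\<or> b)"
  using join_eq[of a b] by simp

text \<open>On elements of the carrier this agrees with \<^const>\<open>sharp_element\<close>, because all meets exist here. Sharp
elements are central: by the next lemmas \<open>a \<mapsto> (a \<and> e, a \<and> e\<^sup>\<sim>)\<close> splits the whole algebra into a product.
To say that something holds ``on \<open>e\<close>'' means that it holds after meeting with \<open>e\<close>.\<close>
definition sharp where "sharp e \<longleftrightarrow> e \<in> carrier E \<and> e \<^bold>\<and> e\<^sup>\<sim> = \<zero>"

lemma sharpD: "sharp e \<Longrightarrow> e \<in> carrier E" "sharp e \<Longrightarrow> e \<^bold>\<and> e\<^sup>\<sim> = \<zero>"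
  by (auto simp: sharp_def)

lemma sharp_one [simp]: "sharp \<one>" and sharp_zero [simp]: "sharp \<zero>"
  by (auto simp: sharp_def)

lemma sharp_compl [simp]: "sharp e \<Longrightarrow> sharp (e\<^sup>\<sim>)"
  by (auto simp: sharp_def meet_commute)

lemma sharp_disjoint:
  assumes "sharp e" "a \<preceq> e" "a \<preceq> e\<^sup>\<sim>" shows "a = \<zero>"
  using meet_greatest[OF assms(2,3)] sharpD(2)[OF assms(1)] leq_zero by simp

lemma sharp_split:
  assumes "sharp e" "a \<in> carrier E"
  shows "Some (a \<^bold>\<and> e) \<boxplus> Some (a \<^bold>\<and> e\<^sup>\<sim>) = Some a"
proof -
  note e = sharpD[OF assms(1)]
  have "e \<^bold>\<or> e\<^sup>\<sim> = \<one>" using disjoint_join[OF e(1) _ e(2)] oadd_compl[OF e(1)] e(1) by simp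
  then have 1: "(a \<^bold>\<and> e) \<^bold>\<or> (a \<^bold>\<and> e\<^sup>\<sim>) = a" using meet_join[of e "e\<^sup>\<sim>" a] e assms by simp
  have "(a \<^bold>\<and> e) \<^bold>\<and> (a \<^bold>\<and> e\<^sup>\<sim>) \<preceq> e \<^bold>\<and> e\<^sup>\<sim>" using e assms by (intro meet_mono) auto
  then have "(a \<^bold>\<and> e) \<^bold>\<and> (a \<^bold>\<and> e\<^sup>\<sim>) = \<zero>" using e leq_zero by simp
  then show ?thesis using disjoint_join[of "a \<^bold>\<and> e" "a \<^bold>\<and> e\<^sup>\<sim>"] 1 e assms by simp
qed

lemma sharp_leqI:
  assumes "sharp e" "z \<in> carrier E" "z \<^bold>\<and> e\<^sup>\<sim> = \<zero>" shows "z \<preceq> e"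
proof -
  have "z \<^bold>\<and> e = z" using sharp_split[OF assms(1,2)] assms sharpD by simp
  then show ?thesis using meet(3)[of z e] assms sharpD by simp
qed

lemma sharp_leqI2:
  assumes "sharp e" "z \<in> carrier E" "z \<^bold>\<and> e = \<zero>" shows "z \<preceq> e\<^sup>\<sim>"
  using sharp_leqI[of "e\<^sup>\<sim>" z] assms sharpD by simp

text \<open>The partial sums on \<open>e\<close> and on its complement stay below \<open>e\<close> and below the complement, because an
element disjoint from both summands is disjoint from the sum; by \<open>sharp_split\<close> they add up to \<open>d\<close>.\<close>
lemma meet_oadd:
  assumes e: "sharp e" and s: "Some a \<boxplus> Some b = Some d"
  shows "Some (a \<^bold>\<and> e) \<boxplus> Some (b \<^bold>\<and> e) = Some (d \<^bold>\<and> e)"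
proof -
  note eC = sharpD(1)[OF e] and C = oadd_carrier[OF s]
  have part: "\<exists>z. Some (a \<^bold>\<and> f) \<boxplus> Some (b \<^bold>\<and> f) = Some z \<and> z \<preceq> f" if f: "sharp f" for f
  proof -
    note fC = sharpD(1)[OF f]
    have af: "a \<^bold>\<and> f \<preceq> a" "b \<^bold>\<and> f \<preceq> b" using fC C by auto
    obtain z where z: "Some (a \<^bold>\<and> f) \<boxplus> Some (b \<^bold>\<and> f) = Some z" using oadd_mono2[OF af s] by blast
    have "(a \<^bold>\<and> f) \<^bold>\<and> f\<^sup>\<sim> = \<zero>" "(b \<^bold>\<and> f) \<^bold>\<and> f\<^sup>\<sim> = \<zero>"
      using C fC sharpD(2)[OF f] by (simp_all add: meet_assoc)
    then have "z \<^bold>\<and> f\<^sup>\<sim> = \<zero>" using disjoint_oadd[OF z] fC by simp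
    then show ?thesis using z sharp_leqI[OF f] oadd_carrier[OF z] by blast
  qed
  obtain z where z: "Some (a \<^bold>\<and> e) \<boxplus> Some (b \<^bold>\<and> e) = Some z" "z \<preceq> e" using part[OF e] by blast
  obtain w where w: "Some (a \<^bold>\<and> e\<^sup>\<sim>) \<boxplus> Some (b \<^bold>\<and> e\<^sup>\<sim>) = Some w" "w \<preceq> e\<^sup>\<sim>" 
    using part[OF sharp_compl[OF e]] by blast
  have "Some d = (Some (a \<^bold>\<and> e) \<boxplus> Some (a \<^bold>\<and> e\<^sup>\<sim>)) \<boxplus> (Some (b \<^bold>\<and> e) \<boxplus> Some (b \<^bold>\<and> e\<^sup>\<sim>))"
    using s sharp_split[OF e] C by simp
  also have "\<dots> = (Some (a \<^bold>\<and> e) \<boxplus> Some (b \<^bold>\<and> e)) \<boxplus> (Some (a \<^bold>\<and> e\<^sup>\<sim>) \<boxplus> Some (b \<^bold>\<and> e\<^sup>\<sim>))"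
    by (simp only: oadd_ac)
  finally have d: "Some z \<boxplus> Some w = Some d" using z w by simp
  have "z \<preceq> d \<^bold>\<and> e" using z leqI[OF d] meet_greatest by blast
  moreover have "d \<^bold>\<and> e \<preceq> z"
  proof -
    let ?u = "d \<^bold>\<and> e"
    have uC: "?u \<in> carrier E" "z \<in> carrier E" using C eC z leq_carrier by auto
    have "?u \<ominus> (?u \<^bold>\<and> z) \<preceq> w" using riesz[OF _ d] C eC by simp
    then have "?u \<ominus> (?u \<^bold>\<and> z) \<preceq> e\<^sup>\<sim>" using w leq_trans by blast
    moreover have "?u \<ominus> (?u \<^bold>\<and> z) \<preceq> ?u" using diff_leq uC by simp
    then have "?u \<ominus> (?u \<^bold>\<and> z) \<preceq> e" using leq_trans[of _ ?u e] C eC by simp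
    ultimately have "?u \<ominus> (?u \<^bold>\<and> z) = \<zero>" using sharp_disjoint[OF e] by blast
    then have "?u \<^bold>\<and> z = ?u" using diff_eq_zero[of "?u \<^bold>\<and> z" ?u] uC by simp
    then show ?thesis using meet(3)[of ?u z] uC by simp
  qed
  ultimately have "z = d \<^bold>\<and> e" by (rule leq_antisym)
  then show ?thesis using z by simp
qed

lemma oadd_compl_at: "sharp e \<Longrightarrow> a \<in> carrier E \<Longrightarrow> Some (a \<^bold>\<and> e) \<boxplus> Some (a\<^sup>\<sim> \<^bold>\<and> e) = Some e"
  using meet_oadd[OF _ oadd_compl[of a]] sharpD(1) by simp

lemma sharp_meet [simp]:
  assumes "sharp e" "sharp f" shows "sharp (e \<^bold>\<and> f)"
proof -
  note C = sharpD(1)[OF assms(1)] sharpD(1)[OF assms(2)]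
  have "(e \<^bold>\<and> f) \<^bold>\<and> e\<^sup>\<sim> \<preceq> e \<^bold>\<and> e\<^sup>\<sim>" "(e \<^bold>\<and> f) \<^bold>\<and> f\<^sup>\<sim> \<preceq> f \<^bold>\<and> f\<^sup>\<sim>"
    using C by (intro meet_mono; simp)+
  then have "(e \<^bold>\<and> f) \<^bold>\<and> e\<^sup>\<sim> = \<zero>" "(e \<^bold>\<and> f) \<^bold>\<and> f\<^sup>\<sim> = \<zero>"
    using assms sharpD(2) leq_zero by simp_all
  then have "(e \<^bold>\<and> f) \<^bold>\<and> (e \<^bold>\<and> f)\<^sup>\<sim> = \<zero> \<^bold>\<or> \<zero>"
    using C by (simp add: compl_of_meet meet_join)
  also have "\<zero> \<^bold>\<or> \<zero> = \<zero>" by (simp add: leq_antisym join_least)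
  finally show ?thesis using C by (simp add: sharp_def)
qed

text \<open>For real numbers in the unit interval, \<open>dbl a = min (2a) 1\<close> and \<open>excess a = max (2a - 1) 0\<close>; the truncations
come from replacing one summand \<open>a\<close> by the minimum of \<open>a\<close> and \<open>1 - a\<close>.\<close>
definition dbl where "dbl a = the (Some a \<boxplus> Some (a \<^bold>\<and> a\<^sup>\<sim>))"
definition excess where "excess a = a \<ominus> (a \<^bold>\<and> a\<^sup>\<sim>)"

lemma oadd_dbl: "a \<in> carrier E \<Longrightarrow> Some a \<boxplus> Some (a \<^bold>\<and> a\<^sup>\<sim>) = Some (dbl a)"
  unfolding dbl_def using oadd_mono2[of a a "a \<^bold>\<and> a\<^sup>\<sim>" "a\<^sup>\<sim>" \<one>] oadd_compl[of a]
  by (metis compl_closed leq_refl meet(3) option.sel)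

lemma oadd_excess: "a \<in> carrier E \<Longrightarrow> Some (a \<^bold>\<and> a\<^sup>\<sim>) \<boxplus> Some (excess a) = Some a"
  unfolding excess_def by (simp add: oadd_diff)

lemma dbl_closed [simp]: "a \<in> carrier E \<Longrightarrow> dbl a \<in> carrier E"
  and excess_closed [simp]: "a \<in> carrier E \<Longrightarrow> excess a \<in> carrier E"
  using oadd_dbl oadd_excess oadd_carrier by blast+

lemma leq_dbl: "a \<in> carrier E \<Longrightarrow> a \<preceq> dbl a"
  using oadd_dbl leqI by blast

lemma iter_dbl_closed [simp]: "a \<in> carrier E \<Longrightarrow> (dbl ^^ n) a \<in> carrier E"
  by (induction n) auto

lemma iter_dbl_mono: "a \<in> carrier E \<Longrightarrow> m \<le> n \<Longrightarrow> (dbl ^^ m) a \<preceq> (dbl ^^ n) a"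
  by (induction n) (auto simp: le_Suc_eq intro: leq_trans[OF _ leq_dbl])

lemma dbl_at_small:
  assumes "sharp e" "a \<in> carrier E" "a \<^bold>\<and> e \<preceq> a\<^sup>\<sim>"
  shows "Some (a \<^bold>\<and> e) \<boxplus> Some (a \<^bold>\<and> e) = Some (dbl a \<^bold>\<and> e)"
proof -
  note eC = sharpD(1)[OF assms(1)]
  have "(a \<^bold>\<and> a\<^sup>\<sim>) \<^bold>\<and> e = (a \<^bold>\<and> e) \<^bold>\<and> a\<^sup>\<sim>"
    using eC assms(2) by (simp add: meet_assoc meet_commute[of e])
  also have "\<dots> = a \<^bold>\<and> e" using assms(3) meet_absorb1 by blast
  finally show ?thesis using meet_oadd[OF assms(1) oadd_dbl[OF assms(2)]] by simp
qed

lemma meet_compl_at_large: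
  assumes "sharp e" "a \<in> carrier E" "a\<^sup>\<sim> \<^bold>\<and> e \<preceq> a"
  shows "(a \<^bold>\<and> a\<^sup>\<sim>) \<^bold>\<and> e = a\<^sup>\<sim> \<^bold>\<and> e"
proof -
  have "(a \<^bold>\<and> a\<^sup>\<sim>) \<^bold>\<and> e = a \<^bold>\<and> (a\<^sup>\<sim> \<^bold>\<and> e)"
    using assms(2) sharpD(1)[OF assms(1)] by (simp add: meet_assoc)
  also have "\<dots> = a\<^sup>\<sim> \<^bold>\<and> e" using meet_absorb2[OF assms(3)] .
  finally show ?thesis .
qed

lemma dbl_at_large:
  assumes "sharp e" "a \<in> carrier E" "a\<^sup>\<sim> \<^bold>\<and> e \<preceq> a"
  shows "dbl a \<^bold>\<and> e = e"
  using meet_oadd[OF assms(1) oadd_dbl[OF assms(2)]] oadd_compl_at[OF assms(1,2)]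
    meet_compl_at_large[OF assms] by simp

lemma excess_at_large:
  assumes "sharp e" "a \<in> carrier E" "a\<^sup>\<sim> \<^bold>\<and> e \<preceq> a"
  shows "Some (a\<^sup>\<sim> \<^bold>\<and> e) \<boxplus> Some (excess a \<^bold>\<and> e) = Some (a \<^bold>\<and> e)"
  using meet_oadd[OF assms(1) oadd_excess[OF assms(2)]] meet_compl_at_large[OF assms] by simp

lemma leq_diff_self:
  assumes "x \<preceq> s" "s \<preceq> s \<ominus> x" shows "x = \<zero>"
proof -
  have "s \<ominus> x = s" using diff_leq assms leq_antisym by blast
  then have "Some s \<boxplus> Some x = Some s" using oadd_diff[OF assms(1)] by (simp add: oadd_commute)
  moreover have "Some s \<boxplus> Some \<zero> = Some s" using leq_carrier assms by simp
  ultimately show ?thesis using oadd_cancel by blast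
qed

text \<open>The form in which completeness excludes infinitesimals: if \<open>z\<close> can be added to every member of a
sequence without leaving the bound \<open>s\<close>, then \<open>s \<ominus> z\<close> is an upper bound as well.\<close>
lemma sup_absorb_zero:
  fixes X :: "nat \<Rightarrow> 'a"
  assumes s: "is_sup s (range X)" and step: "\<And>n. \<exists>w. Some (X n) \<boxplus> Some z = Some w \<and> w \<preceq> s"
  shows "z = \<zero>"
proof (rule leq_diff_self)
  show zs: "z \<preceq> s" using step[of 0] leqI2 leq_trans by blast
  show "s \<preceq> s \<ominus> z"
  proof (rule is_supD(4)[OF s])
    fix a assume "a \<in> range X"
    then obtain n where n: "a = X n" by auto
    obtain w where w: "Some z \<boxplus> Some (X n) = Some w" "w \<preceq> s" using step[of n] by (auto simp: oadd_commute)
    show "a \<preceq> s \<ominus> z" unfolding n using leq_diff_iff[OF w] .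
  qed (use zs in simp)
qed

text \<open>The support of \<open>x\<close> is the supremum \<open>s\<close> of the doublings \<open>dbl\<^sup>n x\<close>. To see that it is sharp, note that
\<open>X\<^sub>k \<and> s\<^sup>\<sim> \<preceq> X\<^sub>m \<and> X\<^sub>m\<^sup>\<sim>\<close> for \<open>k \<le> m\<close> and that adding the latter to \<open>X\<^sub>m\<close> gives \<open>X\<^sub>m\<^sub>+\<^sub>1 \<preceq> s\<close>;
so \<open>s \<and> s\<^sup>\<sim>\<close> can be added to every \<open>X\<^sub>n\<close> below \<open>s\<close>. An element disjoint from \<open>x\<close> stays disjoint from
each doubling.\<close>
lemma support:
  assumes x: "x \<in> carrier E"
  obtains s where "sharp s" "x \<preceq> s" "\<And>y. y \<in> carrier E \<Longrightarrow> x \<^bold>\<and> y = \<zero> \<Longrightarrow> s \<^bold>\<and> y = \<zero>"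
proof -
  define X where "X n = (dbl ^^ n) x" for n
  have XC: "X n \<in> carrier E" for n using x by (simp add: X_def)
  have Xm: "m \<le> n \<Longrightarrow> X m \<preceq> X n" for m n using iter_dbl_mono[OF x] by (simp add: X_def)
  obtain s where s: "is_sup s (range X)" using countable_is_sup[of "range X"] XC by auto
  have sC: "s \<in> carrier E" and Xs: "X n \<preceq> s" for n using is_supD[OF s] by auto
  have "s \<^bold>\<and> s\<^sup>\<sim> = \<zero>"
  proof (rule sup_absorb_zero[OF s])
    fix n
    have ms: "is_sup (s\<^sup>\<sim> \<^bold>\<and> s) ((\<^bold>\<and>) (s\<^sup>\<sim>) ` range X)" using meet_sup[OF _ s, of "s\<^sup>\<sim>"] sC by simp
    have "s\<^sup>\<sim> \<^bold>\<and> s \<preceq> s \<ominus> X n"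
    proof (rule is_supD(4)[OF ms])
      fix a assume "a \<in> (\<^bold>\<and>) (s\<^sup>\<sim>) ` range X"
      then obtain k where k: "a = s\<^sup>\<sim> \<^bold>\<and> X k" by auto
      define m where "m = max n k"
      have "X k \<preceq> X m" "s\<^sup>\<sim> \<preceq> (X m)\<^sup>\<sim>" using Xm Xs compl_antimono by (auto simp: m_def)
      then have "a \<preceq> X m \<^bold>\<and> (X m)\<^sup>\<sim>" unfolding k by (subst meet_commute) (rule meet_mono)
      moreover have "X n \<preceq> X m" using Xm by (simp add: m_def)
      ultimately obtain e where e: "Some (X n) \<boxplus> Some a = Some e" "e \<preceq> dbl (X m)"
        using oadd_mono2 oadd_dbl[OF XC[of m]] by blast
      have "dbl (X m) = X (Suc m)" by (simp add: X_def)
      then have "e \<preceq> s" using e Xs leq_trans by metis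
      then show "a \<preceq> s \<ominus> X n" using leq_diff_iff e by blast
    qed (use Xs in simp)
    then show "\<exists>w. Some (X n) \<boxplus> Some (s \<^bold>\<and> s\<^sup>\<sim>) = Some w \<and> w \<preceq> s"
      using leq_diffD[OF Xs] by (simp add: meet_commute)
  qed
  then have "sharp s" using sC by (simp add: sharp_def)
  moreover have "x \<preceq> s" using Xs[of 0] by (simp add: X_def)
  moreover have "s \<^bold>\<and> y = \<zero>" if y: "y \<in> carrier E" "x \<^bold>\<and> y = \<zero>" for y
  proof -
    have X0: "X n \<^bold>\<and> y = \<zero>" for n
    proof (induction n)
      case 0 then show ?case using y by (simp add: X_def)
    next
      case (Suc n)
      have "(X n \<^bold>\<and> (X n)\<^sup>\<sim>) \<^bold>\<and> y \<preceq> X n \<^bold>\<and> y" using XC y by (intro meet_mono) auto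
      then have "(X n \<^bold>\<and> (X n)\<^sup>\<sim>) \<^bold>\<and> y = \<zero>" using Suc leq_zero by simp
      then have "dbl (X n) \<^bold>\<and> y = \<zero>" using disjoint_oadd[OF oadd_dbl[OF XC] Suc] y by blast
      then show ?case by (simp add: X_def)
    qed
    have "is_sup (y \<^bold>\<and> s) ((\<^bold>\<and>) y ` range X)" using meet_sup[OF _ s] y by simp
    then have "y \<^bold>\<and> s \<preceq> \<zero>" by (rule is_supD(4)) (auto simp: meet_commute[of y] X0)
    then show ?thesis using leq_zero by (simp add: meet_commute)
  qed
  ultimately show ?thesis using that by blast
qed

text \<open>The elements \<open>a \<ominus> (a \<and> b)\<close> and \<open>b \<ominus> (a \<and> b)\<close> are disjoint, so the support \<open>s\<close> of the first is disjoint
from the second: \<open>b \<preceq> a\<close> on \<open>s\<close>, and \<open>a \<preceq> b\<close> on the complement of \<open>s\<close>.\<close>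
lemma comparability:
  assumes "a \<in> carrier E" "b \<in> carrier E"
  obtains e where "sharp e" "a \<^bold>\<and> e \<preceq> b" "b \<^bold>\<and> e\<^sup>\<sim> \<preceq> a"
proof -
  define g where "g = a \<^bold>\<and> b"
  have g: "g \<in> carrier E" "g \<preceq> a" "g \<preceq> b" using assms by (auto simp: g_def)
  have xy: "a \<ominus> g \<in> carrier E" "b \<ominus> g \<in> carrier E" using g by auto
  have "(a \<ominus> g) \<^bold>\<and> (b \<ominus> g) = \<zero>"
    using meet_diff_zero[OF assms] xy by (simp add: g_def)
  then obtain s where s: "sharp s" "a \<ominus> g \<preceq> s" "s \<^bold>\<and> (b \<ominus> g) = \<zero>"
    using support[OF xy(1)] xy(2) by metis
  have part: "c \<^bold>\<and> f \<preceq> g" if "sharp f" "g \<preceq> c" "(c \<ominus> g) \<^bold>\<and> f = \<zero>" for c f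
  proof -
    note fC = sharpD(1)[OF that(1)]
    have "g \<^bold>\<and> f = c \<^bold>\<and> f" using meet_oadd[OF that(1) oadd_diff[OF that(2)]] that(3) fC g by simp
    then show ?thesis using meet(2)[of g f] fC g by simp
  qed
  have sC: "s \<in> carrier E" using sharpD s by blast
  have "(a \<ominus> g) \<^bold>\<and> s\<^sup>\<sim> \<preceq> s \<^bold>\<and> s\<^sup>\<sim>" using s(2) sC by (intro meet_mono) auto
  then have "(a \<ominus> g) \<^bold>\<and> s\<^sup>\<sim> = \<zero>" using sharpD(2)[OF s(1)] leq_zero by simp
  then have 1: "a \<^bold>\<and> s\<^sup>\<sim> \<preceq> b" using part[of "s\<^sup>\<sim>" a] s g leq_trans by simp
  have "b \<^bold>\<and> s \<preceq> g" using part[of s b] s g by (simp add: meet_commute)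
  then have 2: "b \<^bold>\<and> s\<^sup>\<sim>\<^sup>\<sim> \<preceq> a" using g sC leq_trans by simp
  show ?thesis using that[OF sharp_compl[OF s(1)] 1 2] .
qed

text \<open>Sequences decreasing to zero: preserving a monotone limit amounts to preserving one of these.\<close>
definition nullseq :: "(nat \<Rightarrow> 'a) \<Rightarrow> bool" where
  "nullseq d \<longleftrightarrow> (\<forall>n. d (Suc n) \<preceq> d n) \<and> (\<forall>z. (\<forall>n. z \<preceq> d n) \<longrightarrow> z = \<zero>)"

lemma nullseq_antimono: "nullseq d \<Longrightarrow> m \<le> n \<Longrightarrow> d n \<preceq> d m"
proof (induction n)
  case 0
  then show ?case using leq_carrier[of "d (Suc 0)" "d 0"] by (simp add: nullseq_def)
next
  case (Suc n)
  then have *: "d (Suc n) \<preceq> d n" by (simp add: nullseq_def)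
  show ?case
  proof (cases "m = Suc n")
    case False
    then show ?thesis using Suc * leq_trans by auto
  qed (use * leq_carrier in auto)
qed

lemma nullseq_carrier: "nullseq d \<Longrightarrow> d n \<in> carrier E"
  using nullseq_antimono leq_carrier by blast

text \<open>On the part where \<open>b\<close> is at most one half, doubling is plain addition, and on the other part \<open>dbl b\<close>
is everything.\<close>
lemma dbl_mono:
  assumes "a \<preceq> b" shows "dbl a \<preceq> dbl b"
proof -
  have C: "a \<in> carrier E" "b \<in> carrier E" using leq_carrier assms by auto
  obtain e where e: "sharp e" "b \<^bold>\<and> e \<preceq> b\<^sup>\<sim>" "b\<^sup>\<sim> \<^bold>\<and> e\<^sup>\<sim> \<preceq> b" using comparability[of b "b\<^sup>\<sim>"] C by auto
  have eC: "e \<in> carrier E" using e sharpD by blast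
  have ab: "a \<^bold>\<and> e \<preceq> b \<^bold>\<and> e" using assms eC by (intro meet_mono) auto
  then have "a \<^bold>\<and> e \<preceq> a\<^sup>\<sim>" using e(2) compl_antimono[OF assms] leq_trans by metis
  then have "dbl a \<^bold>\<and> e \<preceq> dbl b \<^bold>\<and> e"
    using oadd_leq_mono[OF ab ab dbl_at_small[OF e(1) C(1)] dbl_at_small[OF e(1) C(2) e(2)]] by blast
  moreover have "dbl a \<^bold>\<and> e\<^sup>\<sim> \<preceq> dbl b \<^bold>\<and> e\<^sup>\<sim>"
    using dbl_at_large[OF _ C(2) e(3)] e(1) C(1) eC by simp
  ultimately show ?thesis
    using oadd_leq_mono sharp_split[OF e(1)] C dbl_closed by blast
qed

text \<open>By the Riesz property \<open>z \<ominus> (z \<and> d\<^sub>k) \<preceq> d\<^sub>k\<close> for a lower bound \<open>z\<close> of the doubled sequence. The elements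
on the left increase to \<open>z\<close>, since \<open>z\<close> exceeds their supremum by a lower bound of all \<open>d\<^sub>k\<close>; and each of them is
below each \<open>d\<^sub>n\<close>. So \<open>z\<close> itself is a lower bound of the \<open>d\<^sub>n\<close>.\<close>
lemma nullseq_dbl: 
  assumes d: "nullseq d" shows "nullseq (\<lambda>n. dbl (d n))"
  unfolding nullseq_def
proof (intro conjI allI impI)
  show "dbl (d (Suc n)) \<preceq> dbl (d n)" for n using nullseq_antimono[OF d, of n "Suc n"] dbl_mono by simp
  fix z assume z: "\<forall>n. z \<preceq> dbl (d n)"
  have zC: "z \<in> carrier E" using z leq_carrier by blast
  note dC = nullseq_carrier[OF d]
  define Y where "Y k = z \<ominus> (z \<^bold>\<and> d k)" for k
  have zd: "z \<^bold>\<and> d k \<preceq> z" for k using zC dC by simp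
  have Yd: "Y k \<preceq> d n" for k n
  proof -
    have base: "Y k \<preceq> d k" for k
      using riesz[OF z[rule_format, of k] oadd_dbl[OF dC]] meet(2)[of "d k" "(d k)\<^sup>\<sim>"] dC leq_trans
      unfolding Y_def by (metis compl_closed)
    show ?thesis
    proof (cases "n \<le> k")
      case True then show ?thesis using base nullseq_antimono[OF d] leq_trans by blast
    next
      case False
      then have "z \<^bold>\<and> d n \<preceq> z \<^bold>\<and> d k" using nullseq_antimono[OF d, of k n] zC by (intro meet_mono) auto
      then have "Y k \<preceq> Y n" unfolding Y_def using diff_antimono zd by blast
      then show ?thesis using base leq_trans by blast
    qed
  qed
  have YC: "range Y \<subseteq> carrier E" using Yd leq_carrier by blast
  obtain s where s: "is_sup s (range Y)" using countable_is_sup[OF YC] by auto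
  have sz: "s \<preceq> z" using is_supD(4)[OF s zC] diff_leq[OF zd] by (auto simp: Y_def)
  have "z \<ominus> s \<preceq> d k" for k
  proof -
    have Ys: "Y k \<preceq> s" using is_supD(3)[OF s] by blast
    have "z \<ominus> s \<preceq> z \<ominus> Y k" using diff_antimono[OF Ys sz] .
    also have "z \<ominus> Y k = z \<^bold>\<and> d k" unfolding Y_def using diff_diff[OF zd] .
    also have "\<dots> \<preceq> d k" using zC dC by simp
    finally show ?thesis .
  qed
  then have "z \<ominus> s = \<zero>" using d by (auto simp: nullseq_def)
  then have "s = z" using diff_eq_zero[OF sz] by simp
  then have "z \<preceq> d n" for n using is_supD(4)[OF s dC] Yd by blast
  then show "z = \<zero>" using d by (auto simp: nullseq_def)
qed

text \<open>The density condition behind the choice of an ultrafilter: below every nonzero sharp \<open>p\<close> there is a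
sharp part on which some member of the sequence is at most one half. Otherwise every member is at
least one half on \<open>p\<close>, and then \<open>p\<close> is a lower bound of the doubled sequence.\<close>
lemma nullseq_dense:
  assumes d: "nullseq d" and p: "sharp p" "p \<noteq> \<zero>"
  shows "\<exists>q n. sharp q \<and> q \<noteq> \<zero> \<and> q \<preceq> p \<and> d n \<^bold>\<and> q \<preceq> (d n)\<^sup>\<sim>"
proof (rule ccontr)
  assume neg: "\<not> ?thesis"
  note dC = nullseq_carrier[OF d] and pC = sharpD(1)[OF p(1)]
  have "p \<preceq> dbl (d n)" for n
  proof -
    obtain e where e: "sharp e" "d n \<^bold>\<and> e \<preceq> (d n)\<^sup>\<sim>" "(d n)\<^sup>\<sim> \<^bold>\<and> e\<^sup>\<sim> \<preceq> d n"
      using comparability[of "d n" "(d n)\<^sup>\<sim>"] dC by auto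
    have eC: "e \<in> carrier E" using e sharpD by blast
    have "d n \<^bold>\<and> (p \<^bold>\<and> e) \<preceq> d n \<^bold>\<and> e" using dC pC eC by (intro meet_mono) auto
    then have "d n \<^bold>\<and> (p \<^bold>\<and> e) \<preceq> (d n)\<^sup>\<sim>" using e leq_trans by blast
    moreover have "p \<^bold>\<and> e \<preceq> p" using pC eC by simp
    ultimately have "p \<^bold>\<and> e = \<zero>" using neg sharp_meet[OF p(1) e(1)] by blast
    then have "p \<preceq> e\<^sup>\<sim>" using sharp_leqI2[OF e(1) pC] by simp
    then have "(d n)\<^sup>\<sim> \<^bold>\<and> p \<preceq> (d n)\<^sup>\<sim> \<^bold>\<and> e\<^sup>\<sim>" using dC by (intro meet_mono) auto
    then have "(d n)\<^sup>\<sim> \<^bold>\<and> p \<preceq> d n" using e leq_trans by blast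
    from dbl_at_large[OF p(1) dC this] show ?thesis
      using meet(2)[of "dbl (d n)" p] dC pC by simp
  qed
  then show False using nullseq_dbl[OF d] p(2) by (auto simp: nullseq_def)
qed

end

section \<open>Ultrafilters of sharp elements and binary expansions\<close>

context sigma_mv
begin

text \<open>Ultrafilters of the Boolean algebra of sharp elements.\<close>
definition ultra :: "'a set \<Rightarrow> bool" where
  "ultra U \<longleftrightarrow> U \<subseteq> Collect sharp \<and> \<zero> \<notin> U \<and> (\<forall>e\<in>U. \<forall>f\<in>U. e \<^bold>\<and> f \<in> U) \<and>
     (\<forall>e. sharp e \<longrightarrow> e \<in> U \<or> e\<^sup>\<sim> \<in> U)"

text \<open>Zorn's lemma gives a maximal meet-closed set \<open>V\<close> of nonzero sharp elements containing the sequence. By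
maximality a sharp \<open>e\<close> outside \<open>V\<close> is disjoint from a member of \<open>V\<close>; if this happened to \<open>e\<close> and its
complement, two members of \<open>V\<close> would be disjoint.\<close>
lemma ultra_exists:
  fixes p :: "nat \<Rightarrow> 'a"
  assumes p: "\<And>n. sharp (p n)" "\<And>n. p n \<noteq> \<zero>" "\<And>n. p (Suc n) \<preceq> p n"
  obtains U where "ultra U" "range p \<subseteq> U"
proof -
  define F where "F = {V. range p \<subseteq> V \<and> V \<subseteq> Collect sharp \<and> \<zero> \<notin> V \<and> (\<forall>e\<in>V. \<forall>f\<in>V. e \<^bold>\<and> f \<in> V)}"
  have pm: "m \<le> n \<Longrightarrow> p n \<preceq> p m" for m n
  proof (induction n)
    case 0
    then show ?case using sharpD(1)[OF p(1)] by simp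
  next
    case (Suc n)
    then show ?case using p(3)[of n] sharpD(1)[OF p(1)] leq_trans by (cases "m = Suc n") auto
  qed
  have "p i \<^bold>\<and> p j \<in> range p" for i j
    using pm[of i j] pm[of j i] meet_absorb1[of "p j" "p i"] meet_absorb1[of "p i" "p j"]
    by (cases "i \<le> j") (auto simp: meet_commute[of "p i" "p j"])
  moreover have "\<zero> \<notin> range p" using p(2) by (metis rangeE)
  ultimately have base: "range p \<in> F" using p(1) by (auto simp: F_def)
  have "\<exists>V\<in>F. \<forall>X\<in>F. V \<subseteq> X \<longrightarrow> X = V"
  proof (rule subset_Zorn_nonempty)
    show "F \<noteq> {}" using base by auto
    fix C assume C: "C \<noteq> {}" "subset.chain F C"
    have CF: "V \<in> F" if "V \<in> C" for V using C that by (auto simp: subset.chain_def)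
    have "e \<^bold>\<and> f \<in> \<Union>C" if ef: "e \<in> \<Union>C" "f \<in> \<Union>C" for e f
    proof -
      obtain V W where V: "V \<in> C" "e \<in> V" "W \<in> C" "f \<in> W" using ef by auto
      then have "V \<subseteq> W \<or> W \<subseteq> V" using C by (auto simp: subset.chain_def)
      then obtain X where X: "X \<in> C" "e \<in> X" "f \<in> X" using V by auto
      then have "e \<^bold>\<and> f \<in> X" using CF[of X] by (simp add: F_def)
      then show ?thesis using X by blast
    qed
    moreover have "range p \<subseteq> \<Union>C" using C(1) CF by (fastforce simp: F_def)
    moreover have "\<Union>C \<subseteq> Collect sharp" "\<zero> \<notin> \<Union>C" using CF by (fastforce simp: F_def)+
    ultimately show "\<Union>C \<in> F" unfolding F_def by blast
  qed
  then obtain V where V: "V \<in> F" and max: "\<And>X. X \<in> F \<Longrightarrow> V \<subseteq> X \<Longrightarrow> X = V" by blast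
  have Vs: "range p \<subseteq> V" "\<And>e. e \<in> V \<Longrightarrow> sharp e" "\<zero> \<notin> V" "\<And>e f. e \<in> V \<Longrightarrow> f \<in> V \<Longrightarrow> e \<^bold>\<and> f \<in> V"
    using V by (auto simp: F_def)
  have VC: "e \<in> V \<Longrightarrow> e \<in> carrier E" for e using Vs(2) sharpD(1) by blast
  have key: "\<exists>v\<in>V. v \<^bold>\<and> e = \<zero>" if e: "sharp e" "e \<notin> V" for e
  proof (rule ccontr)
    assume neg: "\<not> ?thesis"
    have eC: "e \<in> carrier E" using e sharpD by blast
    \<comment> \<open>The filter generated by \<open>V\<close> and \<open>e\<close>.\<close>
    define W where "W = {f. sharp f \<and> (\<exists>v\<in>V. v \<^bold>\<and> e \<preceq> f)}"
    have "V \<subseteq> W" using Vs(2) VC eC unfolding W_def by (auto intro!: bexI)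
    moreover have "e \<in> W" using Vs(1) VC eC e unfolding W_def by (auto intro!: bexI[of _ "p 0"])
    moreover have "W \<in> F"
    proof -
      have "\<zero> \<notin> W" using neg leq_zero by (auto simp: W_def)
      moreover have "f \<^bold>\<and> g \<in> W" if fg: "f \<in> W" "g \<in> W" for f g
      proof -
        obtain v w where vw: "v \<in> V" "w \<in> V" "v \<^bold>\<and> e \<preceq> f" "w \<^bold>\<and> e \<preceq> g" using fg by (auto simp: W_def)
        have "(v \<^bold>\<and> w) \<^bold>\<and> e \<preceq> v \<^bold>\<and> e" "(v \<^bold>\<and> w) \<^bold>\<and> e \<preceq> w \<^bold>\<and> e"
          using VC[OF vw(1)] VC[OF vw(2)] eC by (intro meet_mono; simp)+
        then have "(v \<^bold>\<and> w) \<^bold>\<and> e \<preceq> f \<^bold>\<and> g" using vw leq_trans meet_greatest by blast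
        then show ?thesis using Vs(4)[OF vw(1,2)] fg sharp_meet by (auto simp: W_def)
      qed
      ultimately show ?thesis using \<open>V \<subseteq> W\<close> Vs(1) unfolding F_def by (auto simp: W_def)
    qed
    ultimately show False using max[of W] e by auto
  qed
  have "ultra V" unfolding ultra_def
  proof (intro conjI allI impI ballI)
    fix e assume e: "sharp e"
    show "e \<in> V \<or> e\<^sup>\<sim> \<in> V"
    proof (rule ccontr)
      assume "\<not> ?thesis"
      then obtain v w where vw: "v \<in> V" "v \<^bold>\<and> e = \<zero>" "w \<in> V" "w \<^bold>\<and> e\<^sup>\<sim> = \<zero>"
        using key[OF e] key[OF sharp_compl[OF e]] by blast
      have "v \<preceq> e\<^sup>\<sim>" using sharp_leqI2[OF e VC] vw by blast
      moreover have "w \<preceq> e" using sharp_leqI[OF e VC] vw by blast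
      ultimately have "v \<^bold>\<and> w \<preceq> e\<^sup>\<sim> \<^bold>\<and> e" by (rule meet_mono)
      then have "v \<^bold>\<and> w = \<zero>" using sharpD(2)[OF e] leq_zero by (simp add: meet_commute)
      then show False using Vs(3,4) vw by metis
    qed
  qed (use Vs in auto)
  then show ?thesis using that Vs by blast
qed

text \<open>The order of the quotient by the ultrafilter, without forming the quotient: \<open>a\<close> is below \<open>b\<close> on some
member of \<open>U\<close>. By \<open>comparability\<close> it is total.\<close>
definition below :: "'a set \<Rightarrow> 'a \<Rightarrow> 'a \<Rightarrow> bool" where
  "below U a b \<longleftrightarrow> (\<exists>e\<in>U. a \<^bold>\<and> e \<preceq> b)"

text \<open>One step of the binary expansion. For a real \<open>a\<close> in the unit interval the bit is \<open>0\<close> and the expansion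
continues with \<open>2a\<close> if \<open>a \<le> 1 - a\<close>; otherwise the bit is \<open>1\<close> and it continues with \<open>2a - 1\<close>. In the case
\<open>a = 1/2\<close> the expansion is \<open>0111\<dots>\<close>.\<close>
definition bit :: "'a set \<Rightarrow> 'a \<Rightarrow> real" where
  "bit U a = (if below U a (a\<^sup>\<sim>) then 0 else 1)"

definition nxt :: "'a set \<Rightarrow> 'a \<Rightarrow> 'a" where
  "nxt U a = (if below U a (a\<^sup>\<sim>) then dbl a else excess a)"

definition binary_value :: "'a set \<Rightarrow> 'a \<Rightarrow> real" where
  "binary_value U a = (\<Sum>n. bit U ((nxt U ^^ n) a) * (1/2) ^ Suc n)"

lemma summable_binary_value: "summable (\<lambda>n. bit U ((nxt U ^^ n) a) * (1/2) ^ Suc n)"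
proof (rule summable_comparison_test')
  show "summable (\<lambda>n. (1/2::real) ^ Suc n)" by (simp add: summable_geometric)
qed (auto simp: bit_def)

lemma binary_value_rec: "binary_value U a = (bit U a + binary_value U (nxt U a)) / 2"
proof -
  let ?f = "\<lambda>n. bit U ((nxt U ^^ n) a) * (1/2) ^ Suc n"
  have "binary_value U a = ?f 0 + (\<Sum>n. ?f (Suc n))"
    unfolding binary_value_def using suminf_split_head[OF summable_binary_value[of U a]] by simp
  also have "(\<Sum>n. ?f (Suc n)) = (\<Sum>n. (1/2) * (bit U ((nxt U ^^ n) (nxt U a)) * (1/2) ^ Suc n))"
    by (simp add: funpow_swap1 mult.assoc mult.left_commute)
  also have "\<dots> = (1/2) * binary_value U (nxt U a)"
    unfolding binary_value_def by (rule suminf_mult) (rule summable_binary_value)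
  finally show ?thesis by simp
qed

lemma binary_value_bounds: "0 \<le> binary_value U a" "binary_value U a \<le> 1"
proof -
  show "0 \<le> binary_value U a" unfolding binary_value_def
    by (rule suminf_nonneg[OF summable_binary_value]) (auto simp: bit_def)
  have "binary_value U a \<le> (\<Sum>n. (1/2::real) ^ Suc n)" unfolding binary_value_def
    by (rule suminf_le[OF _ summable_binary_value]) (auto simp: bit_def summable_geometric)
  also have "\<dots> = 1" using power_half_series sums_unique by metis
  finally show "binary_value U a \<le> 1" .
qed

text \<open>Identities between binary values are proved by showing that one step of the expansion halves the
error, while all values stay in the unit interval.\<close>
lemma squeeze_half:
  fixes x :: real
  assumes "\<And>n. \<bar>x\<bar> \<le> c * (1/2) ^ n" shows "x = 0"
proof -
  have "(\<lambda>n. c * (1/2::real) ^ n) \<longlonglongrightarrow> c * 0"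
    by (intro tendsto_mult_left LIMSEQ_realpow_zero) auto
  then have "\<bar>x\<bar> \<le> c * 0" using assms by (intro LIMSEQ_le_const) auto
  then show ?thesis by simp
qed

context
  fixes U assumes U: "ultra U"
begin

lemma ultraD:
  shows "e \<in> U \<Longrightarrow> sharp e" "e \<in> U \<Longrightarrow> e \<in> carrier E" "\<zero> \<notin> U"
    "e \<in> U \<Longrightarrow> f \<in> U \<Longrightarrow> e \<^bold>\<and> f \<in> U" "sharp e \<Longrightarrow> e \<in> U \<or> e\<^sup>\<sim> \<in> U"
  using U sharpD(1) by (auto simp: ultra_def)

lemma one_ultra: "\<one> \<in> U"
  using ultraD(5)[of \<one>] ultraD(3) by simp

lemma below_total: "a \<in> carrier E \<Longrightarrow> b \<in> carrier E \<Longrightarrow> below U a b \<or> below U b a"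
  using comparability[of a b] ultraD(5) unfolding below_def by metis

lemma below_shrink:
  assumes "a \<in> carrier E" "e \<in> U" "a \<^bold>\<and> e \<preceq> b" "f \<in> U"
  shows "a \<^bold>\<and> (e \<^bold>\<and> f) \<preceq> b" "a \<^bold>\<and> (f \<^bold>\<and> e) \<preceq> b"
proof -
  have "a \<^bold>\<and> (e \<^bold>\<and> f) \<preceq> a \<^bold>\<and> e" using assms ultraD(2) by (intro meet_mono) auto
  then show "a \<^bold>\<and> (e \<^bold>\<and> f) \<preceq> b" using assms leq_trans by blast
  then show "a \<^bold>\<and> (f \<^bold>\<and> e) \<preceq> b" by (simp add: meet_commute)
qed

lemma ultra_common:
  assumes "e \<in> U" "f \<in> U" obtains g where "g \<in> U" "g \<preceq> e" "g \<preceq> f"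
  using that[of "e \<^bold>\<and> f"] assms ultraD(2,4) by simp

lemma nxt_closed [simp]: "a \<in> carrier E \<Longrightarrow> nxt U a \<in> carrier E"
  by (simp add: nxt_def)

lemma nxt_at_small:
  assumes "e \<in> U" "a \<in> carrier E" "a \<^bold>\<and> e \<preceq> a\<^sup>\<sim>"
  shows "bit U a = 0" "Some (a \<^bold>\<and> e) \<boxplus> Some (a \<^bold>\<and> e) = Some (nxt U a \<^bold>\<and> e)"
proof -
  have "below U a (a\<^sup>\<sim>)" using assms by (auto simp: below_def)
  then show "bit U a = 0" "Some (a \<^bold>\<and> e) \<boxplus> Some (a \<^bold>\<and> e) = Some (nxt U a \<^bold>\<and> e)"
    using dbl_at_small[OF ultraD(1)[OF assms(1)] assms(2,3)] by (simp_all add: bit_def nxt_def)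
qed

lemma nxt_at_large:
  assumes "e \<in> U" "a \<in> carrier E" "a\<^sup>\<sim> \<^bold>\<and> e \<preceq> a" "\<not> below U a (a\<^sup>\<sim>)"
  shows "bit U a = 1" "Some (a\<^sup>\<sim> \<^bold>\<and> e) \<boxplus> Some (nxt U a \<^bold>\<and> e) = Some (a \<^bold>\<and> e)"
  using excess_at_large[OF ultraD(1)[OF assms(1)] assms(2,3)] assms(4) by (simp_all add: bit_def nxt_def)

text \<open>A member \<open>e\<close> of the ultrafilter can be shrunk so that the next bit of \<open>a\<close> is known on all of it.\<close>
lemma decide:
  assumes e: "e \<in> U" and a: "a \<in> carrier E"
  obtains f where "f \<in> U" "f \<preceq> e" "a \<^bold>\<and> f \<preceq> a\<^sup>\<sim>"
    | f where "f \<in> U" "f \<preceq> e" "a\<^sup>\<sim> \<^bold>\<and> f \<preceq> a" "\<not> below U a (a\<^sup>\<sim>)"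
proof (cases "below U a (a\<^sup>\<sim>)")
  case True
  then obtain f where "f \<in> U" "a \<^bold>\<and> f \<preceq> a\<^sup>\<sim>" by (auto simp: below_def)
  then show ?thesis using that(1)[of "e \<^bold>\<and> f"] below_shrink(2)[OF a] e ultraD(2,4) by auto
next
  case False
  then obtain f where "f \<in> U" "a\<^sup>\<sim> \<^bold>\<and> f \<preceq> a" using below_total[of a "a\<^sup>\<sim>"] a by (auto simp: below_def)
  then show ?thesis using that(2)[of "e \<^bold>\<and> f"] below_shrink(2)[of "a\<^sup>\<sim>"] e ultraD(2,4) a False by auto
qed

lemma meet_shrink: "a \<in> carrier E \<Longrightarrow> e \<in> U \<Longrightarrow> f \<preceq> e \<Longrightarrow> (a \<^bold>\<and> e) \<^bold>\<and> f = a \<^bold>\<and> f"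
  using leq_carrier[of f e] ultraD(2)[of e] by (simp add: meet_assoc meet_absorb2)

text \<open>An element that is everything on a member of \<open>U\<close> has all bits equal to \<open>1\<close>.\<close>
lemma binary_value_one:
  assumes "e \<in> U" "a \<in> carrier E" "a \<^bold>\<and> e = e"
  shows "binary_value U a = 1"
proof -
  have "\<forall>a. a \<in> carrier E \<longrightarrow> a \<^bold>\<and> e = e \<longrightarrow> \<bar>binary_value U a - 1\<bar> \<le> 1 * (1/2) ^ n" for n
  proof (induction n)
    case 0
    then show ?case using binary_value_bounds[of U] by (smt (verit) power_0)
  next
    case (Suc n)
    show ?case
    proof (intro allI impI)
      fix a assume a: "a \<in> carrier E" "a \<^bold>\<and> e = e"
      have eC: "e \<in> carrier E" using assms ultraD by blast
      have "Some e \<boxplus> Some (a\<^sup>\<sim> \<^bold>\<and> e) = Some e" using oadd_compl_at[OF ultraD(1)[OF assms(1)] a(1)] a(2) by simp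
      then have 0: "a\<^sup>\<sim> \<^bold>\<and> e = \<zero>" using oadd_cancel[of e _ e \<zero>] eC by simp
      have nb: "\<not> below U a (a\<^sup>\<sim>)"
      proof
        assume "below U a (a\<^sup>\<sim>)"
        then obtain f where f: "f \<in> U" "a \<^bold>\<and> f \<preceq> a\<^sup>\<sim>" by (auto simp: below_def)
        have fC: "f \<in> carrier E" using f ultraD by blast
        have "e \<^bold>\<and> f \<preceq> a \<^bold>\<and> f" using a eC fC meet(2)[of a e] by (intro meet_mono) auto
        then have "e \<^bold>\<and> f \<preceq> a\<^sup>\<sim> \<^bold>\<and> e" using f eC fC leq_trans by (intro meet_greatest) auto
        then have "e \<^bold>\<and> f = \<zero>" using 0 leq_zero by simp
        then show False using ultraD(3) ultraD(4)[OF assms(1) f(1)] by simp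
      qed
      have "a\<^sup>\<sim> \<^bold>\<and> e \<preceq> a" using 0 a by simp
      from nxt_at_large[OF assms(1) a(1) this nb] have "bit U a = 1" "nxt U a \<^bold>\<and> e = e"
        using 0 a eC by simp_all
      moreover from this have "\<bar>binary_value U (nxt U a) - 1\<bar> \<le> (1/2) ^ n" using Suc a by simp
      ultimately show "\<bar>binary_value U a - 1\<bar> \<le> 1 * (1/2) ^ Suc n"
        using binary_value_rec[of U a] by (simp add: abs_if split: if_splits)
    qed
  qed
  then have "binary_value U a - 1 = 0" using assms by (intro squeeze_half) blast
  then show ?thesis by simp
qed

text \<open>Let \<open>a\<close> and \<open>b\<close> add up to \<open>e\<close> on some \<open>e\<close> in \<open>U\<close>. If the bits differ, the continuations again add up to
\<open>e\<close>, as \<open>2a + (2b - 1) = 1\<close>, and the error is halved. Bits \<open>1\<close> and \<open>1\<close> do not occur. If both bits are \<open>0\<close>,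
then \<open>a = b = 1/2\<close> on a smaller member, both continuations have value \<open>1\<close>, and there is no error.\<close>
lemma binary_value_compl:
  assumes "a \<in> carrier E" shows "binary_value U a + binary_value U (a\<^sup>\<sim>) = 1"
proof -
  have "\<forall>a b e. a \<in> carrier E \<longrightarrow> b \<in> carrier E \<longrightarrow> e \<in> U \<longrightarrow> Some (a \<^bold>\<and> e) \<boxplus> Some (b \<^bold>\<and> e) = Some e
      \<longrightarrow> \<bar>binary_value U a + binary_value U b - 1\<bar> \<le> 1 * (1/2) ^ n" for n
  proof (induction n)
    case 0
    then show ?case using binary_value_bounds[of U] by (smt (verit) power_0)
  next
    case (Suc n)
    show ?case
    proof (intro allI impI)
      fix a b e assume C: "a \<in> carrier E" "b \<in> carrier E" and e: "e \<in> U"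
        and s: "Some (a \<^bold>\<and> e) \<boxplus> Some (b \<^bold>\<and> e) = Some e"
      have small_large: "\<bar>binary_value U a + binary_value U b - 1\<bar> \<le> 1 * (1/2) ^ Suc n"
        if C: "a \<in> carrier E" "b \<in> carrier E" and h: "h \<in> U"
          and s: "Some (a \<^bold>\<and> h) \<boxplus> Some (b \<^bold>\<and> h) = Some h"
          and a: "a \<^bold>\<and> h \<preceq> a\<^sup>\<sim>" and b: "b\<^sup>\<sim> \<^bold>\<and> h \<preceq> b" "\<not> below U b (b\<^sup>\<sim>)" for a b h
      proof -
        have "b\<^sup>\<sim> \<^bold>\<and> h = a \<^bold>\<and> h"
          using oadd_compl_at[OF ultraD(1)[OF h] C(2)] s oadd_cancel oadd_commute by metis
        then have "Some (a \<^bold>\<and> h) \<boxplus> Some (nxt U b \<^bold>\<and> h) = Some (b \<^bold>\<and> h)"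
          using nxt_at_large(2)[OF h C(2) b] by simp
        then have "Some (nxt U a \<^bold>\<and> h) \<boxplus> Some (nxt U b \<^bold>\<and> h) = Some h"
          using nxt_at_small(2)[OF h C(1) a] s by (metis oadd_assoc)
        then have "\<bar>binary_value U (nxt U a) + binary_value U (nxt U b) - 1\<bar> \<le> 1 * (1/2) ^ n"
          using Suc C h nxt_closed by blast
        then show ?thesis
          using binary_value_rec[of U a] binary_value_rec[of U b] nxt_at_small(1)[OF h C(1) a] nxt_at_large(1)[OF h C(2) b]
          by (simp add: abs_if split: if_splits)
      qed
      have shrink: "Some (a \<^bold>\<and> h) \<boxplus> Some (b \<^bold>\<and> h) = Some h" if "h \<in> U" "h \<preceq> e" for h
        using meet_oadd[OF ultraD(1)[OF that(1)] s] meet_shrink[OF _ e that(2)] C that(2) 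
        by (simp add: meet_absorb2)
      have cm: "b\<^sup>\<sim> \<^bold>\<and> h = a \<^bold>\<and> h" "a\<^sup>\<sim> \<^bold>\<and> h = b \<^bold>\<and> h" if "h \<in> U" "h \<preceq> e" for h
        using oadd_compl_at[OF ultraD(1)[OF that(1)] C(2)] oadd_compl_at[OF ultraD(1)[OF that(1)] C(1)]
          shrink[OF that] oadd_cancel oadd_commute by metis+
      show "\<bar>binary_value U a + binary_value U b - 1\<bar> \<le> 1 * (1/2) ^ Suc n"
      proof (cases rule: decide[OF e C(1)])
        case (1 f)
        note f = this
        show ?thesis
        proof (cases rule: decide[OF f(1) C(2)])
          case (1 g)
          have ge: "g \<preceq> e" using 1 f leq_trans by blast
          have gC: "g \<in> carrier E" using 1 ultraD by blast
          have ag: "a \<^bold>\<and> g \<preceq> a\<^sup>\<sim>" using below_shrink(1)[OF C(1) f(1,3) 1(1)] 1(2) 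
            by (simp add: meet_absorb2)
          have "a \<^bold>\<and> g \<preceq> a\<^sup>\<sim> \<^bold>\<and> g" using ag C gC by (intro meet_greatest) auto
          moreover have "b \<^bold>\<and> g \<preceq> b\<^sup>\<sim> \<^bold>\<and> g" using 1 C gC by (intro meet_greatest) auto
          ultimately have eq: "a \<^bold>\<and> g = b \<^bold>\<and> g" using cm[OF 1(1) ge] leq_antisym by simp
          then have "nxt U a \<^bold>\<and> g = g" "nxt U b \<^bold>\<and> g = g"
            using nxt_at_small(2)[OF 1(1) C(1) ag] nxt_at_small(2)[OF 1(1) C(2) 1(3)] shrink[OF 1(1) ge] by simp_all
          then have "binary_value U (nxt U a) = 1" "binary_value U (nxt U b) = 1" using binary_value_one 1(1) C by auto
          then show ?thesis using binary_value_rec[of U a] binary_value_rec[of U b]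
             nxt_at_small(1)[OF 1(1) C(1) ag] nxt_at_small(1)[OF 1(1) C(2) 1(3)] by simp
        next
          case (2 g)
          have ge: "g \<preceq> e" using 2 f leq_trans by blast
          have ag: "a \<^bold>\<and> g \<preceq> a\<^sup>\<sim>" using below_shrink(1)[OF C(1) f(1,3) 2(1)] 2(2) 
            by (simp add: meet_absorb2)
          show ?thesis using small_large[OF C 2(1) shrink[OF 2(1) ge] ag 2(3,4)] .
        qed
      next
        case (2 f)
        note f = this
        have fC: "f \<in> carrier E" using f ultraD by blast
        have "b \<^bold>\<and> f \<preceq> a" using f cm[OF f(1,2)] by simp
        then have "b \<^bold>\<and> f \<preceq> a \<^bold>\<and> f" using C fC by (intro meet_greatest) auto
        then have "b \<^bold>\<and> f \<preceq> b\<^sup>\<sim> \<^bold>\<and> f" using cm[OF f(1,2)] by simp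
        then have bf: "b \<^bold>\<and> f \<preceq> b\<^sup>\<sim>" using meet(2)[of "b\<^sup>\<sim>" f] C fC leq_trans by blast
        have s': "Some (b \<^bold>\<and> f) \<boxplus> Some (a \<^bold>\<and> f) = Some f" using shrink[OF f(1,2)] by (simp add: oadd_commute)
        show ?thesis using small_large[OF C(2,1) f(1) s' bf f(3,4)] by (simp add: add.commute)
      qed
    qed
  qed
  note this[rule_format, of a "a\<^sup>\<sim>" \<one>]
  then have "\<bar>binary_value U a + binary_value U (a\<^sup>\<sim>) - 1\<bar> \<le> 1 * (1/2) ^ n" for n
    using assms one_ultra oadd_compl by simp
  then have "binary_value U a + binary_value U (a\<^sup>\<sim>) - 1 = 0" by (rule squeeze_half)
  then show ?thesis by simp
qed

lemma oadd_cancel_option: "Some a \<boxplus> x = Some d \<Longrightarrow> Some a \<boxplus> y = Some d \<Longrightarrow> x = y"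
  by (cases x; cases y) (auto dest: oadd_cancel)

text \<open>If \<open>A + B + C = e\<close> and \<open>2A\<close>, \<open>2B\<close>, \<open>2C\<close> are at most \<open>e\<close>, then \<open>(e - 2A) + (e - 2B) + (e - 2C) = e\<close>. There are no
negatives to compute with; instead, as for the sides of a triangle, the sorted terms are written with
nonnegative parameters: \<open>A = w + z\<close>, \<open>B = A + v\<close>, \<open>C = B + w\<close>. Then \<open>e = 2v + 4w + 3z\<close>, and the three
differences are \<open>2v + 2w + z\<close>, \<open>2w + z\<close> and \<open>z\<close>.\<close>
lemma triangle_excess_sum:
  assumes ABC: "Some A \<boxplus> Some B \<boxplus> Some C = Some e"
    and AB: "A \<preceq> B" and BC: "B \<preceq> C" and D: "Some A \<boxplus> Some B = Some D" and CD: "C \<preceq> D"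
    and a: "Some A \<boxplus> Some A \<boxplus> Some a = Some e" and b: "Some B \<boxplus> Some B \<boxplus> Some b = Some e"
    and c: "Some C \<boxplus> Some C \<boxplus> Some c = Some e"
  shows "Some a \<boxplus> Some b \<boxplus> Some c = Some e"
proof -
  define v where "v = Some (B \<ominus> A)"
  define w where "w = Some (C \<ominus> B)"
  define z where "z = Some (D \<ominus> C)"
  have B: "Some B = Some A \<boxplus> v" unfolding v_def using oadd_diff[OF AB] by simp
  have C: "Some C = Some B \<boxplus> w" unfolding w_def using oadd_diff[OF BC] by simp
  have D': "Some D = Some C \<boxplus> z" unfolding z_def using oadd_diff[OF CD] by simp
  have "Some B \<boxplus> Some A = Some D" using D by (simp add: oadd_commute)
  moreover have "Some B \<boxplus> (w \<boxplus> z) = Some D" using C D' by (simp add: oadd_assoc)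
  ultimately have A: "Some A = w \<boxplus> z" by (rule oadd_cancel_option)
  note expand = C B A
  have e: "Some e = w \<boxplus> (w \<boxplus> (w \<boxplus> (w \<boxplus> (v \<boxplus> (v \<boxplus> (z \<boxplus> (z \<boxplus> z)))))))"
    unfolding ABC[symmetric] expand by (simp only: oadd_ac)
  have "Some A \<boxplus> (Some A \<boxplus> (v \<boxplus> (v \<boxplus> (w \<boxplus> (w \<boxplus> z))))) = Some e"
    unfolding e expand by (simp only: oadd_ac)
  moreover have "Some A \<boxplus> (Some A \<boxplus> Some a) = Some e" using a by (simp add: oadd_assoc)
  ultimately have "Some A \<boxplus> (v \<boxplus> (v \<boxplus> (w \<boxplus> (w \<boxplus> z)))) = Some A \<boxplus> Some a" by (rule oadd_cancel_option)
  then have a': "Some a = v \<boxplus> (v \<boxplus> (w \<boxplus> (w \<boxplus> z)))"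
    using \<open>Some A \<boxplus> (Some A \<boxplus> Some a) = Some e\<close>
    by (cases "Some A \<boxplus> Some a") (auto dest: oadd_cancel_option)
  have "Some B \<boxplus> (Some B \<boxplus> (w \<boxplus> (w \<boxplus> z))) = Some e"
    unfolding e expand by (simp only: oadd_ac)
  moreover have bb: "Some B \<boxplus> (Some B \<boxplus> Some b) = Some e" using b by (simp add: oadd_assoc)
  ultimately have "Some B \<boxplus> (w \<boxplus> (w \<boxplus> z)) = Some B \<boxplus> Some b" by (rule oadd_cancel_option)
  then have b': "Some b = w \<boxplus> (w \<boxplus> z)"
    using bb by (cases "Some B \<boxplus> Some b") (auto dest: oadd_cancel_option)
  have "Some C \<boxplus> (Some C \<boxplus> z) = Some e"
    unfolding e expand by (simp only: oadd_ac)
  moreover have cc: "Some C \<boxplus> (Some C \<boxplus> Some c) = Some e" using c by (simp add: oadd_assoc)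
  ultimately have "Some C \<boxplus> z = Some C \<boxplus> Some c" by (rule oadd_cancel_option)
  then have c': "Some c = z"
    using cc by (cases "Some C \<boxplus> Some c") (auto dest: oadd_cancel_option)
  show ?thesis unfolding a' b' c' e by (simp only: oadd_ac)
qed

text \<open>Additivity is proved in the symmetric form \<open>a + b + c = 1\<close>, read on a member of the ultrafilter. It has
fewer cases than \<open>a + b = c\<close>, because at most one of three such elements exceeds one half.\<close>
definition tripartition :: "'a \<Rightarrow> 'a \<Rightarrow> 'a \<Rightarrow> 'a \<Rightarrow> bool" where
  "tripartition e a b c \<longleftrightarrow> a \<in> carrier E \<and> b \<in> carrier E \<and> c \<in> carrier E \<and> e \<in> U \<and>
     Some (a \<^bold>\<and> e) \<boxplus> Some (b \<^bold>\<and> e) \<boxplus> Some (c \<^bold>\<and> e) = Some e"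

lemma tripartition_perm: "tripartition e a b c \<Longrightarrow> tripartition e b a c" "tripartition e a b c \<Longrightarrow> tripartition e a c b"
  by (simp_all add: tripartition_def oadd_ac)

lemma tripartition_shrink:
  assumes "tripartition e a b c" "f \<in> U" "f \<preceq> e" shows "tripartition f a b c"
proof -
  have C: "a \<in> carrier E" "b \<in> carrier E" "c \<in> carrier E" "e \<in> U" using assms by (auto simp: tripartition_def)
  obtain d where d: "Some (a \<^bold>\<and> e) \<boxplus> Some (b \<^bold>\<and> e) = Some d" "Some d \<boxplus> Some (c \<^bold>\<and> e) = Some e"
    using assms(1) by (cases "Some (a \<^bold>\<and> e) \<boxplus> Some (b \<^bold>\<and> e)") (auto simp: tripartition_def)
  note f = ultraD(1)[OF assms(2)]
  show ?thesis using meet_oadd[OF f d(1)] meet_oadd[OF f d(2)] meet_shrink[OF _ C(4) assms(3)] C assms(2,3)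
    by (simp add: tripartition_def meet_absorb2)
qed

lemma tripartition_compl:
  assumes "tripartition e a b c"
  shows "Some (a \<^bold>\<and> e) \<boxplus> Some (b \<^bold>\<and> e) = Some (c\<^sup>\<sim> \<^bold>\<and> e)"
proof -
  have "Some (c \<^bold>\<and> e) \<boxplus> (Some (a \<^bold>\<and> e) \<boxplus> Some (b \<^bold>\<and> e)) = Some e" using assms by (simp add: tripartition_def oadd_ac)
  moreover have "Some (c \<^bold>\<and> e) \<boxplus> Some (c\<^sup>\<sim> \<^bold>\<and> e) = Some e" using assms oadd_compl_at ultraD(1) by (auto simp: tripartition_def)
  ultimately show ?thesis by (rule oadd_cancel_option)
qed

text \<open>If all bits are \<open>0\<close>, the continuations add up to \<open>2\<close>, so their orthosupplements add up to \<open>1\<close>.\<close>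
lemma tripartition_small_step:
  assumes t: "tripartition e a b c" and ord: "a \<^bold>\<and> e \<preceq> b" "b \<^bold>\<and> e \<preceq> c"
    and small: "a \<^bold>\<and> e \<preceq> a\<^sup>\<sim>" "b \<^bold>\<and> e \<preceq> b\<^sup>\<sim>" "c \<^bold>\<and> e \<preceq> c\<^sup>\<sim>"
  shows "tripartition e ((nxt U a)\<^sup>\<sim>) ((nxt U b)\<^sup>\<sim>) ((nxt U c)\<^sup>\<sim>)"
proof -
  have C: "a \<in> carrier E" "b \<in> carrier E" "c \<in> carrier E" "e \<in> U" using t by (auto simp: tripartition_def)
  have eC: "e \<in> carrier E" using C ultraD by blast
  have D: "Some (x \<^bold>\<and> e) \<boxplus> Some (x \<^bold>\<and> e) \<boxplus> Some ((nxt U x)\<^sup>\<sim> \<^bold>\<and> e) = Some e"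
    if "x \<in> carrier E" "x \<^bold>\<and> e \<preceq> x\<^sup>\<sim>" for x
    using nxt_at_small(2)[OF C(4) that] oadd_compl_at[OF ultraD(1)[OF C(4)], of "nxt U x"] that(1) by simp
  show ?thesis unfolding tripartition_def
  proof (intro conjI)
    show "Some ((nxt U a)\<^sup>\<sim> \<^bold>\<and> e) \<boxplus> Some ((nxt U b)\<^sup>\<sim> \<^bold>\<and> e) \<boxplus> Some ((nxt U c)\<^sup>\<sim> \<^bold>\<and> e) = Some e"
    proof (rule triangle_excess_sum)
      show "Some (a \<^bold>\<and> e) \<boxplus> Some (b \<^bold>\<and> e) \<boxplus> Some (c \<^bold>\<and> e) = Some e" using t by (simp add: tripartition_def)
      show "a \<^bold>\<and> e \<preceq> b \<^bold>\<and> e" "b \<^bold>\<and> e \<preceq> c \<^bold>\<and> e" "c \<^bold>\<and> e \<preceq> c\<^sup>\<sim> \<^bold>\<and> e"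
        using ord small C eC by (auto intro: meet_greatest)
      show "Some (a \<^bold>\<and> e) \<boxplus> Some (b \<^bold>\<and> e) = Some (c\<^sup>\<sim> \<^bold>\<and> e)" using tripartition_compl[OF t] .
    qed (use D C small in auto)
  qed (use C in auto)
qed

text \<open>If \<open>a\<close> exceeds one half, then \<open>b\<close> and \<open>c\<close> do not, and \<open>(2a - 1) + 2b + 2c = 1\<close>: replace \<open>a\<close> by \<open>(b + c)\<close> plus
its continuation in \<open>a + b + c = 1\<close>.\<close>
lemma tripartition_large_step:
  assumes t: "tripartition e a b c" and large: "a\<^sup>\<sim> \<^bold>\<and> e \<preceq> a" "\<not> below U a (a\<^sup>\<sim>)"
  shows "bit U b = 0" "bit U c = 0" "tripartition e (nxt U a) (nxt U b) (nxt U c)"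
proof -
  have C: "a \<in> carrier E" "b \<in> carrier E" "c \<in> carrier E" "e \<in> U" using t by (auto simp: tripartition_def)
  have eC: "e \<in> carrier E" using C ultraD by blast
  have *: "b \<^bold>\<and> e \<preceq> b\<^sup>\<sim>" if t: "tripartition e a b c" for b c
  proof -
    have C: "b \<in> carrier E" "c \<in> carrier E" using t by (auto simp: tripartition_def)
    have "Some (b \<^bold>\<and> e) \<boxplus> Some (c \<^bold>\<and> e) = Some (a\<^sup>\<sim> \<^bold>\<and> e)"
      using tripartition_compl[OF tripartition_perm(2)[OF tripartition_perm(1)[OF t]]] .
    then have "b \<^bold>\<and> e \<preceq> a\<^sup>\<sim> \<^bold>\<and> e" by (rule leqI)
    also have "\<dots> \<preceq> a \<^bold>\<and> e" using large eC \<open>a \<in> carrier E\<close> by (intro meet_greatest) auto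
    also have "\<dots> \<preceq> b\<^sup>\<sim> \<^bold>\<and> e" using tripartition_compl[OF tripartition_perm(2)[OF t]] by (rule leqI)
    also have "\<dots> \<preceq> b\<^sup>\<sim>" using C eC by simp
    finally show ?thesis .
  qed
  have sm: "b \<^bold>\<and> e \<preceq> b\<^sup>\<sim>" "c \<^bold>\<and> e \<preceq> c\<^sup>\<sim>" using *[OF t] *[OF tripartition_perm(2)[OF t]] by auto
  show "bit U b = 0" "bit U c = 0" using nxt_at_small(1)[OF C(4)] C sm by auto
  have bc: "Some (b \<^bold>\<and> e) \<boxplus> Some (c \<^bold>\<and> e) = Some (a\<^sup>\<sim> \<^bold>\<and> e)"
    using tripartition_compl[OF tripartition_perm(2)[OF tripartition_perm(1)[OF t]]] .
  have "Some e = (Some (a\<^sup>\<sim> \<^bold>\<and> e) \<boxplus> Some (nxt U a \<^bold>\<and> e)) \<boxplus> Some (b \<^bold>\<and> e) \<boxplus> Some (c \<^bold>\<and> e)"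
    using nxt_at_large(2)[OF C(4,1) large] t by (simp add: tripartition_def)
  also have "\<dots> = Some (nxt U a \<^bold>\<and> e) \<boxplus> (Some (b \<^bold>\<and> e) \<boxplus> Some (b \<^bold>\<and> e)) \<boxplus> (Some (c \<^bold>\<and> e) \<boxplus> Some (c \<^bold>\<and> e))"
    unfolding bc[symmetric] by (simp only: oadd_ac)
  finally show "tripartition e (nxt U a) (nxt U b) (nxt U c)"
    using nxt_at_small(2)[OF C(4) C(2) sm(1)] nxt_at_small(2)[OF C(4) C(3) sm(2)] C by (simp add: tripartition_def)
qed

text \<open>In each of the two possible steps the error \<open>|h a + h b + h c - 1|\<close> is halved. For three bits \<open>0\<close> this uses
\<open>h x + h (x') = 1\<close>, since the continuations are replaced by their orthosupplements; the elements may be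
sorted because \<open>below\<close> is total.\<close>
lemma binary_value_tripartition:
  assumes "tripartition e a b c" shows "binary_value U a + binary_value U b + binary_value U c = 1"
proof -
  define err where "err a b c = \<bar>binary_value U a + binary_value U b + binary_value U c - 1\<bar>" for a b c
  have "\<forall>e a b c. tripartition e a b c \<longrightarrow> err a b c \<le> 2 * (1/2) ^ n" for n
  proof (induction n)
    case 0
    show ?case unfolding err_def using binary_value_bounds[of U] by (smt (verit) power_0)
  next
    case (Suc n)
    have large: "err a b c \<le> 2 * (1/2) ^ Suc n"
      if t: "tripartition e a b c" and l: "\<not> below U a (a\<^sup>\<sim>)" for e a b c
    proof -
      have C: "a \<in> carrier E" "e \<in> U" using t by (auto simp: tripartition_def)
      show ?thesis
      proof (cases rule: decide[OF C(2,1)])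
        case (1 f)
        then show ?thesis using l by (auto simp: below_def)
      next
        case (2 f)
        have tf: "tripartition f a b c" using tripartition_shrink[OF t] 2 by blast
        note st = tripartition_large_step[OF tf 2(3,4)]
        have "err (nxt U a) (nxt U b) (nxt U c) \<le> 2 * (1/2) ^ n" using st(3) Suc by blast
        then show ?thesis using st(1,2) nxt_at_large(1)[OF 2(1) C(1) 2(3,4)]
            binary_value_rec[of U a] binary_value_rec[of U b] binary_value_rec[of U c] unfolding err_def
          by (simp add: abs_if split: if_splits)
      qed
    qed
    have small: "err a b c \<le> 2 * (1/2) ^ Suc n"
      if t: "tripartition e a b c" and s: "below U a (a\<^sup>\<sim>)" "below U b (b\<^sup>\<sim>)" "below U c (c\<^sup>\<sim>)"
        and ord: "below U a b" "below U b c" for e a b c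
    proof -
      have C: "a \<in> carrier E" "b \<in> carrier E" "c \<in> carrier E" "e \<in> U" using t by (auto simp: tripartition_def)
      obtain e1 e2 e3 e4 e5 where es: "e1 \<in> U" "e2 \<in> U" "e3 \<in> U" "e4 \<in> U" "e5 \<in> U"
        and le: "a \<^bold>\<and> e1 \<preceq> a\<^sup>\<sim>" "b \<^bold>\<and> e2 \<preceq> b\<^sup>\<sim>" "c \<^bold>\<and> e3 \<preceq> c\<^sup>\<sim>" "a \<^bold>\<and> e4 \<preceq> b" "b \<^bold>\<and> e5 \<preceq> c"
        using s ord by (auto simp: below_def)
      obtain f1 where f1: "f1 \<in> U" "f1 \<preceq> e" "f1 \<preceq> e1" using ultra_common[OF C(4) es(1)] .
      obtain f2 where f2: "f2 \<in> U" "f2 \<preceq> f1" "f2 \<preceq> e2" using ultra_common[OF f1(1) es(2)] .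
      obtain f3 where f3: "f3 \<in> U" "f3 \<preceq> f2" "f3 \<preceq> e3" using ultra_common[OF f2(1) es(3)] .
      obtain f4 where f4: "f4 \<in> U" "f4 \<preceq> f3" "f4 \<preceq> e4" using ultra_common[OF f3(1) es(4)] .
      obtain f where f: "f \<in> U" "f \<preceq> f4" "f \<preceq> e5" using ultra_common[OF f4(1) es(5)] .
      have fe: "f \<preceq> e" "f \<preceq> e1" "f \<preceq> e2" "f \<preceq> e3" "f \<preceq> e4"
        using f1 f2 f3 f4 f leq_trans by meson+
      have tf: "tripartition f a b c" using tripartition_shrink[OF t f(1) fe(1)] .
      have "a \<^bold>\<and> f \<preceq> a\<^sup>\<sim>" "b \<^bold>\<and> f \<preceq> b\<^sup>\<sim>" "c \<^bold>\<and> f \<preceq> c\<^sup>\<sim>" "a \<^bold>\<and> f \<preceq> b" "b \<^bold>\<and> f \<preceq> c"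
        using le fe f(3) C meet_mono[OF leq_refl] leq_trans by meson+
      note f = this
      have "err ((nxt U a)\<^sup>\<sim>) ((nxt U b)\<^sup>\<sim>) ((nxt U c)\<^sup>\<sim>) \<le> 2 * (1/2) ^ n"
        using tripartition_small_step[OF tf f(4,5,1,2,3)] Suc by blast
      moreover have "binary_value U (nxt U x) + binary_value U ((nxt U x)\<^sup>\<sim>) = 1" if "x \<in> carrier E" for x
        using binary_value_compl that by simp
      ultimately show ?thesis using C s binary_value_rec[of U a] binary_value_rec[of U b] binary_value_rec[of U c]
        unfolding err_def by (simp add: bit_def) (smt (verit) field_sum_of_halves)
    qed
    show ?case
    proof (intro allI impI)
      fix e a b c assume t: "tripartition e a b c"
      then have C: "a \<in> carrier E" "b \<in> carrier E" "c \<in> carrier E" by (auto simp: tripartition_def)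
      have t': "tripartition e b a c" "tripartition e a c b" "tripartition e c a b" "tripartition e b c a" "tripartition e c b a"
        using t tripartition_perm by blast+
      have e': "err b a c = err a b c" "err a c b = err a b c" "err c a b = err a b c"
         "err b c a = err a b c" "err c b a = err a b c" by (simp_all add: err_def algebra_simps)
      show "err a b c \<le> 2 * (1/2) ^ Suc n"
      proof (cases "below U a (a\<^sup>\<sim>) \<and> below U b (b\<^sup>\<sim>) \<and> below U c (c\<^sup>\<sim>)")
        case False
        then show ?thesis using large[OF t] large[OF t'(1)] large[OF t'(3)] unfolding e' by blast
      next
        case True
        then show ?thesis using small[OF t] small[OF t'(1)] small[OF t'(2)] small[OF t'(3)] small[OF t'(4)] small[OF t'(5)]
          below_total[OF C(1,2)] below_total[OF C(1,3)] below_total[OF C(2,3)] unfolding e' by blast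
      qed
    qed
  qed
  then have "err a b c \<le> 2 * (1/2) ^ n" for n using assms by blast
  then have "binary_value U a + binary_value U b + binary_value U c - 1 = 0" unfolding err_def by (rule squeeze_half)
  then show ?thesis by simp
qed

end
end

section \<open>States preserving countably many infima\<close>

context sigma_mv
begin

definition state :: "('a \<Rightarrow> real) \<Rightarrow> bool" where
  "state h \<longleftrightarrow> (\<forall>a\<in>carrier E. 0 \<le> h a) \<and> h \<one> = 1 \<and>
     (\<forall>a b d. Some a \<boxplus> Some b = Some d \<longrightarrow> h d = h a + h b)"

lemma stateD:
  assumes "state h"
  shows "a \<in> carrier E \<Longrightarrow> 0 \<le> h a" "h \<one> = 1" "Some a \<boxplus> Some b = Some d \<Longrightarrow> h d = h a + h b"
  using assms by (auto simp: state_def)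

lemma state_mono: "state h \<Longrightarrow> a \<preceq> b \<Longrightarrow> h a \<le> h b"
  using stateD(3)[OF _ oadd_diff[of a b]] stateD(1)[of h "b \<ominus> a"] by fastforce

lemma state_diff: "state h \<Longrightarrow> a \<preceq> b \<Longrightarrow> h (b \<ominus> a) = h b - h a"
  using stateD(3)[OF _ oadd_diff[of a b]] by fastforce

lemma state_zero: "state h \<Longrightarrow> h \<zero> = 0"
  using stateD(3)[of h \<zero> \<zero> \<zero>] by simp

lemma state_compl: "state h \<Longrightarrow> a \<in> carrier E \<Longrightarrow> h (a\<^sup>\<sim>) = 1 - h a"
  using stateD(3)[OF _ oadd_compl[of a]] stateD(2) by fastforce

lemma state_binary_value:
  assumes U: "ultra U" shows "state (binary_value U)"
  unfolding state_def
proof (intro conjI allI impI ballI)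
  show "binary_value U \<one> = 1" using binary_value_one[OF U one_ultra[OF U], of \<one>] by simp
  fix a b d assume s: "Some a \<boxplus> Some b = Some d"
  note C = oadd_carrier[OF s]
  have "tripartition U \<one> a b (d\<^sup>\<sim>)"
    using s C oadd_compl[OF C(3)] one_ultra[OF U] by (simp add: tripartition_def[OF U])
  then show "binary_value U d = binary_value U a + binary_value U b"
    using binary_value_tripartition[OF U] binary_value_compl[OF U C(3)] by fastforce
qed (rule binary_value_bounds)

lemma binary_value_disjoint:
  assumes U: "ultra U" and e: "e \<in> U" "a \<in> carrier E" "a \<^bold>\<and> e = \<zero>" shows "binary_value U a = 0"
proof -
  have "a \<preceq> e\<^sup>\<sim>" using sharp_leqI2[OF ultraD(1)[OF U]] e by blast
  then have "binary_value U a \<le> binary_value U (e\<^sup>\<sim>)" using state_mono[OF state_binary_value[OF U]] by blast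
  also have "\<dots> = 0"
    using state_compl[OF state_binary_value[OF U]] binary_value_one[OF U e(1), of e] ultraD(2)[OF U e(1)]
    by (simp add: meet_absorb1)
  finally show ?thesis using binary_value_bounds[of U a] by simp
qed

text \<open>If for every \<open>j\<close> some member of the \<open>j\<close>-fold doubled sequence is at most one half on a member of \<open>U\<close>, then
from some index on the first bits of \<open>d\<^sub>n\<close> vanish, and their number tends to infinity.\<close>
lemma binary_value_null:
  assumes U: "ultra U" and d: "nullseq d"
    and "\<And>j. \<exists>n. below U ((dbl ^^ j) (d n)) (((dbl ^^ j) (d n))\<^sup>\<sim>)"
  shows "(\<lambda>n. binary_value U (d n)) \<longlonglongrightarrow> 0"
proof -
  have "\<exists>N. \<forall>k\<ge>N. binary_value U (d k) \<le> (1/2) ^ m" for m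
    using d assms(3)
  proof (induction m arbitrary: d)
    case 0
    then show ?case using binary_value_bounds by auto
  next
    case (Suc m)
    have "\<exists>N. \<forall>k\<ge>N. binary_value U (dbl (d k)) \<le> (1/2) ^ m"
    proof (rule Suc.IH)
      show "nullseq (\<lambda>k. dbl (d k))" using nullseq_dbl Suc.prems by blast
      show "\<exists>n. below U ((dbl ^^ j) (dbl (d n))) (((dbl ^^ j) (dbl (d n)))\<^sup>\<sim>)" for j
        using Suc.prems(2)[of "Suc j"] by (simp add: funpow_swap1)
    qed
    then obtain N where N: "\<And>k. k \<ge> N \<Longrightarrow> binary_value U (dbl (d k)) \<le> (1/2) ^ m" by blast
    obtain n e where e: "e \<in> U" "d n \<^bold>\<and> e \<preceq> (d n)\<^sup>\<sim>" using Suc.prems(2)[of 0] by (auto simp: below_def)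
    have "binary_value U (d k) \<le> (1/2) ^ Suc m" if k: "k \<ge> max N n" for k
    proof -
      have kn: "d k \<preceq> d n" using nullseq_antimono[OF Suc.prems(1)] k by simp
      have "d k \<^bold>\<and> e \<preceq> d n \<^bold>\<and> e" using kn ultraD(2)[OF U e(1)] by (intro meet_mono) auto
      then have "d k \<^bold>\<and> e \<preceq> (d k)\<^sup>\<sim>" using e(2) compl_antimono[OF kn] leq_trans by blast
      then have "below U (d k) ((d k)\<^sup>\<sim>)" using e(1) by (auto simp: below_def)
      then have "binary_value U (d k) = binary_value U (dbl (d k)) / 2"
        using binary_value_rec[of U "d k"] by (simp add: bit_def nxt_def)
      then show ?thesis using N[of k] k by simp
    qed
    then show ?case by blast
  qed
  note * = this
  show ?thesis
  proof (rule LIMSEQ_I)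
    fix r :: real assume "0 < r"
    then obtain m where m: "(1/2) ^ m < r" using real_arch_pow_inv[of r "1/2"] by auto
    obtain N where "\<forall>k\<ge>N. binary_value U (d k) \<le> (1/2) ^ m" using * by blast
    then show "\<exists>N. \<forall>k\<ge>N. norm (binary_value U (d k) - 0) < r"
      using m by (intro exI[of _ N]) (auto simp: abs_of_nonneg binary_value_bounds intro: le_less_trans)
  qed
qed

text \<open>Otherwise the multiples \<open>2\<^sup>j x\<close> are all defined, and \<open>x\<close> can be added to each of them below their supremum.\<close>
lemma exists_large_double:
  assumes x: "x \<in> carrier E" "x \<noteq> \<zero>"
  shows "\<exists>j. \<not> (dbl ^^ j) x \<preceq> ((dbl ^^ j) x)\<^sup>\<sim>"
proof (rule ccontr)
  assume "\<not> ?thesis"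
  then have sm: "(dbl ^^ j) x \<preceq> ((dbl ^^ j) x)\<^sup>\<sim>" for j by blast
  obtain s where s: "is_sup s (range (\<lambda>n. (dbl ^^ n) x))"
    using countable_is_sup[OF image_subsetI[of UNIV "\<lambda>n. (dbl ^^ n) x" "carrier E"]] x(1) by auto
  have "x = \<zero>"
  proof (rule sup_absorb_zero[OF s])
    fix n
    let ?y = "(dbl ^^ n) x"
    have yC: "?y \<in> carrier E" using x by simp
    have "Some ?y \<boxplus> Some ?y = Some (dbl ?y)"
      using oadd_dbl[OF yC] meet_absorb1[OF sm[of n]] by simp
    then obtain w where w: "Some ?y \<boxplus> Some x = Some w" "w \<preceq> dbl ?y"
      using oadd_mono2[OF leq_refl[OF yC] iter_dbl_mono[OF x(1), of 0 n]] by auto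
    have "(dbl ^^ Suc n) x \<preceq> s" by (rule is_supD(3)[OF s rangeI])
    then have "dbl ?y \<preceq> s" by simp
    then show "\<exists>w. Some ?y \<boxplus> Some x = Some w \<and> w \<preceq> s" using w leq_trans by blast
  qed
  then show False using x by simp
qed

lemma binary_value_zero_iter:
  assumes "binary_value U x = 0"
  shows "binary_value U ((dbl ^^ j) x) = 0"
proof (induction j)
  case (Suc j)
  let ?y = "(dbl ^^ j) x"
  have "bit U ?y = 0 \<and> binary_value U (nxt U ?y) = 0"
    using binary_value_rec[of U ?y] Suc binary_value_bounds(1)[of U "nxt U ?y"] by (auto simp: bit_def split: if_splits)
  then show ?case by (auto simp: bit_def nxt_def split: if_splits)
qed (use assms in simp)

text \<open>Let \<open>x = a \<ominus> (a \<and> b)\<close> and \<open>y = b \<ominus> (a \<and> b)\<close>. It suffices that \<open>h x > 0\<close>: as \<open>x\<close> and \<open>y\<close> are disjoint, one of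
them vanishes on a member of \<open>U\<close>, so then \<open>h y = 0\<close>. Some doubling \<open>v\<close> of \<open>x\<close> exceeds
one half somewhere. Its excess is nonzero on every nonzero sharp part of the support \<open>p\<close> of the excess, so
an ultrafilter through \<open>p\<close> gives \<open>v\<close> the bit \<open>1\<close> and \<open>x\<close> a positive value. The descent from \<open>p\<close> through \<open>nullseq_dense\<close> takes care of all
iterated doublings of the given null sequences.\<close>
theorem state_separation:
  assumes D: "countable D" "\<And>d. d \<in> D \<Longrightarrow> nullseq d"
    and ab: "a \<in> carrier E" "b \<in> carrier E" "\<not> a \<preceq> b"
  obtains h where "state h" "\<And>d. d \<in> D \<Longrightarrow> (\<lambda>n. h (d n)) \<longlonglongrightarrow> 0" "h b < h a"
proof -
  define g where "g = a \<^bold>\<and> b"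
  have g: "g \<in> carrier E" "g \<preceq> a" "g \<preceq> b" using ab by (auto simp: g_def)
  define x where "x = a \<ominus> g"
  define y where "y = b \<ominus> g"
  have xC: "x \<in> carrier E" "y \<in> carrier E" using g by (auto simp: x_def y_def)
  have x0: "x \<noteq> \<zero>" using diff_eq_zero[OF g(2)] g(3) ab by (auto simp: x_def)
  obtain j where j: "\<not> (dbl ^^ j) x \<preceq> ((dbl ^^ j) x)\<^sup>\<sim>" using exists_large_double[OF xC(1) x0] by blast
  define v where "v = (dbl ^^ j) x"
  have vC: "v \<in> carrier E" using xC by (simp add: v_def)
  have w0: "excess v \<noteq> \<zero>"
  proof
    assume "excess v = \<zero>"
    then have "v \<^bold>\<and> v\<^sup>\<sim> = v" using oadd_excess[OF vC] vC by simp
    then show False using j meet(3)[of v "v\<^sup>\<sim>"] vC by (simp add: v_def)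
  qed
  obtain p where p: "sharp p" "excess v \<preceq> p" "\<And>y. y \<in> carrier E \<Longrightarrow> excess v \<^bold>\<and> y = \<zero> \<Longrightarrow> p \<^bold>\<and> y = \<zero>"
    using support[OF excess_closed[OF vC]] by metis
  have p0: "p \<noteq> \<zero>" using p(2) w0 leq_zero by auto
  \<comment> \<open>Iterated doublings are included because all bits, and not only the first, have to become \<open>0\<close>; the constant sequence makes the set nonempty, so that it can be enumerated.\<close>
  define D' where "D' = insert (\<lambda>_. \<zero>) (\<Union>j. (\<lambda>d n. (dbl ^^ j) (d n)) ` D)"
  have "countable D'" using D(1) by (auto simp: D'_def)
  have null: "nullseq d" if "d \<in> D'" for d
  proof -
    have "nullseq (\<lambda>n. (dbl ^^ j) (d n))" if "d \<in> D" for d j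
      by (induction j) (use D(2)[OF that] nullseq_dbl in auto)
    moreover have "nullseq (\<lambda>_. \<zero>)" by (auto simp: nullseq_def leq_zero)
    ultimately show ?thesis using that by (auto simp: D'_def)
  qed
  define \<delta> where "\<delta> = from_nat_into D'"
  have range: "range \<delta> = D'"
    unfolding \<delta>_def using \<open>countable D'\<close> by (intro range_from_nat_into) (auto simp: D'_def)
  have "\<exists>q. \<forall>n::nat. (sharp (q n) \<and> q n \<noteq> \<zero> \<and> (n = 0 \<longrightarrow> q n = p)) \<and>
      (q (Suc n) \<preceq> q n \<and> (\<exists>k. \<delta> n k \<^bold>\<and> q (Suc n) \<preceq> (\<delta> n k)\<^sup>\<sim>))"
  proof (rule dependent_nat_choice)
    show "\<exists>q. sharp q \<and> q \<noteq> \<zero> \<and> (0 = (0::nat) \<longrightarrow> q = p)" using p p0 by blast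
    fix q and n :: nat assume q: "sharp q \<and> q \<noteq> \<zero> \<and> (n = 0 \<longrightarrow> q = p)"
    have "nullseq (\<delta> n)" using null range by blast
    then show "\<exists>q'. (sharp q' \<and> q' \<noteq> \<zero> \<and> (Suc n = 0 \<longrightarrow> q' = p)) \<and>
      (q' \<preceq> q \<and> (\<exists>k. \<delta> n k \<^bold>\<and> q' \<preceq> (\<delta> n k)\<^sup>\<sim>))"
      using nullseq_dense[of "\<delta> n" q] q by auto
  qed
  then obtain q where "\<forall>n::nat. (sharp (q n) \<and> q n \<noteq> \<zero> \<and> (n = 0 \<longrightarrow> q n = p)) \<and>
      (q (Suc n) \<preceq> q n \<and> (\<exists>k. \<delta> n k \<^bold>\<and> q (Suc n) \<preceq> (\<delta> n k)\<^sup>\<sim>))" ..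
  then have q: "\<And>n. sharp (q n)" "\<And>n. q n \<noteq> \<zero>" "q 0 = p" "\<And>n. q (Suc n) \<preceq> q n"
    "\<And>n. \<exists>k. \<delta> n k \<^bold>\<and> q (Suc n) \<preceq> (\<delta> n k)\<^sup>\<sim>" by blast+
  obtain U where U: "ultra U" "range q \<subseteq> U" using ultra_exists[where p = q, OF q(1,2,4)] by blast
  have pU: "p \<in> U" using U(2) q(3) by blast
  note st = state_binary_value[OF U(1)]
  have small: "\<exists>n. below U (d n) ((d n)\<^sup>\<sim>)" if d: "d \<in> D'" for d
  proof -
    obtain m where m: "d = \<delta> m" using d range by blast
    obtain k where "\<delta> m k \<^bold>\<and> q (Suc m) \<preceq> (\<delta> m k)\<^sup>\<sim>" using q(5) by blast
    moreover have "q (Suc m) \<in> U" using U(2) by blast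
    ultimately show ?thesis unfolding below_def m by blast
  qed
  have lim: "(\<lambda>n. binary_value U (d n)) \<longlonglongrightarrow> 0" if d: "d \<in> D" for d
  proof (rule binary_value_null[OF U(1) D(2)[OF d]])
    fix j
    have "(\<lambda>n. (dbl ^^ j) (d n)) \<in> D'" using d by (auto simp: D'_def)
    from small[OF this] show "\<exists>n. below U ((dbl ^^ j) (d n)) (((dbl ^^ j) (d n))\<^sup>\<sim>)" .
  qed
  have "bit U v = 1"
  proof -
    have "\<not> below U v (v\<^sup>\<sim>)"
    proof
      assume "below U v (v\<^sup>\<sim>)"
      then obtain f where f: "f \<in> U" "v \<^bold>\<and> f \<preceq> v\<^sup>\<sim>" by (auto simp: below_def)
      note fs = ultraD(1,2)[OF U(1) f(1)]
      have "(v \<^bold>\<and> v\<^sup>\<sim>) \<^bold>\<and> f = (v \<^bold>\<and> f) \<^bold>\<and> v\<^sup>\<sim>" using vC fs by (simp add: meet_assoc meet_commute[of f])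
      also have "\<dots> = v \<^bold>\<and> f" using f(2) by (rule meet_absorb1)
      finally have "Some (v \<^bold>\<and> f) \<boxplus> Some (excess v \<^bold>\<and> f) = Some (v \<^bold>\<and> f)"
        using meet_oadd[OF fs(1) oadd_excess[OF vC]] by simp
      then have "excess v \<^bold>\<and> f = \<zero>" using oadd_cancel[of "v \<^bold>\<and> f" _ "v \<^bold>\<and> f" \<zero>] vC fs by simp
      then have "p \<^bold>\<and> f = \<zero>" using p(3) fs by blast
      then show False using ultraD(3,4)[OF U(1)] pU f(1) by metis
    qed
    then show ?thesis by (simp add: bit_def)
  qed
  then have "binary_value U v \<noteq> 0" using binary_value_rec[of U v] binary_value_bounds(1)[of U "nxt U v"] by auto
  then have hx: "binary_value U x > 0" using binary_value_zero_iter[of U x j] binary_value_bounds(1)[of U x] v_def by fastforce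
  have "binary_value U y = 0"
  proof -
    obtain e where e: "sharp e" "x \<^bold>\<and> e \<preceq> y" "y \<^bold>\<and> e\<^sup>\<sim> \<preceq> x" using comparability[OF xC] .
    have eC: "e \<in> carrier E" using sharpD e by blast
    have zero: "z = \<zero>" if "z \<preceq> x" "z \<preceq> y" for z
      using meet_diff_zero[OF ab(1,2)] that by (simp add: x_def y_def g_def)
    have "x \<^bold>\<and> e = \<zero>" by (rule zero) (use e xC eC in auto)
    moreover have "y \<^bold>\<and> e\<^sup>\<sim> = \<zero>" by (rule zero) (use e xC eC in auto)
    ultimately have "binary_value U x = 0 \<or> binary_value U y = 0"
      using ultraD(5)[OF U(1) e(1)] binary_value_disjoint[OF U(1)] xC by blast
    then show ?thesis using hx by simp
  qed
  then have "binary_value U b < binary_value U a"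
    using stateD(3)[OF st oadd_diff[OF g(2)]] stateD(3)[OF st oadd_diff[OF g(3)]] hx
    by (simp add: x_def y_def)
  then show ?thesis using that[OF st lim] by blast
qed

end

section \<open>From spectral resolutions to observables\<close>

lemma borel_lessThan_induct [consumes 1, case_names basic empty compl union]:
  fixes B :: "real set"
  assumes B: "B \<in> sets borel"
    and basic: "\<And>t. P {..<t}" and empty: "P {}"
    and compl: "\<And>A. A \<in> sets borel \<Longrightarrow> P A \<Longrightarrow> P (- A)"
    and union: "\<And>A. disjoint_family A \<Longrightarrow> (\<And>i. A i \<in> sets borel) \<Longrightarrow> (\<And>i. P (A i)) \<Longrightarrow> P (\<Union>i::nat. A i)"
  shows "P B"
proof -
  let ?G = "range (lessThan :: real \<Rightarrow> real set)"
  have sets: "sets (borel :: real measure) = sigma_sets UNIV ?G"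
    by (subst borel_Iio) simp
  show ?thesis
  proof (rule sigma_sets_induct_disjoint[of ?G UNIV B P])
    show "Int_stable ?G"
    proof (rule Int_stableI)
      fix A B assume "A \<in> ?G" "B \<in> ?G"
      then obtain s t where "A = {..<s}" "B = {..<t}" by auto
      then have "A \<inter> B = {..<min s t}" by auto
      then show "A \<inter> B \<in> ?G" by blast
    qed
    show "P (UNIV - A)" if "A \<in> sigma_sets UNIV ?G" "P A" for A
      using compl[of A] that by (simp add: sets Compl_eq_Diff_UNIV)
    show "P (\<Union>i::nat. A i)" if "disjoint_family A" "range A \<subseteq> sigma_sets UNIV ?G" "\<And>i. P (A i)" for A
      using union[of A] that by (auto simp: sets)
  qed (use B basic empty sets in auto)
qed

text \<open>The distribution function of an effect observable, with values in an algebra of compatible elements.\<close>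
locale spectral_resolution = sigma_mv +
  fixes F :: "real \<Rightarrow> 'a"
  assumes F_mono: "s \<le> t \<Longrightarrow> F s \<preceq> F t"
    and F_lower: "t \<le> 0 \<Longrightarrow> F t = \<zero>"
    and F_upper: "1 < t \<Longrightarrow> F t = \<one>"
    and F_left: "is_sup (F t) (F ` {..<t})"
begin

lemma F_closed [simp]: "F t \<in> carrier E"
  using F_mono leq_carrier by blast

text \<open>The distribution function \<open>t \<mapsto> h (F t)\<close> need not be left-continuous, so \<open>\<nu> {..<t}\<close> can only be required to
lie between its left limit and its value at \<open>t\<close>. For a single \<open>t\<close> the two coincide as soon as \<open>h\<close> respects one
null sequence, see \<open>value_of_lessThan\<close>.\<close>
definition agrees :: "('a \<Rightarrow> real) \<Rightarrow> real measure \<Rightarrow> bool" where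
  "agrees h \<nu> \<longleftrightarrow> prob_space \<nu> \<and> sets \<nu> = sets borel \<and>
     (\<forall>t. measure \<nu> {..<t} \<le> h (F t) \<and> (\<forall>s<t. h (F s) \<le> measure \<nu> {..<t}))"

text \<open>The right-continuous version \<open>G\<close> of \<open>t \<mapsto> h (F t)\<close> is the distribution function of \<open>\<nu>\<close>.\<close>
lemma agrees_exists:
  assumes h: "state h" shows "\<exists>\<nu>. agrees h \<nu>"
proof -
  define G where "G t = (INF s\<in>{t<..}. h (F s))" for t
  have bdd: "bdd_below ((\<lambda>s. h (F s)) ` {t<..})" for t
    by (rule bdd_belowI[of _ 0]) (use stateD(1)[OF h] in auto)
  have hF: "s \<le> t \<Longrightarrow> h (F s) \<le> h (F t)" for s t using state_mono[OF h F_mono] .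
  have GF: "G t \<le> h (F s)" if "t < s" for s t
    unfolding G_def using that by (intro cINF_lower bdd) auto
  have FG: "h (F t) \<le> G t" for t
    unfolding G_def by (rule cINF_greatest) (auto intro: hF)
  have mono: "G s \<le> G t" if "s \<le> t" for s t
    unfolding G_def by (rule cINF_superset_mono) (use that bdd in auto)
  have right: "continuous (at_right a) G" for a
  proof (subst continuous_at_right_real_increasing)
    show "\<forall>e>0. \<exists>d>0. G (a + d) - G a < e"
    proof (intro allI impI)
      fix e :: real assume "0 < e"
      then have "\<exists>x\<in>(\<lambda>s. h (F s)) ` {a<..}. x < G a + e"
        unfolding G_def by (subst cInf_less_iff[symmetric]) (use bdd in auto)
      then obtain s where s: "a < s" "h (F s) < G a + e" by auto
      have "G (a + (s - a)/2) \<le> h (F s)" using s(1) by (intro GF) (auto simp: field_simps)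
      then show "\<exists>d>0. G (a + d) - G a < e" using s by (intro exI[of _ "(s - a)/2"]) auto
    qed
  qed (rule mono)
  have G0: "G t = 0" if "t < 0" for t
    using FG[of t] GF[of t 0] state_zero[OF h] F_lower that by auto
  have G1: "G t = 1" if "1 < t" for t
    using FG[of t] GF[of t "t + 1"] stateD(2)[OF h] F_upper that by auto
  have bot: "(G \<longlongrightarrow> 0) at_bot"
    by (rule tendsto_eventually) (use G0 in \<open>auto intro: eventually_mono[OF eventually_gt_at_bot[of 0]]\<close>)
  have top: "(G \<longlongrightarrow> 1) at_top"
    by (rule tendsto_eventually) (use G1 in \<open>auto intro: eventually_mono[OF eventually_gt_at_top[of 1]]\<close>)
  define \<nu> where "\<nu> = interval_measure G"
  interpret \<nu>: real_distribution \<nu>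
    unfolding \<nu>_def by (rule real_distribution_interval_measure) (use mono right bot top in auto)
  have cdf: "cdf \<nu> = G"
    unfolding \<nu>_def by (rule cdf_interval_measure) (use mono right bot top in auto)
  have 1: "measure \<nu> {..<t} \<le> h (F t)" for t
  proof (rule tendsto_upperbound[OF \<nu>.cdf_at_left])
    show "\<forall>\<^sub>F s in at_left t. cdf \<nu> s \<le> h (F t)"
      using GF cdf by (auto simp: eventually_at_filter)
  qed simp
  have 2: "h (F s) \<le> measure \<nu> {..<t}" if "s < t" for s t
  proof -
    have "h (F s) \<le> measure \<nu> {..s}" using FG[of s] cdf by (metis cdf_def)
    also have "\<dots> \<le> measure \<nu> {..<t}" using that by (intro \<nu>.finite_measure_mono) auto
    finally show ?thesis .
  qed
  show ?thesis unfolding agrees_def using 1 2 \<nu>.prob_space_axioms by (auto intro!: exI[of _ \<nu>])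
qed

text \<open>The family \<open>D\<close> of null sequences records which limits a state has to preserve in order to see that \<open>a\<close>
belongs to \<open>B\<close>.\<close>
definition determined :: "(nat \<Rightarrow> 'a) set \<Rightarrow> real set \<Rightarrow> 'a \<Rightarrow> bool" where
  "determined D B a \<longleftrightarrow> (\<forall>h \<nu>. state h \<longrightarrow> (\<forall>d\<in>D. (\<lambda>n. h (d n)) \<longlonglongrightarrow> 0) \<longrightarrow> agrees h \<nu> \<longrightarrow>
     h a = measure \<nu> B)"

definition value_of :: "real set \<Rightarrow> 'a \<Rightarrow> bool" where
  "value_of B a \<longleftrightarrow> a \<in> carrier E \<and> B \<in> sets borel \<and>
     (\<exists>D. countable D \<and> (\<forall>d\<in>D. nullseq d) \<and> determined D B a)"

lemma determinedD: "determined D B a \<Longrightarrow> state h \<Longrightarrow> (\<And>d. d \<in> D \<Longrightarrow> (\<lambda>n. h (d n)) \<longlonglongrightarrow> 0) \<Longrightarrow>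
    agrees h \<nu> \<Longrightarrow> h a = measure \<nu> B"
  by (simp add: determined_def)

lemma value_ofD: "value_of B a \<Longrightarrow> a \<in> carrier E" "value_of B a \<Longrightarrow> B \<in> sets borel"
  by (auto simp: value_of_def)

text \<open>A state that respects the null sequences of both \<open>a\<close> and \<open>b\<close> has \<open>h a = \<nu> B \<le> \<nu> C = h b\<close>; if \<open>a \<preceq> b\<close> failed,
\<open>state_separation\<close> would provide such a state with \<open>h b < h a\<close>.\<close>
lemma value_of_mono:
  assumes "value_of B a" "value_of C b" "B \<subseteq> C" shows "a \<preceq> b"
proof (rule ccontr)
  assume neg: "\<not> a \<preceq> b"
  obtain D1 where D1: "countable D1" "\<And>d. d \<in> D1 \<Longrightarrow> nullseq d"
    "determined D1 B a"
    using assms(1) unfolding value_of_def by blast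
  obtain D2 where D2: "countable D2" "\<And>d. d \<in> D2 \<Longrightarrow> nullseq d"
    "determined D2 C b"
    using assms(2) unfolding value_of_def by blast
  obtain h where h: "state h" "\<And>d. d \<in> D1 \<union> D2 \<Longrightarrow> (\<lambda>n. h (d n)) \<longlonglongrightarrow> 0" "h b < h a"
  proof (rule state_separation)
    show "countable (D1 \<union> D2)" using D1(1) D2(1) by simp
    show "nullseq d" if "d \<in> D1 \<union> D2" for d using that D1(2) D2(2) by blast
  qed (use value_ofD(1)[OF assms(1)] value_ofD(1)[OF assms(2)] neg in auto)
  obtain \<nu> where \<nu>: "agrees h \<nu>" using agrees_exists[OF h(1)] by blast
  interpret prob_space \<nu> using \<nu> by (simp add: agrees_def)
  have "measure \<nu> B \<le> measure \<nu> C"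
    using assms(3) value_ofD(2)[OF assms(2)] \<nu> by (intro finite_measure_mono) (auto simp: agrees_def)
  then show False using determinedD[OF D1(3) h(1) _ \<nu>] determinedD[OF D2(3) h(1) _ \<nu>] h(2,3) by auto
qed

lemma value_of_unique: "value_of B a \<Longrightarrow> value_of B b \<Longrightarrow> a = b"
  using value_of_mono leq_antisym by blast

lemma value_of_empty: "value_of {} \<zero>"
  unfolding value_of_def determined_def by (auto intro!: exI[of _ "{}"] simp: state_zero)

lemma diff_nullseq:
  assumes mono: "\<And>n. a n \<preceq> a (Suc n)" and s: "is_sup s (range a)"
  shows "nullseq (\<lambda>n. s \<ominus> a n)"
  unfolding nullseq_def
proof (intro conjI allI impI)
  have as: "a n \<preceq> s" for n using is_supD(3)[OF s] by blast
  show "s \<ominus> a (Suc n) \<preceq> s \<ominus> a n" for n using diff_antimono[OF mono as] .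
  fix z assume z: "\<forall>n. z \<preceq> s \<ominus> a n"
  show "z = \<zero>" by (rule sup_absorb_zero[OF s]) (use z leq_diffD[OF as] in blast)
qed

text \<open>The null sequence \<open>F t \<ominus> F (t - 1/n)\<close> forces \<open>h (F (t - 1/n)) \<le> \<nu> {..<t} \<le> h (F t)\<close> to become equalities.\<close>
lemma value_of_lessThan: "value_of {..<t} (F t)"
proof -
  define a where "a n = F (t - 1 / Suc n)" for n
  have mono: "a n \<preceq> a (Suc n)" for n unfolding a_def by (rule F_mono) (simp add: field_simps)
  have s: "is_sup (F t) (range a)"
    unfolding is_sup_def
  proof (intro conjI ballI impI)
    show "range a \<subseteq> carrier E" by (auto simp: a_def)
    show "x \<preceq> F t" if x: "x \<in> range a" for x
    proof -
      obtain n where "x = F (t - 1 / real (Suc n))" using x unfolding a_def by blast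
      then show ?thesis by (simp add: F_mono)
    qed
    fix u assume u: "u \<in> carrier E" "\<forall>x\<in>range a. x \<preceq> u"
    show "F t \<preceq> u"
    proof (rule is_supD(4)[OF F_left u(1)])
      fix x assume "x \<in> F ` {..<t}"
      then obtain r where r: "r < t" "x = F r" by auto
      then obtain n where n: "1 / Suc n < t - r" using nat_approx_posE[of "t - r"] by auto
      then have "x \<preceq> a n" unfolding a_def r by (intro F_mono) simp
      then show "x \<preceq> u" using u(2) leq_trans by blast
    qed
  qed simp
  have as: "a n \<preceq> F t" for n using is_supD(3)[OF s] by blast
  show ?thesis unfolding value_of_def determined_def
  proof (intro conjI exI[of _ "{\<lambda>n. F t \<ominus> a n}"] allI impI)
    fix h \<nu> assume h: "state h" and lim: "\<forall>d\<in>{\<lambda>n. F t \<ominus> a n}. (\<lambda>n. h (d n)) \<longlonglongrightarrow> 0" and \<nu>: "agrees h \<nu>"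
    have "(\<lambda>n. h (F t) - h (a n)) \<longlonglongrightarrow> 0" using lim state_diff[OF h as] by simp
    moreover have "h (F t) - measure \<nu> {..<t} \<le> h (F t) - h (a n)" for n
      using \<nu> by (simp add: agrees_def a_def)
    ultimately have "h (F t) - measure \<nu> {..<t} \<le> 0" by (intro LIMSEQ_le_const) auto
    then show "h (F t) = measure \<nu> {..<t}" using \<nu> by (auto simp: agrees_def intro: antisym)
  qed (use diff_nullseq[OF mono s] in auto)
qed

lemma value_of_compl:
  assumes "value_of B a" shows "value_of (- B) (a\<^sup>\<sim>)"
proof -
  obtain D where D: "countable D" "\<And>d. d \<in> D \<Longrightarrow> nullseq d"
    "determined D B a"
    using assms unfolding value_of_def by blast
  note aB = value_ofD[OF assms]
  show ?thesis unfolding value_of_def determined_def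
  proof (intro conjI exI[of _ D] allI impI)
    fix h \<nu> assume h: "state h" "\<forall>d\<in>D. (\<lambda>n. h (d n)) \<longlonglongrightarrow> 0" "agrees h \<nu>"
    interpret prob_space \<nu> using h by (simp add: agrees_def)
    have sp: "space \<nu> = UNIV" using h(3) sets_eq_imp_space_eq[of \<nu> borel] by (simp add: agrees_def)
    have "measure \<nu> (- B) = 1 - measure \<nu> B"
      using prob_compl[of B] h(3) aB(2) by (simp add: agrees_def sp Compl_eq_Diff_UNIV)
    then show "h (a\<^sup>\<sim>) = measure \<nu> (- B)" using determinedD[OF D(3) h(1) _ h(3)] h(2) state_compl[OF h(1) aB(1)] by auto
  qed (use D aB in auto)
qed

text \<open>The sum of \<open>a\<close> and \<open>b\<close> is defined because \<open>B \<subseteq> - C\<close> gives \<open>a \<preceq> b\<^sup>\<sim>\<close>.\<close>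
lemma value_of_disjoint_union:
  assumes "value_of B a" "value_of C b" "B \<inter> C = {}"
  shows "\<exists>c. Some a \<boxplus> Some b = Some c \<and> value_of (B \<union> C) c"
proof -
  note aB = value_ofD[OF assms(1)] and bC = value_ofD[OF assms(2)]
  obtain D1 where D1: "countable D1" "\<And>d. d \<in> D1 \<Longrightarrow> nullseq d"
    "determined D1 B a"
    using assms(1) unfolding value_of_def by blast
  obtain D2 where D2: "countable D2" "\<And>d. d \<in> D2 \<Longrightarrow> nullseq d"
    "determined D2 C b"
    using assms(2) unfolding value_of_def by blast
  have "a \<preceq> b\<^sup>\<sim>" using value_of_mono[OF assms(1) value_of_compl[OF assms(2)]] assms(3) by blast
  then obtain c where c: "Some a \<boxplus> Some b = Some c" using orth_iff aB bC by blast
  have "value_of (B \<union> C) c" unfolding value_of_def determined_def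
  proof (intro conjI exI[of _ "D1 \<union> D2"] allI impI)
    fix h \<nu> assume h: "state h" "\<forall>d\<in>D1 \<union> D2. (\<lambda>n. h (d n)) \<longlonglongrightarrow> 0" "agrees h \<nu>"
    interpret prob_space \<nu> using h by (simp add: agrees_def)
    have "measure \<nu> (B \<union> C) = measure \<nu> B + measure \<nu> C"
      using aB bC assms(3) h(3) by (intro finite_measure_Union) (auto simp: agrees_def)
    then show "h c = measure \<nu> (B \<union> C)"
      using stateD(3)[OF h(1) c] determinedD[OF D1(3) h(1) _ h(3)] determinedD[OF D2(3) h(1) _ h(3)] h(2) by auto
  qed (use D1 D2 aB bC c oadd_carrier(3)[OF c] in auto)
  then show ?thesis using c by blast
qed

text \<open>The sequence \<open>s \<ominus> a\<^sub>n\<close> is added to the null sequences, so that \<open>h s\<close> is the limit of the \<open>h a\<^sub>n\<close>.\<close>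
lemma value_of_incseq:
  fixes B :: "nat \<Rightarrow> real set"
  assumes v: "\<And>n. value_of (B n) (a n)" and inc: "\<And>n. B n \<subseteq> B (Suc n)" and s: "is_sup s (range a)"
  shows "value_of (\<Union>n. B n) s"
proof -
  note aB = value_ofD[OF v]
  have "\<forall>n. \<exists>D. countable D \<and> (\<forall>d\<in>D. nullseq d) \<and> determined D (B n) (a n)"
    using v unfolding value_of_def by blast
  then obtain D where D: "\<And>n. countable (D n)" "\<And>n d. d \<in> D n \<Longrightarrow> nullseq d"
    "\<And>n. determined (D n) (B n) (a n)"
    by metis
  have mono: "a n \<preceq> a (Suc n)" for n using value_of_mono[OF v v inc] .
  have as: "a n \<preceq> s" for n using is_supD(3)[OF s] by blast
  show ?thesis unfolding value_of_def determined_def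
  proof (intro conjI exI[of _ "insert (\<lambda>n. s \<ominus> a n) (\<Union>n. D n)"] allI impI)
    fix h \<nu> assume h: "state h" "\<forall>d\<in>insert (\<lambda>n. s \<ominus> a n) (\<Union>n. D n). (\<lambda>n. h (d n)) \<longlonglongrightarrow> 0" "agrees h \<nu>"
    interpret prob_space \<nu> using h by (simp add: agrees_def)
    have "(\<lambda>n. h s - h (a n)) \<longlonglongrightarrow> 0" using h(2) state_diff[OF h(1) as] by simp
    from tendsto_diff[OF tendsto_const[of "h s"] this] have "(\<lambda>n. h (a n)) \<longlonglongrightarrow> h s" by simp
    moreover have "h (a n) = measure \<nu> (B n)" for n using determinedD[OF D(3) h(1) _ h(3)] h(2) by blast
    moreover have "(\<lambda>n. measure \<nu> (B n)) \<longlonglongrightarrow> measure \<nu> (\<Union>n. B n)"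
      using aB(2) h(3) inc by (intro finite_Lim_measure_incseq) (auto simp: agrees_def incseq_SucI)
    ultimately show "h s = measure \<nu> (\<Union>n. B n)" using LIMSEQ_unique by auto
  qed (use D aB is_supD(2)[OF s] diff_nullseq[OF mono s] in auto)
qed

lemma value_of_exists:
  assumes "B \<in> sets borel" shows "\<exists>a. value_of B a"
  using assms
proof (induction rule: borel_lessThan_induct)
  case (union A)
    then obtain a where a: "\<And>i. value_of (A i) (a i)" by metis
    have "\<exists>c. value_of (\<Union>i<n. A i) c" for n
    proof (induction n)
      case 0
      then show ?case using value_of_empty by auto
    next
      case (Suc n)
      then obtain c where c: "value_of (\<Union>i<n. A i) c" by blast
      have "A i \<inter> A n = {}" if "i < n" for i
        using disjoint_family_onD[OF union(1), of i n] that by simp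
      then have "(\<Union>i<n. A i) \<inter> A n = {}" by auto
      then obtain e where "value_of ((\<Union>i<n. A i) \<union> A n) e"
        using value_of_disjoint_union[OF c a] by blast
      moreover have "(\<Union>i<n. A i) \<union> A n = (\<Union>i<Suc n. A i)" by (auto simp: less_Suc_eq)
      ultimately show ?case by auto
    qed
    then obtain c where c: "\<And>n. value_of (\<Union>i<n. A i) (c n)" by metis
    obtain s where s: "is_sup s (range c)"
      using countable_is_sup[of "range c"] value_ofD(1)[OF c] by auto
    have "value_of (\<Union>n. \<Union>i<n. A i) s" by (rule value_of_incseq[OF c _ s]) (auto simp: less_Suc_eq)
    moreover have "(\<Union>n. \<Union>i<n. A i) = (\<Union>i. A i)" by auto
    ultimately show ?case by auto
  qed (use value_of_lessThan value_of_empty value_of_compl in blast)+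

theorem spectral_resolution_observable:
  "\<exists>x. observable E x \<and> (\<forall>t. x {..<t} = F t)"
proof -
  define x where "x = (\<lambda>B\<in>sets (borel :: real measure). SOME a. value_of B a)"
  have x: "value_of B (x B)" if "B \<in> sets borel" for B
    unfolding x_def using that value_of_exists[OF that] someI_ex[of "value_of B"] by simp
  have eq: "x B = a" if "value_of B a" for a B
    using value_of_unique[OF x that] value_ofD(2)[OF that] by blast
  have one: "value_of UNIV \<one>" using value_of_compl[OF value_of_empty] by simp
  have "observable E x" unfolding observable_def
  proof (intro conjI ballI allI impI)
    show "x \<in> sets borel \<rightarrow>\<^sub>E carrier E" using x value_ofD(1) by (auto simp: PiE_iff x_def)
    show "x UNIV = ea_one E" using eq[OF one] .
    fix B C :: "real set" assume BC: "B \<in> sets borel" "C \<in> sets borel" "B \<inter> C = {}"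
    obtain c where c: "Some (x B) \<boxplus> Some (x C) = Some c" "value_of (B \<union> C) c"
      using value_of_disjoint_union[OF x x] BC by blast
    then show "psum E (x B) (x C) = Some (x (B \<union> C))"
      using eq[OF c(2)] oadd_eq[of "x B" "x C"] oadd_carrier[OF c(1)] by simp
  next
    fix B :: "nat \<Rightarrow> real set" assume B: "(\<forall>i. B i \<in> sets borel) \<and> (\<forall>i. B i \<subseteq> B (Suc i))"
    have xC: "range (\<lambda>i. x (B i)) \<subseteq> carrier E" using x value_ofD(1) B by blast
    then obtain s where s: "is_sup s (range (\<lambda>i. x (B i)))" using countable_is_sup[OF xC] by auto
    have "value_of (\<Union>i. B i) s" by (rule value_of_incseq[OF _ _ s]) (use x B in auto)
    then show "least (ea_order E) (x (\<Union>i. B i)) (Upper (ea_order E) (range (\<lambda>i. x (B i))))"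
      using eq s is_sup_iff_least[OF xC] by metis
  qed
  then show ?thesis using eq[OF value_of_lessThan] by blast
qed

end

section \<open>Blocks\<close>

context effect_algebra
begin

lemma diff_eq_compl:
  assumes "a \<preceq> b" shows "\<exists>c. Some (b\<^sup>\<sim>) \<boxplus> Some a = Some c \<and> b \<ominus> a = c\<^sup>\<sim>"
proof -
  have "(Some a \<boxplus> Some (b \<ominus> a)) \<boxplus> Some (b\<^sup>\<sim>) = Some \<one>"
    using oadd_diff[OF assms] oadd_compl[OF leq_carrier(2)[OF assms]] by simp
  then have *: "(Some (b\<^sup>\<sim>) \<boxplus> Some a) \<boxplus> Some (b \<ominus> a) = Some \<one>" by (simp only: oadd_ac)
  then obtain c where c: "Some (b\<^sup>\<sim>) \<boxplus> Some a = Some c" by (cases "Some (b\<^sup>\<sim>) \<boxplus> Some a") auto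
  then show ?thesis using * compl_unique by auto
qed

end

text \<open>A subset closed under \<open>1\<close>, orthosupplements and sums is closed under differences (\<open>diff_sub\<close>), which is
why it carries the restricted order.\<close>
locale sub_effect_algebra = effect_algebra E for E :: "('a, 'm) effect_structure_scheme" (structure) +
  fixes M :: "'a set"
  assumes sub: "M \<subseteq> carrier E" and sub_one: "\<one> \<in> M"
    and sub_compl: "a \<in> M \<Longrightarrow> a\<^sup>\<sim> \<in> M"
    and sub_oadd: "a \<in> M \<Longrightarrow> b \<in> M \<Longrightarrow> Some a \<boxplus> Some b = Some c \<Longrightarrow> c \<in> M"
begin

abbreviation "E' \<equiv> E\<lparr>carrier := M\<rparr>"

lemma effect_algebra_sub: "effect_algebra E'"
proof
  have zero: "\<zero> \<in> M" using sub_compl[OF sub_one] by simp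
  show "ea_zero E' \<in> carrier E'" "ea_one E' \<in> carrier E'" using zero sub_one by simp_all
  fix a b c
  assume a: "a \<in> carrier E'"
  then have aC: "a \<in> M" "a \<in> carrier E" using sub by auto
  show "\<exists>!b. b \<in> carrier E' \<and> psum E' a b = Some (ea_one E')"
    using orthosupplement[OF aC(2)] sub_compl[OF aC(1)] oadd_compl[OF aC(2)] oadd_eq[OF aC(2)] aC sub
    by (intro ex1I[of _ "a\<^sup>\<sim>"]) (auto intro: compl_unique)
  show "a = ea_zero E'" if "psum E' a (ea_one E') \<noteq> None"
    using that zero_one_law aC by simp
  assume b: "b \<in> carrier E'"
  then have bC: "b \<in> M" "b \<in> carrier E" using sub by auto
  show "psum E' a b = psum E' b a" using psum_commute aC bC by simp
  show "c \<in> carrier E'" if "psum E' a b = Some c"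
    using that sub_oadd[OF aC(1) bC(1)] oadd_eq[OF aC(2) bC(2)] by simp
  assume c: "c \<in> carrier E'"
  then have cC: "c \<in> M" "c \<in> carrier E" using sub by auto
  show "Option.bind (psum E' a b) (\<lambda>s. psum E' s c) = Option.bind (psum E' b c) (psum E' a)"
    using psum_assoc[OF aC(2) bC(2) cC(2)] by simp
qed

sublocale S: effect_algebra E' by (rule effect_algebra_sub)

lemma oadd_sub: "a \<in> M \<Longrightarrow> b \<in> M \<Longrightarrow> S.oadd (Some a) (Some b) = Some a \<boxplus> Some b"
  using sub by (auto simp: S.oadd_def oadd_def)

lemma diff_sub: "a \<in> M \<Longrightarrow> b \<in> M \<Longrightarrow> a \<preceq> b \<Longrightarrow> b \<ominus> a \<in> M"
  using diff_eq_compl[of a b] sub_compl sub_oadd by metis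

lemma leq_sub: "a \<in> M \<Longrightarrow> b \<in> M \<Longrightarrow> S.leq a b \<longleftrightarrow> a \<preceq> b"
proof
  assume M: "a \<in> M" "b \<in> M"
  {
    assume "S.leq a b"
    then obtain c where c: "S.oadd (Some a) (Some c) = Some b" by (auto simp: S.leq_def)
    then have "c \<in> M" using S.oadd_carrier(2) by auto
    then show "a \<preceq> b" using c oadd_sub M leqI by simp
  next
    assume "a \<preceq> b"
    then show "S.leq a b" using oadd_sub[OF M(1) diff_sub[OF M]] oadd_diff[of a b] S.leqI by simp
  }
qed

lemma least_sub:
  assumes "A \<subseteq> M" "s \<in> M" "\<And>a. a \<in> A \<Longrightarrow> a \<preceq> s" "\<And>u. u \<in> carrier E \<Longrightarrow> (\<forall>a\<in>A. a \<preceq> u) \<Longrightarrow> s \<preceq> u"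
  shows "least (ea_order E') s (Upper (ea_order E') A)"
proof -
  have "A \<subseteq> carrier E'" using assms(1) by simp
  then show ?thesis using assms sub leq_sub by (auto simp: S.least_Upper_iff subset_iff)
qed

lemma greatest_sub:
  assumes "A \<subseteq> M" "s \<in> M" "\<And>a. a \<in> A \<Longrightarrow> s \<preceq> a" "\<And>u. u \<in> carrier E \<Longrightarrow> (\<forall>a\<in>A. u \<preceq> a) \<Longrightarrow> u \<preceq> s"
  shows "greatest (ea_order E') s (Lower (ea_order E') A)"
proof -
  have "A \<subseteq> carrier E'" using assms(1) by simp
  then show ?thesis using assms sub leq_sub by (auto simp: S.greatest_Lower_iff subset_iff)
qed

end

context sigma_lattice_ea
begin

definition commutant :: "'a set \<Rightarrow> 'a set" where
  "commutant S = {z \<in> carrier E. \<forall>s\<in>S. compat s z}"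

lemma commutantI: "z \<in> carrier E \<Longrightarrow> (\<And>s. s \<in> S \<Longrightarrow> compat s z) \<Longrightarrow> z \<in> commutant S"
  by (simp add: commutant_def)

lemma commutantD: "z \<in> commutant S \<Longrightarrow> z \<in> carrier E" "z \<in> commutant S \<Longrightarrow> s \<in> S \<Longrightarrow> compat s z"
  by (simp_all add: commutant_def)

end

text \<open>The double commutant of pairwise compatible elements consists of pairwise compatible elements: it lies
inside the first commutant, as the set itself does. Being a commutant, it is closed under all
operations that preserve compatibility, countable suprema included.\<close>
locale compatible_set = sigma_lattice_ea +
  fixes S :: "'a set"
  assumes S_carrier: "S \<subseteq> carrier E" and S_compat: "a \<in> S \<Longrightarrow> b \<in> S \<Longrightarrow> compat a b"
begin

abbreviation "block \<equiv> commutant (commutant S)"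

lemma S_block: "S \<subseteq> block"
  using S_carrier commutantD(2) compat_commute by (blast intro: commutantI)

lemma block_compat:
  assumes "a \<in> block" "b \<in> block" shows "compat a b"
proof -
  have "S \<subseteq> commutant S" using S_carrier S_compat by (blast intro: commutantI)
  then have "a \<in> commutant S" using commutantD[OF assms(1)] by (blast intro: commutantI)
  then show ?thesis using commutantD(2)[OF assms(2)] by blast
qed

lemma block_carrier: "block \<subseteq> carrier E"
  using commutantD(1) by blast

lemma block_sup:
  assumes "countable A" "A \<subseteq> block" "is_sup s A" shows "s \<in> block"
proof (rule commutantI[OF is_supD(2)[OF assms(3)]])
  fix c assume c: "c \<in> commutant S"
  show "compat c s"
    by (rule compat_sup(1)[OF assms(1) _ assms(3) commutantD(1)[OF c]])
      (use assms(2) c commutantD(2) in blast)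
qed

sublocale block: sub_effect_algebra E block
proof
  show "block \<subseteq> carrier E" by (rule block_carrier)
  show "\<one> \<in> block" by (rule commutantI) (auto intro: leq_compat leq_one dest: commutantD(1))
  show "a\<^sup>\<sim> \<in> block" if "a \<in> block" for a
    by (rule commutantI[OF compl_closed[OF commutantD(1)[OF that]] compat_compl[OF commutantD(2)[OF that]]])
  show "c \<in> block" if "a \<in> block" "b \<in> block" "Some a \<boxplus> Some b = Some c" for a b c
    by (rule commutantI[OF oadd_carrier(3)[OF that(3)]
      compat_oadd_closed[OF commutantD(2)[OF that(1)] commutantD(2)[OF that(2)] that(3)]])
qed

lemma block_meet:
  assumes "a \<in> block" "b \<in> block" shows "a \<^bold>\<and> b \<in> block"
  by (rule commutantI[OF meet(1)[OF commutantD(1)[OF assms(1)] commutantD(1)[OF assms(2)]]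
      compat_meet_closed[OF commutantD(2)[OF assms(1)] commutantD(2)[OF assms(2)]]])

abbreviation "E' \<equiv> E\<lparr>carrier := block\<rparr>"

lemma sigma_lattice_block: "sigma_lattice (ea_order E')"
proof -
  have sup: "\<exists>s. least (ea_order E') s (Upper (ea_order E') A)" if A: "A \<subseteq> block" "countable A" for A
  proof -
    obtain s where s: "is_sup s A" using countable_is_sup A block_carrier by blast
    have "s \<in> block" using block_sup A s by blast
    then show ?thesis using block.least_sub[OF A(1)] is_supD[OF s] by blast
  qed
  have inf: "\<exists>s. greatest (ea_order E') s (Lower (ea_order E') A)" if A: "A \<subseteq> block" "countable A" for A
  proof -
    have B: "ea_compl E ` A \<subseteq> block" "countable (ea_compl E ` A)" using A block.sub_compl by auto
    obtain s where s: "is_sup s (ea_compl E ` A)"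
      using countable_is_sup[OF order_trans[OF B(1) block_carrier] B(2)] by blast
    have sM: "s \<in> block" "s \<in> carrier E" using block_sup[OF B(2,1) s] block_carrier by auto
    have "greatest (ea_order E') (s\<^sup>\<sim>) (Lower (ea_order E') A)"
    proof (rule block.greatest_sub[OF A(1)])
      show "s\<^sup>\<sim> \<in> block" using block.sub_compl sM by blast
      fix a assume a: "a \<in> A"
      then have "a\<^sup>\<sim> \<preceq> s" "a \<in> carrier E" using is_supD(3)[OF s] A block_carrier by auto
      then show "s\<^sup>\<sim> \<preceq> a" using compl_antimono[of "a\<^sup>\<sim>" s] by simp
    next
      fix u assume u: "u \<in> carrier E" "\<forall>a\<in>A. u \<preceq> a"
      have "s \<preceq> u\<^sup>\<sim>" by (rule is_supD(4)[OF s]) (use u compl_antimono in auto)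
      then show "u \<preceq> s\<^sup>\<sim>" using compl_antimono[of s "u\<^sup>\<sim>"] u by simp
    qed
    then show ?thesis by blast
  qed
  interpret po: partial_order "ea_order E'" by (rule block.S.partial_order_ea_order)
  show ?thesis by unfold_locales (use sup inf in auto)
qed

sublocale block: sigma_mv E'
proof -
  interpret B: sigma_lattice_ea E'
    by (rule sigma_lattice_ea.intro[OF block.effect_algebra_sub sigma_lattice_block])
  show "sigma_mv E'"
  proof
    fix a b assume "a \<in> carrier E'" "b \<in> carrier E'"
    then have ab: "a \<in> block" "b \<in> block" by simp_all
    then have C: "a \<in> carrier E" "b \<in> carrier E" using block_carrier by auto
    define m where "m = a \<^bold>\<and> b"
    have m: "m \<in> block" "m \<preceq> a" "m \<preceq> b" using block_meet[OF ab] C by (simp_all add: m_def)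
    have d: "a \<ominus> m \<in> block" "b \<ominus> m \<in> block" using block.diff_sub m ab by blast+
    have "Some a \<boxplus> Some (b \<ominus> m) = Some (a \<^bold>\<or> b)"
      using compat_join[OF block_compat[OF ab]] by (simp add: m_def)
    then show "B.compat a b" unfolding B.compat_def
      using m d ab oadd_diff[OF m(2)] oadd_diff[OF m(3)]
      by (intro exI[of _ "a \<ominus> m"] exI[of _ "b \<ominus> m"] exI[of _ m])
        (simp add: block.oadd_sub oadd_commute)
  qed
qed

end

text \<open>In contrast to \<open>spectral_resolution\<close>, the ambient algebra is an arbitrary \<open>\<sigma>\<close>-lattice effect algebra here.\<close>
locale ea_resolution = sigma_lattice_ea +
  fixes F :: "real \<Rightarrow> 'a"
  assumes F_mono: "s \<le> t \<Longrightarrow> F s \<preceq> F t"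
    and F_lower: "t \<le> 0 \<Longrightarrow> F t = \<zero>"
    and F_upper: "1 < t \<Longrightarrow> F t = \<one>"
    and F_left: "is_sup (F t) (F ` {..<t})"
begin

sublocale compatible_set E "range F"
proof
  show "range F \<subseteq> carrier E" using F_mono leq_carrier by blast
  fix a b assume "a \<in> range F" "b \<in> range F"
  then obtain s t where "a = F s" "b = F t" by blast
  then show "compat a b" using leq_compat[OF F_mono] compat_commute[OF leq_compat[OF F_mono]]
    by (cases "s \<le> t") auto
qed

text \<open>The block of the chain \<open>range F\<close> has an observable for \<open>F\<close>; it is an observable of \<open>E\<close>, because countable
suprema of elements of the block are the same in both.\<close>
theorem ea_observable_exists: "\<exists>x. observable E x \<and> (\<forall>t. x {..<t} = F t)"
proof -
  have FM: "F t \<in> block" for t using S_block by blast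
  interpret R: spectral_resolution E' F
  proof
    show "block.S.leq (F s) (F t)" if "s \<le> t" for s t
      using F_mono[OF that] FM block.leq_sub by blast
    show "block.is_sup (F t) (F ` {..<t})" for t
      using F_left[of t] FM block_carrier block.leq_sub by (auto simp: block.is_sup_def is_sup_def)
  qed (use F_lower F_upper in auto)
  obtain x where x: "observable E' x" "\<And>t. x {..<t} = F t" using R.spectral_resolution_observable by blast
  have "observable E x" unfolding observable_def
  proof (intro conjI ballI allI impI)
    show "x \<in> sets borel \<rightarrow>\<^sub>E carrier E"
      using x(1) block_carrier by (auto simp: observable_def PiE_iff)
    show "x UNIV = \<one>" using x(1) by (simp add: observable_def)
    show "psum E (x B) (x C) = Some (x (B \<union> C))"
      if "B \<in> sets borel" "C \<in> sets borel" "B \<inter> C = {}" for B C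
      using x(1) that by (simp add: observable_def)
    fix B :: "nat \<Rightarrow> real set" assume B: "(\<forall>i. B i \<in> sets borel) \<and> (\<forall>i. B i \<subseteq> B (Suc i))"
    let ?A = "range (\<lambda>i. x (B i))"
    have AM: "?A \<subseteq> block" using x(1) B by (auto simp: observable_def PiE_iff)
    then have AC: "?A \<subseteq> carrier E" using block_carrier by blast
    obtain s where s: "is_sup s ?A" using countable_is_sup[OF AC] by auto
    have "s \<in> block" using block_sup[OF _ AM s] by simp
    then have "least (ea_order E') s (Upper (ea_order E') ?A)"
      using block.least_sub[OF AM] is_supD[OF s] by blast
    then have "block.is_sup s ?A" using AM by (simp add: block.is_sup_iff_least)
    moreover have "block.is_sup (x (\<Union>i. B i)) ?A"
      using x(1) B AM by (simp add: observable_def block.is_sup_iff_least)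
    ultimately have "x (\<Union>i. B i) = s" using block.is_sup_unique by blast
    then show "least (ea_order E) (x (\<Union>i. B i)) (Upper (ea_order E) ?A)"
      using s is_sup_iff_least[OF AC] by simp
  qed
  then show ?thesis using x(2) by blast
qed

end

section \<open>Effect observables\<close>

lemma lessThan_eq_UN: "(\<Union>n. {..<t - 1 / Suc n}) = {..<t::real}"
proof (intro equalityI subsetI)
  fix s assume "s \<in> {..<t}"
  then obtain n where "1 / Suc n < t - s" using nat_approx_posE[of "t - s"] by auto
  then show "s \<in> (\<Union>n. {..<t - 1 / Suc n})" by (auto intro!: exI[of _ n])
qed (auto intro: less_trans)

lemma atMost_eq_INT: "(\<Inter>n. {..<t + 1 / Suc n}) = {..t::real}"
proof (intro equalityI subsetI)
  fix s assume s: "s \<in> (\<Inter>n. {..<t + 1 / Suc n})"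
  show "s \<in> {..t}"
  proof (rule ccontr)
    assume "s \<notin> {..t}"
    then obtain n where "1 / Suc n < s - t" using nat_approx_posE[of "s - t"] by auto
    then show False using s by (auto dest!: spec[of _ n])
  qed
qed (auto intro: le_less_trans)

context effect_algebra
begin

lemma observableD:
  assumes "observable E x"
  shows observable_closed [simp]: "B \<in> sets borel \<Longrightarrow> x B \<in> carrier E"
    and observable_extensional: "x \<in> extensional (sets borel)"
    and observable_UNIV: "x UNIV = \<one>"
    and observable_oadd: "B \<in> sets borel \<Longrightarrow> C \<in> sets borel \<Longrightarrow> B \<inter> C = {} \<Longrightarrow>
      Some (x B) \<boxplus> Some (x C) = Some (x (B \<union> C))"
  using assms oadd_eq by (auto simp: observable_def PiE_iff)

lemma observable_empty: "observable E x \<Longrightarrow> x {} = \<zero>"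
  using observable_oadd[of x UNIV "{}"] oadd_cancel[of "x UNIV" "x {}" "x UNIV" \<zero>] by simp

lemma observable_compl:
  assumes "observable E x" "B \<in> sets borel" shows "x (- B) = (x B)\<^sup>\<sim>"
proof (rule compl_unique)
  show "Some (x B) \<boxplus> Some (x (- B)) = Some \<one>"
    using observable_oadd[OF assms(1), of B "- B"] observable_UNIV[OF assms(1)] assms(2) by simp
qed

lemma observable_mono:
  assumes "observable E x" "B \<in> sets borel" "C \<in> sets borel" "B \<subseteq> C" shows "x B \<preceq> x C"
proof (rule leqI)
  have "B \<union> (C - B) = C" using assms by auto
  then show "Some (x B) \<boxplus> Some (x (C - B)) = Some (x C)"
    using observable_oadd[OF assms(1), of B "C - B"] assms by simp
qed

lemma observable_null_mono:
  "observable E x \<Longrightarrow> B \<in> sets borel \<Longrightarrow> C \<in> sets borel \<Longrightarrow> B \<subseteq> C \<Longrightarrow> x C = \<zero> \<Longrightarrow> x B = \<zero>"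
  using observable_mono[of x B C] leq_zero by simp

lemma observable_one_mono:
  "observable E x \<Longrightarrow> B \<in> sets borel \<Longrightarrow> C \<in> sets borel \<Longrightarrow> B \<subseteq> C \<Longrightarrow> x B = \<one> \<Longrightarrow> x C = \<one>"
  using observable_mono[of x B C] leq_one[of "x C"] leq_antisym by auto

lemma observable_null_Un:
  assumes x: "observable E x" and BC: "B \<in> sets borel" "C \<in> sets borel" "x B = \<zero>" "x C = \<zero>"
  shows "x (B \<union> C) = \<zero>"
proof -
  have "x (C - B) = \<zero>" using observable_null_mono[OF x _ BC(2) _ BC(4), of "C - B"] BC by blast
  moreover have "B \<inter> (C - B) = {}" "B \<union> (C - B) = B \<union> C" by auto
  ultimately show ?thesis using observable_oadd[OF x, of B "C - B"] BC by simp
qed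

end

context sigma_lattice_ea
begin

lemma observable_sup:
  assumes x: "observable E x" and B: "\<And>i::nat. B i \<in> sets borel" "\<And>i. B i \<subseteq> B (Suc i)"
  shows "is_sup (x (\<Union>i. B i)) (range (\<lambda>i. x (B i)))"
proof -
  have "range (\<lambda>i. x (B i)) \<subseteq> carrier E" using x B by auto
  then show ?thesis using x B by (auto simp: is_sup_iff_least observable_def)
qed

lemma observable_inf:
  assumes x: "observable E x" and B: "\<And>i::nat. B i \<in> sets borel" "\<And>i. B (Suc i) \<subseteq> B i"
    and u: "\<And>i. u \<preceq> x (B i)"
  shows "u \<preceq> x (\<Inter>i. B i)"
proof -
  have uC: "u \<in> carrier E" using u leq_carrier by blast
  have "is_sup (x (\<Union>i. - B i)) (range (\<lambda>i. x (- B i)))"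
    using B by (intro observable_sup[OF x]) auto
  moreover have "x (- B i) \<preceq> u\<^sup>\<sim>" for i
    using compl_antimono[OF u[of i]] observable_compl[OF x B(1)] by simp
  ultimately have "x (\<Union>i. - B i) \<preceq> u\<^sup>\<sim>"
    using is_supD(4)[of "x (\<Union>i. - B i)" "range (\<lambda>i. x (- B i))" "u\<^sup>\<sim>"] uC by blast
  moreover have I: "(\<Inter>i. B i) \<in> sets borel" using B by auto
  ultimately have "(x (\<Inter>i. B i))\<^sup>\<sim> \<preceq> u\<^sup>\<sim>" unfolding observable_compl[OF x I, symmetric] by simp
  then show ?thesis using compl_leq_iff uC x I by simp
qed

lemma observable_null_UN:
  assumes x: "observable E x" and B: "\<And>i::nat. B i \<in> sets borel" "\<And>i. x (B i) = \<zero>"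
  shows "x (\<Union>i. B i) = \<zero>"
proof -
  have fin: "x (\<Union>i<n. B i) = \<zero>" for n
  proof (induction n)
    case 0
    then show ?case using observable_empty[OF x] by simp
  next
    case (Suc n)
    then have "x ((\<Union>i<n. B i) \<union> B n) = \<zero>" using B by (intro observable_null_Un[OF x]) auto
    moreover have "(\<Union>i<n. B i) \<union> B n = (\<Union>i<Suc n. B i)" by (auto simp: less_Suc_eq)
    ultimately show ?case by simp
  qed
  have "is_sup (x (\<Union>n. \<Union>i<n. B i)) (range (\<lambda>n. x (\<Union>i<n. B i)))"
    using B by (intro observable_sup[OF x]) (auto simp: less_Suc_eq)
  then have "x (\<Union>n. \<Union>i<n. B i) \<preceq> \<zero>" by (rule is_supD(4)) (auto simp: fin)
  moreover have "(\<Union>n. \<Union>i<n. B i) = (\<Union>i. B i)" by auto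
  ultimately show ?thesis using leq_zero by simp
qed

text \<open>The sets on which \<open>x\<close> and \<open>y\<close> agree are closed under complements and countable disjoint unions, and the
half-lines are closed under intersection. This makes the Olson order antisymmetric.\<close>
lemma observable_eqI:
  assumes x: "observable E x" and y: "observable E y" and eq: "\<And>t. x {..<t} = y {..<t}"
  shows "x = y"
proof (rule extensionalityI[OF observable_extensional[OF x] observable_extensional[OF y]])
  fix B :: "real set" assume "B \<in> sets borel"
  then show "x B = y B"
  proof (induction rule: borel_lessThan_induct)
    case (union A)
    have fin: "x (\<Union>i<n. A i) = y (\<Union>i<n. A i)" for n
    proof (induction n)
      case 0
      then show ?case using observable_empty[OF x] observable_empty[OF y] by simp
    next
      case (Suc n)
      have "A i \<inter> A n = {}" if "i < n" for i
        using disjoint_family_onD[OF union(1), of i n] that by simp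
      then have d: "(\<Union>i<n. A i) \<inter> A n = {}" by auto
      have U: "(\<Union>i<Suc n. A i) = (\<Union>i<n. A i) \<union> A n" by (auto simp: less_Suc_eq)
      have "(\<Union>i<n. A i) \<in> sets borel" using union(2) by auto
      then show ?case
        unfolding U using observable_oadd[OF x _ union(2) d] observable_oadd[OF y _ union(2) d] Suc union(3)[of n]
        by simp
    qed
    have "is_sup (x (\<Union>n. \<Union>i<n. A i)) (range (\<lambda>n. x (\<Union>i<n. A i)))"
      using union(2) by (intro observable_sup[OF x]) (auto simp: less_Suc_eq)
    moreover have "is_sup (y (\<Union>n. \<Union>i<n. A i)) (range (\<lambda>n. y (\<Union>i<n. A i)))"
      using union(2) by (intro observable_sup[OF y]) (auto simp: less_Suc_eq)
    moreover have "(\<Union>n. \<Union>i<n. A i) = (\<Union>i. A i)" by auto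
    ultimately show ?case using is_sup_unique fin by simp
  qed (use eq observable_empty[OF x] observable_empty[OF y] observable_compl[OF x] observable_compl[OF y] in auto)
qed

text \<open>The intersection of all closed sets of full measure has full measure: its complement is a union of
open null sets, and countably many of them suffice by Lindelof's theorem.\<close>
lemma spectrum_least:
  assumes x: "observable E x"
  shows "closed (spectrum E x)" "x (spectrum E x) = \<one>" 
    "\<And>K. closed K \<Longrightarrow> x K = \<one> \<Longrightarrow> spectrum E x \<subseteq> K"
proof -
  define \<F> where "\<F> = {K. closed K \<and> x K = \<one>}"
  have null: "x (- K) = \<zero>" "- K \<in> sets borel" if "K \<in> \<F>" for K
    using that observable_compl[OF x, of K] by (auto simp: \<F>_def)
  obtain \<G> where \<G>: "\<G> \<subseteq> uminus ` \<F>" "countable \<G>" "\<Union>\<G> = \<Union>(uminus ` \<F>)"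
    using Lindelof[of "uminus ` \<F>"] by (auto simp: \<F>_def)
  have "x (\<Union>\<G>) = \<zero>"
  proof (cases "\<G> = {}")
    case True
    then show ?thesis using observable_empty[OF x] by simp
  next
    case False
    have "from_nat_into \<G> i \<in> uminus ` \<F>" for i using \<G>(1) from_nat_into[OF False] by blast
    then have "x (\<Union>i. from_nat_into \<G> i) = \<zero>"
      using null by (intro observable_null_UN[OF x]) (metis imageE)+
    then show ?thesis using range_from_nat_into[OF False \<G>(2)] by simp
  qed
  moreover have "\<Union>(uminus ` \<F>) = - \<Inter>\<F>" by auto
  ultimately have "x (- \<Inter>\<F>) = \<zero>" using \<G>(3) by simp
  moreover have cl: "closed (\<Inter>\<F>)" by (rule closed_Inter) (simp add: \<F>_def)
  ultimately have one: "x (\<Inter>\<F>) = \<one>" using observable_compl[OF x, of "- \<Inter>\<F>"] by simp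
  have "spectrum E x = \<Inter>\<F>" unfolding spectrum_def
    by (rule Least_equality) (use cl one in \<open>auto simp: \<F>_def\<close>)
  then show "closed (spectrum E x)" "x (spectrum E x) = \<one>" 
    "\<And>K. closed K \<Longrightarrow> x K = \<one> \<Longrightarrow> spectrum E x \<subseteq> K"
    using cl one by (auto simp: \<F>_def)
qed

lemma EO_carrier_iff: "x \<in> carrier (EO E) \<longleftrightarrow> observable E x \<and> x {0..1} = \<one>"
proof -
  have "spectrum E x \<subseteq> {0..1} \<longleftrightarrow> x {0..1} = \<one>" if x: "observable E x"
    using spectrum_least[OF x] observable_one_mono[OF x, of "spectrum E x" "{0..1}"] by auto
  then show ?thesis by (auto simp: EO_def)
qed

lemma EO_observable: "x \<in> carrier (EO E) \<Longrightarrow> observable E x"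
  by (simp add: EO_carrier_iff)

lemma EO_closed [simp]: "x \<in> carrier (EO E) \<Longrightarrow> B \<in> sets borel \<Longrightarrow> x B \<in> carrier E"
  using EO_observable by simp

lemma EO_le_iff: "x \<in> carrier (EO E) \<Longrightarrow> y \<in> carrier (EO E) \<Longrightarrow>
    le (EO E) x y \<longleftrightarrow> (\<forall>t. y {..<t} \<preceq> x {..<t})"
  by (simp add: EO_def olson_le_def EO_carrier_iff)

lemma EO_lower:
  assumes "x \<in> carrier (EO E)" "t \<le> 0" shows "x {..<t} = \<zero>"
proof -
  have x: "observable E x" "x {0..1} = \<one>" using assms by (auto simp: EO_carrier_iff)
  have "x (- {0..1}) = \<zero>" using observable_compl[OF x(1), of "{0..1}"] x(2) by simp
  then show ?thesis
    by (rule observable_null_mono[OF x(1), rotated 3]) (use assms in auto)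
qed

lemma EO_upper: "x \<in> carrier (EO E) \<Longrightarrow> 1 < t \<Longrightarrow> x {..<t} = \<one>"
proof -
  assume "x \<in> carrier (EO E)" "1 < t"
  moreover from this have "{0..1} \<subseteq> {..<t}" by auto
  ultimately show ?thesis using observable_one_mono[of x "{0..1}" "{..<t}"] by (simp add: EO_carrier_iff)
qed

lemma partial_order_EO: "partial_order (EO E)"
proof -
  have c: "eq (EO E) = (=)" by (simp add: EO_def)
  show ?thesis
  proof
    fix x y z
    assume x: "x \<in> carrier (EO E)"
    then show "le (EO E) x x" by (simp add: EO_le_iff)
    assume y: "y \<in> carrier (EO E)"
    show "eq (EO E) x y" if "le (EO E) x y" "le (EO E) y x"
      using that x y observable_eqI[OF EO_observable EO_observable] leq_antisym by (auto simp: EO_le_iff c)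
    assume z: "z \<in> carrier (EO E)"
    show "le (EO E) x z" if "le (EO E) x y" "le (EO E) y z"
      using that x y z leq_trans unfolding EO_le_iff[OF x y] EO_le_iff[OF y z] EO_le_iff[OF x z] by blast
  qed (auto simp: c)
qed

interpretation EO: partial_order "EO E" by (rule partial_order_EO)

lemma greatest_EO_unique:
  assumes "greatest (EO E) i (Lower (EO E) A)" shows "\<Sqinter>\<^bsub>EO E\<^esub> A = i"
  unfolding Lattice.inf_def
proof (rule some_equality)
  show "greatest (EO E) i (Lower (EO E) A)" by (rule assms)
  fix j assume "greatest (EO E) j (Lower (EO E) A)"
  then show "j = i" using assms unfolding greatest_def by (blast intro: EO.le_antisym)
qed

lemma least_EO_unique:
  assumes "least (EO E) i (Upper (EO E) A)" shows "\<Squnion>\<^bsub>EO E\<^esub> A = i"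
  unfolding Lattice.sup_def
proof (rule some_equality)
  show "least (EO E) i (Upper (EO E) A)" by (rule assms)
  fix j assume "least (EO E) j (Upper (EO E) A)"
  then show "j = i" using assms unfolding least_def by (blast intro: EO.le_antisym)
qed

text \<open>The values \<open>S t\<close> are prescribed only on the interval from \<open>0\<close> to \<open>1\<close>; outside, the resolution has to be \<open>0\<close> or \<open>1\<close>,
which matters for the empty family, where all \<open>S t\<close> are \<open>0\<close>. Left-continuity of the supremum is inherited from
the members, since suprema commute.\<close>
lemma EO_inf_exists:
  assumes A: "A \<subseteq> carrier (EO E)" and sup: "\<And>t. \<exists>s. is_sup s ((\<lambda>x. x {..<t}) ` A)"
  shows "\<exists>i. greatest (EO E) i (Lower (EO E) A)"
proof -
  obtain S where S: "\<And>t. is_sup (S t) ((\<lambda>x. x {..<t}) ` A)" using sup by metis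
  define F where "F t = (if t \<le> 0 then \<zero> else if 1 < t then \<one> else S t)" for t :: real
  have SC: "S t \<in> carrier E" for t using is_supD(2)[OF S] .
  have FC: "F t \<in> carrier E" for t by (simp add: F_def SC)
  have xS: "x {..<t} \<preceq> S t" if "x \<in> A" for x t using is_supD(3)[OF S] that by blast
  have xF: "x {..<t} \<preceq> F t" if x: "x \<in> A" for x t
    using xS[OF x] EO_lower[of x t] EO_closed[of x] A x by (auto simp: F_def)
  have Smono: "S s \<preceq> S t" if st: "s \<le> t" for s t
  proof (rule is_supD(4)[OF S SC])
    fix a assume "a \<in> (\<lambda>x. x {..<s}) ` A"
    then obtain x where x: "x \<in> A" "a = x {..<s}" by blast
    have "x {..<s} \<preceq> x {..<t}" using st x A EO_observable by (intro observable_mono) auto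
    then show "a \<preceq> S t" using xS[OF x(1)] leq_trans x by blast
  qed
  have Fmono: "F s \<preceq> F t" if "s \<le> t" for s t
    using that Smono[OF that] by (auto simp: F_def SC)
  interpret ea_resolution E F
  proof
    show "is_sup (F t) (F ` {..<t})" for t
      unfolding is_sup_def
    proof (intro conjI ballI impI)
      show "F ` {..<t} \<subseteq> carrier E" "F t \<in> carrier E" using FC by auto
      show "a \<preceq> F t" if "a \<in> F ` {..<t}" for a using that Fmono by auto
      fix u assume u: "u \<in> carrier E" "\<forall>a\<in>F ` {..<t}. a \<preceq> u"
      consider "t \<le> 0" | "0 < t" "t \<le> 1" | "1 < t" by linarith
      then show "F t \<preceq> u"
      proof cases
        case 1
        then show ?thesis using u by (simp add: F_def)
      next
        case 2
        have "S t \<preceq> u"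
        proof (rule is_supD(4)[OF S u(1)])
          fix a assume "a \<in> (\<lambda>x. x {..<t}) ` A"
          then obtain x where x: "x \<in> A" "a = x {..<t}" by blast
          have xo: "observable E x" using x A EO_observable by auto
          have "is_sup (x (\<Union>n. {..<t - 1 / Suc n})) (range (\<lambda>n. x {..<t - 1 / Suc n}))"
            by (rule observable_sup[OF xo]) (auto simp: field_simps)
          then have "is_sup (x {..<t}) (range (\<lambda>n. x {..<t - 1 / Suc n}))"
            unfolding lessThan_eq_UN .
          then have "x {..<t} \<preceq> u"
          proof (rule is_supD(4)[OF _ u(1)])
            fix b assume "b \<in> range (\<lambda>n. x {..<t - 1 / Suc n})"
            then obtain n where n: "b = x {..<t - 1 / Suc n}" by blast
            have "F (t - 1 / Suc n) \<preceq> u" using u(2) by auto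
            then show "b \<preceq> u" using xF[OF x(1)] leq_trans n by blast
          qed
          then show "a \<preceq> u" using x by simp
        qed
        then show ?thesis using 2 by (simp add: F_def)
      next
        case 3
        then have "F ((1 + t) / 2) \<preceq> u" using u(2) by auto
        then show ?thesis using 3 by (simp add: F_def)
      qed
    qed
  qed (use Fmono in \<open>auto simp: F_def\<close>)
  obtain i where i: "observable E i" "\<And>t. i {..<t} = F t" using ea_observable_exists by blast
  have "\<one> \<preceq> i (\<Inter>n. {..<1 + 1 / Suc n})"
    by (rule observable_inf[OF i(1)]) (auto simp: i(2) F_def field_simps)
  then have "\<one> \<preceq> i {..1}" unfolding atMost_eq_INT .
  then have one: "i {..1} = \<one>" using leq_one[of "i {..1}"] i(1) leq_antisym by simp
  have "i (- {..1}) = \<zero>" using observable_compl[OF i(1), of "{..1}"] one by simp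
  moreover have "i {..<0} = \<zero>" by (simp add: i(2) F_def)
  ultimately have "i (- {..1} \<union> {..<0}) = \<zero>" by (intro observable_null_Un[OF i(1)]) auto
  moreover have "- (- {..1} \<union> {..<0}) = {0..1::real}" by auto
  ultimately have "i {0..1} = \<one>" using observable_compl[OF i(1), of "- {..1} \<union> {..<0}"] by simp
  then have iE: "i \<in> carrier (EO E)" using i(1) by (simp add: EO_carrier_iff)
  have "greatest (EO E) i (Lower (EO E) A)"
    unfolding greatest_def
  proof (intro conjI ballI)
    show "i \<in> Lower (EO E) A" using iE A xF by (auto simp: Lower_def EO_le_iff subset_iff i(2))
    fix z assume z: "z \<in> Lower (EO E) A"
    then have zE: "z \<in> carrier (EO E)" and zx: "\<And>x. x \<in> A \<Longrightarrow> le (EO E) z x"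
      using A by (auto simp: Lower_def)
    have "F t \<preceq> z {..<t}" for t
    proof -
      have "S t \<preceq> z {..<t}"
      proof (rule is_supD(4)[OF S])
        fix a assume "a \<in> (\<lambda>x. x {..<t}) ` A"
        then obtain x where x: "x \<in> A" "a = x {..<t}" by blast
        show "a \<preceq> z {..<t}" using zx[OF x(1)] EO_le_iff[OF zE, of x] A x by blast
      qed (use zE in simp)
      then show ?thesis using EO_upper[OF zE, of t] EO_closed[OF zE] by (auto simp: F_def)
    qed
    then show "le (EO E) z i" using zE iE by (simp add: EO_le_iff i(2))
  qed (auto simp: Lower_def)
  then show ?thesis by blast
qed

section \<open>Functions of observables and the involution\<close>

lemma obs_fun_apply: "B \<in> sets borel \<Longrightarrow> obs_fun f x B = x (f -` B)"
  by (simp add: obs_fun_def)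

lemma observable_obs_fun:
  assumes x: "observable E x" and f: "f \<in> borel_measurable borel"
  shows "observable E (obs_fun f x)"
proof -
  have m: "f -` B \<in> sets borel" if "B \<in> sets borel" for B using measurable_sets[OF f that] by simp
  show ?thesis unfolding observable_def
  proof (intro conjI ballI allI impI)
    show "obs_fun f x \<in> sets borel \<rightarrow>\<^sub>E carrier E"
      unfolding obs_fun_def by (rule restrict_PiE[THEN iffD2]) (use observable_closed[OF x m] in blast)
    show "obs_fun f x UNIV = \<one>" using observable_UNIV[OF x] by (simp add: obs_fun_def)
    show "psum E (obs_fun f x B) (obs_fun f x C) = Some (obs_fun f x (B \<union> C))"
      if "B \<in> sets borel" "C \<in> sets borel" "B \<inter> C = {}" for B C
      using that observable_oadd[OF x m m, of B C] oadd_eq m x by (auto simp: obs_fun_def vimage_Un)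
    fix B :: "nat \<Rightarrow> real set" assume B: "(\<forall>i. B i \<in> sets borel) \<and> (\<forall>i. B i \<subseteq> B (Suc i))"
    have "is_sup (x (\<Union>i. f -` B i)) (range (\<lambda>i. x (f -` B i)))"
      using B by (intro observable_sup[OF x] m vimage_mono) blast+
    moreover have "(\<Union>i. B i) \<in> sets borel" using B by auto
    ultimately have "is_sup (obs_fun f x (\<Union>i. B i)) (range (\<lambda>i. obs_fun f x (B i)))"
      using B by (simp only: obs_fun_apply vimage_UN)
    then show "least (ea_order E) (obs_fun f x (\<Union>i. B i))
        (Upper (ea_order E) (range (\<lambda>i. obs_fun f x (B i))))"
      using is_sup_iff_least is_supD(1) by blast
  qed
qed

lemma EO_obs_fun:
  assumes x: "x \<in> carrier (EO E)" and f: "f \<in> borel_measurable borel" "f ` {0..1} \<subseteq> {0..1}"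
  shows "obs_fun f x \<in> carrier (EO E)"
proof -
  have "f -` {0..1} \<in> sets borel" using measurable_sets[OF f(1), of "{0..1}"] by simp
  then have "x (f -` {0..1}) = \<one>"
    using x f(2) observable_one_mono[of x "{0..1}" "f -` {0..1}"] by (auto simp: EO_carrier_iff)
  then show ?thesis using x f observable_obs_fun by (simp add: EO_carrier_iff obs_fun_apply)
qed

lemma obs_fun_mono:
  assumes x: "observable E x" and f: "f \<in> borel_measurable borel" and g: "g \<in> borel_measurable borel"
    and le: "\<And>t. f t \<le> g t"
  shows "obs_fun g x {..<t} \<preceq> obs_fun f x {..<t}"
proof -
  have "f -` {..<t} \<in> sets borel" "g -` {..<t} \<in> sets borel"
    using measurable_sets[OF f, of "{..<t}"] measurable_sets[OF g, of "{..<t}"] by simp_all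
  moreover have "g -` {..<t} \<subseteq> f -` {..<t}" using le by (auto intro: le_less_trans)
  ultimately show ?thesis by (simp add: obs_fun_apply observable_mono[OF x])
qed

lemma obs_neg_apply: "B \<in> sets borel \<Longrightarrow> obs_neg x B = x ((\<lambda>t. 1 - t) -` B)"
  by (simp add: obs_neg_def obs_fun_apply)

lemma obs_neg_closed: "x \<in> carrier (EO E) \<Longrightarrow> obs_neg x \<in> carrier (EO E)"
  unfolding obs_neg_def by (rule EO_obs_fun) auto

lemma obs_neg_neg: "x \<in> carrier (EO E) \<Longrightarrow> obs_neg (obs_neg x) = x"
proof -
  assume x: "x \<in> carrier (EO E)"
  show ?thesis
  proof (rule extensionalityI)
    show "obs_neg (obs_neg x) \<in> extensional (sets borel)" by (simp add: obs_neg_def obs_fun_def)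
    show "x \<in> extensional (sets borel)" using observable_extensional[OF EO_observable[OF x]] .
    fix B :: "real set" assume B: "B \<in> sets borel"
    have "(\<lambda>t::real. 1 - t) -` B \<in> sets borel"
      using measurable_sets[OF _ B, of "\<lambda>t. 1 - t" borel] by simp
    then show "obs_neg (obs_neg x) B = x B" using B by (simp add: obs_neg_apply vimage_def)
  qed
qed

text \<open>Reflection turns \<open>{..<t}\<close> into the complement of \<open>{..1 - t}\<close>, so the inequality is needed for closed half-lines,
which are intersections of open ones.\<close>
lemma obs_neg_antitone:
  assumes x: "x \<in> carrier (EO E)" and y: "y \<in> carrier (EO E)" and le: "le (EO E) x y"
  shows "le (EO E) (obs_neg y) (obs_neg x)"
proof -
  note xo = EO_observable[OF x] and yo = EO_observable[OF y]
  have "y {..s} \<preceq> x {..s}" for s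
  proof -
    have "y {..s} \<preceq> x (\<Inter>n. {..<s + 1 / Suc n})"
    proof (rule observable_inf[OF xo])
      fix n :: nat
      have "y {..s} \<preceq> y {..<s + 1 / Suc n}"
        by (rule observable_mono[OF yo]) (auto intro: le_less_trans)
      also have "\<dots> \<preceq> x {..<s + 1 / Suc n}" using le x y by (simp add: EO_le_iff)
      finally show "y {..s} \<preceq> x {..<s + 1 / Suc n}" .
    qed (auto simp: field_simps)
    then show ?thesis unfolding atMost_eq_INT .
  qed
  then have "(x {..s})\<^sup>\<sim> \<preceq> (y {..s})\<^sup>\<sim>" for s using compl_antimono by blast
  then have "x (- {..s}) \<preceq> y (- {..s})" for s using observable_compl xo yo by simp
  moreover have "(\<lambda>r. 1 - r) -` {..<t} = - {..1 - t}" for t :: real by auto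
  ultimately show ?thesis using x y by (simp add: EO_le_iff obs_neg_closed obs_neg_apply)
qed

text \<open>An antitone involution turns infima into suprema.\<close>
lemma least_obs_neg:
  assumes A: "A \<subseteq> carrier (EO E)" and i: "greatest (EO E) i (Lower (EO E) A)"
  shows "least (EO E) (obs_neg i) (Upper (EO E) (obs_neg ` A))"
proof -
  have iE: "i \<in> carrier (EO E)" "\<And>x. x \<in> A \<Longrightarrow> le (EO E) i x"
    "\<And>z. z \<in> carrier (EO E) \<Longrightarrow> (\<And>x. x \<in> A \<Longrightarrow> le (EO E) z x) \<Longrightarrow> le (EO E) z i"
    using i A by (auto simp: greatest_def Lower_def)
  show ?thesis unfolding least_def
  proof (intro conjI ballI)
    show "obs_neg i \<in> Upper (EO E) (obs_neg ` A)"
      using iE A obs_neg_closed obs_neg_antitone by (auto simp: Upper_def)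
    fix u assume u: "u \<in> Upper (EO E) (obs_neg ` A)"
    then have uE: "u \<in> carrier (EO E)" by (simp add: Upper_def)
    have "le (EO E) (obs_neg u) x" if x: "x \<in> A" for x
    proof -
      have xE: "x \<in> carrier (EO E)" using x A by auto
      then have "le (EO E) (obs_neg x) u" using u x obs_neg_closed[OF xE] unfolding Upper_def by blast
      then show ?thesis using obs_neg_antitone[OF obs_neg_closed[OF xE] uE] obs_neg_neg[OF xE] by simp
    qed
    then have "le (EO E) (obs_neg u) i" using iE(3)[OF obs_neg_closed[OF uE]] by blast
    then show "le (EO E) (obs_neg i) u"
      using obs_neg_antitone[OF obs_neg_closed[OF uE] iE(1)] obs_neg_neg[OF uE] by simp
  qed (auto simp: Upper_def)
qed

lemma greatest_obs_neg:
  assumes A: "A \<subseteq> carrier (EO E)" and i: "least (EO E) i (Upper (EO E) A)"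
  shows "greatest (EO E) (obs_neg i) (Lower (EO E) (obs_neg ` A))"
proof -
  have iE: "i \<in> carrier (EO E)" "\<And>x. x \<in> A \<Longrightarrow> le (EO E) x i"
    "\<And>z. z \<in> carrier (EO E) \<Longrightarrow> (\<And>x. x \<in> A \<Longrightarrow> le (EO E) x z) \<Longrightarrow> le (EO E) i z"
    using i A by (auto simp: least_def Upper_def)
  show ?thesis unfolding greatest_def
  proof (intro conjI ballI)
    show "obs_neg i \<in> Lower (EO E) (obs_neg ` A)"
      using iE A obs_neg_closed obs_neg_antitone by (auto simp: Lower_def)
    fix u assume u: "u \<in> Lower (EO E) (obs_neg ` A)"
    then have uE: "u \<in> carrier (EO E)" by (simp add: Lower_def)
    have "le (EO E) x (obs_neg u)" if x: "x \<in> A" for x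
    proof -
      have xE: "x \<in> carrier (EO E)" using x A by auto
      then have "le (EO E) u (obs_neg x)" using u x obs_neg_closed[OF xE] unfolding Lower_def by blast
      then show ?thesis using obs_neg_antitone[OF uE obs_neg_closed[OF xE]] obs_neg_neg[OF xE] by simp
    qed
    then have "le (EO E) i (obs_neg u)" using iE(3)[OF obs_neg_closed[OF uE]] by blast
    then show "le (EO E) u (obs_neg i)"
      using obs_neg_antitone[OF iE(1) obs_neg_closed[OF uE]] obs_neg_neg[OF uE] by simp
  qed (auto simp: Lower_def)
qed

lemma EO_sup_exists:
  assumes A: "A \<subseteq> carrier (EO E)" and inf: "\<exists>i. greatest (EO E) i (Lower (EO E) (obs_neg ` A))"
  shows "\<exists>s. least (EO E) s (Upper (EO E) A)"
proof -
  have nA: "obs_neg ` A \<subseteq> carrier (EO E)" using A obs_neg_closed by blast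
  have "obs_neg ` obs_neg ` A = (\<lambda>x. x) ` A"
    unfolding image_image by (rule image_cong[OF refl]) (use A obs_neg_neg in blast)
  then have nn: "obs_neg ` obs_neg ` A = A" by simp
  obtain i where "greatest (EO E) i (Lower (EO E) (obs_neg ` A))" using inf by blast
  from least_obs_neg[OF nA this] show ?thesis unfolding nn by blast
qed

lemma EO_de_morgan:
  fixes x :: "'i \<Rightarrow> real set \<Rightarrow> 'a"
  assumes x: "\<And>\<alpha>. \<alpha> \<in> A \<Longrightarrow> x \<alpha> \<in> carrier (EO E)"
    and inf: "\<exists>i. greatest (EO E) i (Lower (EO E) (x ` A))"
    and sup: "\<exists>s. least (EO E) s (Upper (EO E) (x ` A))"
  shows "obs_neg (\<Sqinter>\<^bsub>EO E\<^esub> (x ` A)) = \<Squnion>\<^bsub>EO E\<^esub> ((\<lambda>\<alpha>. obs_neg (x \<alpha>)) ` A)"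
    and "obs_neg (\<Squnion>\<^bsub>EO E\<^esub> (x ` A)) = \<Sqinter>\<^bsub>EO E\<^esub> ((\<lambda>\<alpha>. obs_neg (x \<alpha>)) ` A)"
proof -
  have xA: "x ` A \<subseteq> carrier (EO E)" using x by auto
  have im: "(\<lambda>\<alpha>. obs_neg (x \<alpha>)) ` A = obs_neg ` x ` A" by (simp add: image_image)
  obtain i where i: "greatest (EO E) i (Lower (EO E) (x ` A))" using inf by blast
  show "obs_neg (\<Sqinter>\<^bsub>EO E\<^esub> (x ` A)) = \<Squnion>\<^bsub>EO E\<^esub> ((\<lambda>\<alpha>. obs_neg (x \<alpha>)) ` A)"
    unfolding im greatest_EO_unique[OF i] least_EO_unique[OF least_obs_neg[OF xA i]] ..
  obtain s where s: "least (EO E) s (Upper (EO E) (x ` A))" using sup by blast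
  show "obs_neg (\<Squnion>\<^bsub>EO E\<^esub> (x ` A)) = \<Sqinter>\<^bsub>EO E\<^esub> ((\<lambda>\<alpha>. obs_neg (x \<alpha>)) ` A)"
    unfolding im least_EO_unique[OF s] greatest_EO_unique[OF greatest_obs_neg[OF xA s]] ..
qed

lemma EO_countable_inf:
  assumes "A \<subseteq> carrier (EO E)" "countable A" shows "\<exists>i. greatest (EO E) i (Lower (EO E) A)"
proof (rule EO_inf_exists[OF assms(1)])
  show "\<exists>s. is_sup s ((\<lambda>x. x {..<t}) ` A)" for t
    by (rule countable_is_sup) (use assms in auto)
qed

lemma EO_countable_sup:
  assumes "A \<subseteq> carrier (EO E)" "countable A" shows "\<exists>s. least (EO E) s (Upper (EO E) A)"
proof (rule EO_sup_exists[OF assms(1)])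
  show "\<exists>i. greatest (EO E) i (Lower (EO E) (obs_neg ` A))"
    using assms obs_neg_closed by (intro EO_countable_inf countable_image) blast+
qed

lemma sigma_lattice_EO: "sigma_lattice (EO E)"
  by unfold_locales (use EO_countable_inf EO_countable_sup in auto)

lemma involution_lattice_EO: "involution_lattice (EO E) obs_neg"
proof -
  interpret sigma_lattice "EO E" by (rule sigma_lattice_EO)
  show ?thesis by unfold_locales (use obs_neg_closed obs_neg_neg obs_neg_antitone in auto)
qed

lemma EO_complete:
  assumes c: "Complete_Lattice.complete_lattice (ea_order E)" and A: "A \<subseteq> carrier (EO E)"
  shows "\<exists>i. greatest (EO E) i (Lower (EO E) A)" "\<exists>s. least (EO E) s (Upper (EO E) A)"
proof -
  have inf: "\<exists>i. greatest (EO E) i (Lower (EO E) A)" if A: "A \<subseteq> carrier (EO E)" for A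
  proof (rule EO_inf_exists[OF A])
    fix t :: real
    have "(\<lambda>x. x {..<t}) ` A \<subseteq> carrier E" using A by auto
    then show "\<exists>s. is_sup s ((\<lambda>x. x {..<t}) ` A)"
      using complete_lattice.sup_exists[OF c] is_sup_iff_least by simp
  qed
  show "\<exists>i. greatest (EO E) i (Lower (EO E) A)" using inf[OF A] .
  show "\<exists>s. least (EO E) s (Upper (EO E) A)"
    using A obs_neg_closed by (intro EO_sup_exists[OF A inf]) blast
qed

lemma involution_complete_lattice_EO:
  assumes "Complete_Lattice.complete_lattice (ea_order E)"
  shows "involution_complete_lattice (EO E) obs_neg"
proof -
  interpret involution_lattice "EO E" obs_neg by (rule involution_lattice_EO)
  show ?thesis by unfold_locales (use EO_complete[OF assms] in auto)
qed

end

section \<open>Question observables\<close>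

context effect_algebra
begin

lemma psum_trivial [simp]:
  assumes "a \<in> carrier E"
  shows "psum E a \<zero> = Some a" "psum E \<zero> a = Some a"
    "psum E a (a\<^sup>\<sim>) = Some \<one>" "psum E (a\<^sup>\<sim>) a = Some \<one>"
  using assms oadd_zero[of a] oadd_zero_left[of a] oadd_compl[of a] psum_commute[of a "a\<^sup>\<sim>"]
  by (simp_all add: oadd_eq)

text \<open>The value depends only on which of the two points \<open>0\<close> and \<open>1\<close> belong to the set; along an increasing
sequence this is eventually constant.\<close>
lemma observable_question:
  assumes a: "a \<in> carrier E" shows "observable E (question E a)"
  unfolding observable_def
proof (intro conjI ballI allI impI)
  show "question E a \<in> sets borel \<rightarrow>\<^sub>E carrier E" using a by (auto simp: question_def)
  show "question E a UNIV = \<one>" by (simp add: question_def)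
  show psum: "psum E (question E a B) (question E a C) = Some (question E a (B \<union> C))"
    if "B \<in> sets borel" "C \<in> sets borel" "B \<inter> C = {}" for B C
    using that a by (auto simp: question_def)
  have mono: "question E a B \<preceq> question E a C" if "B \<in> sets borel" "C \<in> sets borel" "B \<subseteq> C" for B C
    using that a by (auto simp: question_def)
  fix B :: "nat \<Rightarrow> real set" assume B: "(\<forall>i. B i \<in> sets borel) \<and> (\<forall>i. B i \<subseteq> B (Suc i))"
  have inc: "incseq B" using B by (simp add: incseq_SucI)
  have U: "(\<Union>i. B i) \<in> sets borel" using B by auto
  have "\<exists>n. {0,1} \<inter> (\<Union>i. B i) \<subseteq> B n"
  proof -
    have ex: "\<exists>n. c \<in> (\<Union>i. B i) \<longrightarrow> c \<in> B n" for c by blast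
    obtain m where m: "0 \<in> (\<Union>i. B i) \<longrightarrow> 0 \<in> B m" using ex by blast
    obtain n where n: "1 \<in> (\<Union>i. B i) \<longrightarrow> 1 \<in> B n" using ex by blast
    have "B m \<subseteq> B (max m n)" "B n \<subseteq> B (max m n)" using inc by (simp_all add: incseq_def)
    then show ?thesis using m n by (intro exI[of _ "max m n"]) blast
  qed
  then obtain n where n: "{0,1} \<inter> (\<Union>i. B i) \<subseteq> B n" ..
  have "0 \<in> B n \<longleftrightarrow> 0 \<in> (\<Union>i. B i)" "1 \<in> B n \<longleftrightarrow> 1 \<in> (\<Union>i. B i)" using n by blast+
  then have eq: "question E a (\<Union>i. B i) = question E a (B n)"
    using U B by (simp only: question_def restrict_apply')
  have R: "range (\<lambda>i. question E a (B i)) \<subseteq> carrier E" using mono[of "B _" "B _"] B leq_carrier by blast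
  show "least (ea_order E) (question E a (\<Union>i. B i)) (Upper (ea_order E) (range (\<lambda>i. question E a (B i))))"
    unfolding least_Upper_iff[OF R]
  proof (intro conjI ballI impI)
    show "question E a (\<Union>i. B i) \<in> carrier E" using R eq by auto
    show "c \<preceq> question E a (\<Union>i. B i)" if "c \<in> range (\<lambda>i. question E a (B i))" for c
      using that mono[OF _ U] B by blast
  qed (use eq in auto)
qed

lemma question_lessThan:
  "question E a {..<t} = (if t \<le> 0 then \<zero> else if t \<le> 1 then a\<^sup>\<sim> else \<one>)"
  by (auto simp: question_def)

lemma sharp_element_iff:
  assumes "a \<in> carrier E"
  shows "sharp_element E a \<longleftrightarrow> (\<forall>u. u \<preceq> a \<longrightarrow> u \<preceq> a\<^sup>\<sim> \<longrightarrow> u = \<zero>)"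
proof -
  have "{a, a\<^sup>\<sim>} \<subseteq> carrier E" using assms by simp
  then show ?thesis unfolding sharp_element_def
    using assms leq_zero leq_carrier(1) by (auto simp: greatest_Lower_iff)
qed

lemma sharp_element_compl: "a \<in> carrier E \<Longrightarrow> sharp_element E a \<Longrightarrow> sharp_element E (a\<^sup>\<sim>)"
  by (simp add: sharp_element_iff)

lemma sharp_observable_question_iff:
  assumes a: "a \<in> carrier E"
  shows "sharp_observable E (question E a) \<longleftrightarrow> sharp_element E a"
proof
  assume "sharp_observable E (question E a)"
  then have "sharp_element E (question E a {1})" by (simp add: sharp_observable_def)
  then show "sharp_element E a" by (simp add: question_def)
next
  assume "sharp_element E a"
  moreover have "sharp_element E \<zero>" "sharp_element E \<one>"
    using leq_zero by (auto simp: sharp_element_iff)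
  ultimately show "sharp_observable E (question E a)"
    using observable_question[OF a] sharp_element_compl[OF a] by (simp add: sharp_observable_def question_def)
qed

end

context sigma_lattice_ea
begin

lemma question_EO [simp]: "a \<in> carrier E \<Longrightarrow> question E a \<in> carrier (EO E)"
  using observable_question by (simp add: EO_carrier_iff question_def)

lemma le_question_iff:
  assumes x: "x \<in> carrier (EO E)" and a: "a \<in> carrier E"
  shows "le (EO E) x (question E a) \<longleftrightarrow> (\<forall>t. 0 < t \<longrightarrow> t \<le> 1 \<longrightarrow> a\<^sup>\<sim> \<preceq> x {..<t})"
  using assms EO_upper[OF x] EO_closed[OF x] by (auto simp: EO_le_iff question_lessThan)

lemma question_le_iff:
  assumes x: "x \<in> carrier (EO E)" and a: "a \<in> carrier E"
  shows "le (EO E) (question E a) x \<longleftrightarrow> (\<forall>t. 0 < t \<longrightarrow> t \<le> 1 \<longrightarrow> x {..<t} \<preceq> a\<^sup>\<sim>)"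
  using assms EO_lower[OF x] EO_closed[OF x] by (auto simp: EO_le_iff question_lessThan)

lemma obs_neg_question:
  assumes "a \<in> carrier E" shows "obs_neg (question E a) = question E (a\<^sup>\<sim>)"
proof (rule extensionalityI)
  fix B :: "real set" assume B: "B \<in> sets borel"
  have "(\<lambda>t::real. 1 - t) -` B \<in> sets borel"
    using measurable_sets[OF _ B, of "\<lambda>t. 1 - t" borel] by simp
  then show "obs_neg (question E a) B = question E (a\<^sup>\<sim>) B"
    using B assms by (simp add: obs_neg_apply question_def)
qed (auto simp: obs_neg_def obs_fun_def question_def)

lemma question_meet:
  assumes a: "a \<in> carrier E" and b: "b \<in> carrier E"
  shows "question E a \<sqinter>\<^bsub>EO E\<^esub> question E b = question E (a \<^bold>\<and> b)"
proof -
  have ab: "a \<^bold>\<and> b \<in> carrier E" using assms by simp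
  have "greatest (EO E) (question E (a \<^bold>\<and> b)) (Lower (EO E) {question E a, question E b})"
    unfolding greatest_def
  proof (intro conjI ballI)
    show "question E (a \<^bold>\<and> b) \<in> Lower (EO E) {question E a, question E b}"
      using a b ab compl_antimono[of "a \<^bold>\<and> b" a] compl_antimono[of "a \<^bold>\<and> b" b]
      by (auto simp: Lower_def le_question_iff question_lessThan)
    fix z assume "z \<in> Lower (EO E) {question E a, question E b}"
    then have z: "z \<in> carrier (EO E)" "le (EO E) z (question E a)" "le (EO E) z (question E b)"
      using a b by (auto simp: Lower_def)
    then show "le (EO E) z (question E (a \<^bold>\<and> b))"
      using a b ab by (auto simp: le_question_iff compl_of_meet intro: join_least)
  qed (auto simp: Lower_def)
  then show ?thesis unfolding Lattice.meet_def by (rule greatest_EO_unique)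
qed

lemma question_join:
  assumes a: "a \<in> carrier E" and b: "b \<in> carrier E"
  shows "question E a \<squnion>\<^bsub>EO E\<^esub> question E b = question E (a \<^bold>\<or> b)"
proof -
  have ab: "a \<^bold>\<or> b \<in> carrier E" using assms by simp
  have dm: "(a \<^bold>\<or> b)\<^sup>\<sim> = a\<^sup>\<sim> \<^bold>\<and> b\<^sup>\<sim>" using compl_of_meet[of "a\<^sup>\<sim>" "b\<^sup>\<sim>"] a b by (metis compl_closed compl_compl meet(1))
  have "least (EO E) (question E (a \<^bold>\<or> b)) (Upper (EO E) {question E a, question E b})"
    unfolding least_def
  proof (intro conjI ballI)
    show "question E (a \<^bold>\<or> b) \<in> Upper (EO E) {question E a, question E b}"
      using a b ab compl_antimono[of a "a \<^bold>\<or> b"] compl_antimono[of b "a \<^bold>\<or> b"]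
      by (auto simp: Upper_def le_question_iff question_lessThan)
    fix z assume "z \<in> Upper (EO E) {question E a, question E b}"
    then have z: "z \<in> carrier (EO E)" "le (EO E) (question E a) z" "le (EO E) (question E b) z"
      using a b by (auto simp: Upper_def)
    then show "le (EO E) (question E (a \<^bold>\<or> b)) z"
      using a b ab by (auto simp: question_le_iff dm intro: meet_greatest)
  qed (auto simp: Upper_def)
  then show ?thesis unfolding Lattice.join_def by (rule least_EO_unique)
qed

lemma sharp_element_meet: "a \<in> carrier E \<Longrightarrow> sharp_element E a \<longleftrightarrow> a \<^bold>\<and> a\<^sup>\<sim> = \<zero>"
  unfolding sharp_element_iff
  using meet_greatest[of _ a "a\<^sup>\<sim>"] leq_zero meet(2,3)[of a "a\<^sup>\<sim>"] compl_closed[of a] by metis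

lemma sharp_question_meet_iff:
  assumes a: "a \<in> carrier E"
  shows "sharp_element E a \<longleftrightarrow> question E a \<sqinter>\<^bsub>EO E\<^esub> obs_neg (question E a) = question E \<zero>"
proof -
  have "question E (a \<^bold>\<and> a\<^sup>\<sim>) = question E \<zero> \<Longrightarrow> a \<^bold>\<and> a\<^sup>\<sim> = \<zero>"
    by (drule fun_cong[of _ _ "{1}"]) (simp add: question_def)
  then have "question E (a \<^bold>\<and> a\<^sup>\<sim>) = question E \<zero> \<longleftrightarrow> a \<^bold>\<and> a\<^sup>\<sim> = \<zero>" by metis
  then show ?thesis
    unfolding sharp_element_meet[OF a] obs_neg_question[OF a] question_meet[OF a compl_closed[OF a]] by blast
qed

lemma obs_fun_id: "obs_fun (\<lambda>t. t) x {..<t} = x {..<t}"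
  by (simp add: obs_fun_apply)

text \<open>The smaller function is the smaller one in the Olson order: \<open>min t (1 - t)\<close> lies below both \<open>t\<close> and \<open>1 - t\<close>.\<close>
lemma obs_fun_min_le:
  assumes x: "x \<in> carrier (EO E)"
  shows "le (EO E) (obs_fun (\<lambda>t. min t (1 - t)) x) (x \<sqinter>\<^bsub>EO E\<^esub> obs_neg x)"
proof -
  interpret EO: sigma_lattice "EO E" by (rule sigma_lattice_EO)
  note xo = EO_observable[OF x]
  have n: "obs_fun (\<lambda>t. 1 - t) x \<in> carrier (EO E)"
    using obs_neg_closed[OF x] by (simp only: obs_neg_def)
  have m: "(\<lambda>t::real. min t (1 - t)) \<in> borel_measurable borel" by measurable
  have g: "obs_fun (\<lambda>t. min t (1 - t)) x \<in> carrier (EO E)"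
    by (rule EO_obs_fun[OF x m]) auto
  have "le (EO E) (obs_fun (\<lambda>t. min t (1 - t)) x) x"
    using obs_fun_mono[OF xo m, of "\<lambda>t. t"] by (simp add: EO_le_iff g x obs_fun_id)
  moreover have "le (EO E) (obs_fun (\<lambda>t. min t (1 - t)) x) (obs_neg x)"
    using obs_fun_mono[OF xo m, of "\<lambda>t. 1 - t"] by (simp add: EO_le_iff g n obs_neg_def)
  ultimately show ?thesis by (rule EO.weak.meet_le[OF _ _ x obs_neg_closed[OF x] g])
qed

lemma le_obs_fun_max:
  assumes x: "x \<in> carrier (EO E)"
  shows "le (EO E) (x \<squnion>\<^bsub>EO E\<^esub> obs_neg x) (obs_fun (\<lambda>t. max t (1 - t)) x)"
proof -
  interpret EO: sigma_lattice "EO E" by (rule sigma_lattice_EO)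
  note xo = EO_observable[OF x]
  have n: "obs_fun (\<lambda>t. 1 - t) x \<in> carrier (EO E)"
    using obs_neg_closed[OF x] by (simp only: obs_neg_def)
  have m: "(\<lambda>t::real. max t (1 - t)) \<in> borel_measurable borel" by measurable
  have g: "obs_fun (\<lambda>t. max t (1 - t)) x \<in> carrier (EO E)"
    by (rule EO_obs_fun[OF x m]) auto
  have "le (EO E) x (obs_fun (\<lambda>t. max t (1 - t)) x)"
    using obs_fun_mono[OF xo _ m, of "\<lambda>t. t"] by (simp add: EO_le_iff g x obs_fun_id)
  moreover have "le (EO E) (obs_neg x) (obs_fun (\<lambda>t. max t (1 - t)) x)"
    using obs_fun_mono[OF xo _ m, of "\<lambda>t. 1 - t"] by (simp add: EO_le_iff g n obs_neg_def)
  ultimately show ?thesis by (rule EO.weak.join_le[OF _ _ x obs_neg_closed[OF x] g])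
qed

end

section \<open>The involution lattice of effect observables\<close>

theorem theorem4p5:
  fixes E :: "('a, 'm) effect_structure_scheme"
  assumes "effect_algebra E"
    and "sigma_lattice (ea_order E)"
  shows
    \<comment> \<open>(i)\<close>
    "(\<forall>x\<in>carrier (EO E). \<forall>y\<in>carrier (EO E).
        x \<sqsubseteq>\<^bsub>EO E\<^esub> y \<longrightarrow> obs_neg y \<sqsubseteq>\<^bsub>EO E\<^esub> obs_neg x) \<and>
     \<comment> \<open>(ii)\<close>
     (\<forall>x\<in>carrier (EO E). obs_neg (obs_neg x) = x) \<and>
     \<comment> \<open>(iii)\<close>
     obs_neg (question E (ea_zero E)) = question E (ea_one E) \<and>
     obs_neg (question E (ea_one E)) = question E (ea_zero E) \<and>
     \<comment> \<open>(iv), countable index sets\<close>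
     (\<forall>(A :: 'i set) (x :: 'i \<Rightarrow> real set \<Rightarrow> 'a).
        countable A \<and> (\<forall>\<alpha>\<in>A. x \<alpha> \<in> carrier (EO E)) \<longrightarrow>
          obs_neg (\<Sqinter>\<^bsub>EO E\<^esub> (x ` A)) = \<Squnion>\<^bsub>EO E\<^esub> ((\<lambda>\<alpha>. obs_neg (x \<alpha>)) ` A) \<and>
          obs_neg (\<Squnion>\<^bsub>EO E\<^esub> (x ` A)) = \<Sqinter>\<^bsub>EO E\<^esub> ((\<lambda>\<alpha>. obs_neg (x \<alpha>)) ` A)) \<and>
     \<comment> \<open>(v)\<close>
     (\<forall>a\<in>carrier E. obs_neg (question E a) = question E (ea_compl E a)) \<and>
     \<comment> \<open>(vi)\<close>
     (\<forall>a\<in>carrier E. \<forall>b\<in>carrier E.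
        question E a \<sqinter>\<^bsub>EO E\<^esub> question E b = question E (a \<sqinter>\<^bsub>ea_order E\<^esub> b) \<and>
        question E a \<squnion>\<^bsub>EO E\<^esub> question E b = question E (a \<squnion>\<^bsub>ea_order E\<^esub> b)) \<and>
     \<comment> \<open>(vii): both inequalities are reversed with respect to the source, which is refuted by
       \<open>x = question E (1/2)\<close> in the effect algebra of the real unit interval\<close>
     (\<forall>x\<in>carrier (EO E).
        obs_fun (\<lambda>t. min t (1 - t)) x \<sqsubseteq>\<^bsub>EO E\<^esub> x \<sqinter>\<^bsub>EO E\<^esub> obs_neg x \<and>
        x \<squnion>\<^bsub>EO E\<^esub> obs_neg x \<sqsubseteq>\<^bsub>EO E\<^esub> obs_fun (\<lambda>t. max t (1 - t)) x) \<and>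
     \<comment> \<open>(viii)\<close>
     (\<forall>a\<in>carrier E.
        (sharp_observable E (question E a) \<longleftrightarrow> sharp_element E a) \<and>
        (sharp_element E a \<longleftrightarrow>
           question E a \<sqinter>\<^bsub>EO E\<^esub> obs_neg (question E a) = question E (ea_zero E))) \<and>
     \<comment> \<open>the involution lattice of effect observables; countable infima and suprema exist\<close>
     involution_lattice (EO E) obs_neg \<and>
     sigma_lattice (EO E) \<and>
     \<comment> \<open>the case of a complete lattice effect algebra\<close>
     (Complete_Lattice.complete_lattice (ea_order E) \<longrightarrow>
        (\<forall>(A :: 'i set) (x :: 'i \<Rightarrow> real set \<Rightarrow> 'a).
           (\<forall>\<alpha>\<in>A. x \<alpha> \<in> carrier (EO E)) \<longrightarrow>
             obs_neg (\<Sqinter>\<^bsub>EO E\<^esub> (x ` A)) = \<Squnion>\<^bsub>EO E\<^esub> ((\<lambda>\<alpha>. obs_neg (x \<alpha>)) ` A) \<and>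
             obs_neg (\<Squnion>\<^bsub>EO E\<^esub> (x ` A)) = \<Sqinter>\<^bsub>EO E\<^esub> ((\<lambda>\<alpha>. obs_neg (x \<alpha>)) ` A)) \<and>
        involution_complete_lattice (EO E) obs_neg)"
proof -
  interpret sigma_lattice_ea E by (rule sigma_lattice_ea.intro[OF assms])
  have countable: "obs_neg (\<Sqinter>\<^bsub>EO E\<^esub> (x ` A)) = \<Squnion>\<^bsub>EO E\<^esub> ((\<lambda>\<alpha>. obs_neg (x \<alpha>)) ` A) \<and>
      obs_neg (\<Squnion>\<^bsub>EO E\<^esub> (x ` A)) = \<Sqinter>\<^bsub>EO E\<^esub> ((\<lambda>\<alpha>. obs_neg (x \<alpha>)) ` A)"
    if "countable A \<and> (\<forall>\<alpha>\<in>A. x \<alpha> \<in> carrier (EO E))" for A :: "'i set" and x :: "'i \<Rightarrow> real set \<Rightarrow> 'a"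
  proof -
    have "x ` A \<subseteq> carrier (EO E)" "countable (x ` A)" using that by auto
    then show ?thesis using EO_de_morgan[of A x] EO_countable_inf EO_countable_sup that by blast
  qed
  have complete: "obs_neg (\<Sqinter>\<^bsub>EO E\<^esub> (x ` A)) = \<Squnion>\<^bsub>EO E\<^esub> ((\<lambda>\<alpha>. obs_neg (x \<alpha>)) ` A) \<and>
      obs_neg (\<Squnion>\<^bsub>EO E\<^esub> (x ` A)) = \<Sqinter>\<^bsub>EO E\<^esub> ((\<lambda>\<alpha>. obs_neg (x \<alpha>)) ` A)"
    if "Complete_Lattice.complete_lattice (ea_order E)" "\<forall>\<alpha>\<in>A. x \<alpha> \<in> carrier (EO E)"
    for A :: "'i set" and x :: "'i \<Rightarrow> real set \<Rightarrow> 'a"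
  proof -
    have "x ` A \<subseteq> carrier (EO E)" using that by auto
    then show ?thesis using EO_de_morgan[of A x] EO_complete[OF that(1)] that by blast
  qed
  show ?thesis
  proof (intro conjI allI ballI impI)
    show "obs_neg (question E (ea_zero E)) = question E (ea_one E)"
      "obs_neg (question E (ea_one E)) = question E (ea_zero E)"
      by (simp_all add: obs_neg_question)
  qed (fact obs_neg_antitone obs_neg_neg obs_neg_question question_meet question_join
      obs_fun_min_le le_obs_fun_max sharp_observable_question_iff sharp_question_meet_iff
      involution_lattice_EO sigma_lattice_EO involution_complete_lattice_EO
      conjunct1[OF countable] conjunct2[OF countable] conjunct1[OF complete] conjunct2[OF complete])+
qed

end
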